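(* Let $\lambda\in\mathbb R$ and let $v$ satisfy Assumptions A and B at $\lambda$ (see context), with exponent $\rho_0>1$ in Assumption A. Put $\rho=\tfrac32\min\{\rho_0-1,1\}>0$. Then there are $\hbar_0>0$ and, for every $x_1\in(x_-,x_+)$, a constant $C$ (independent of $x$ and $\hbar$) such that for all $\hbar\in(0,\hbar_0]$ the following holds. (i) For $\pm x\ge\pm x_\pm$ the solutions $u_\pm(x)=u_\pm(x;\lambda,\hbar)$ admit the representations $$u_\pm(x)=|\xi_\pm'(x)|^{-1/2}\,\mathrm{Ai}\big(\hbar^{-2/3}\xi_\pm(x)\big)\,\big(1+\varepsilon_\pm(x;\hbar)\big),\qquad |\varepsilon_\pm(x;\hbar)|\le C\hbar\,(1+|\xi_\pm(x)|)^{-\rho}.$$ (ii) For $x\in[x_1,x_+]$ in the case of $u_+$, and for $x\in[x_-,x_1]$ in the case of $u_-$, $$\Big|u_\pm(x)-|\xi_\pm'(x)|^{-1/2}\,\mathrm{Ai}\big(\hbar^{-2/3}\xi_\pm(x)\big)\Big|\le C\,\hbar^{7/6}\big(\hbar^{2/3}+|x-x_\pm|\big)^{-1/4}.$$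
   Context: Let $v:\mathbb R\to\mathbb R$, $\lambda\in\mathbb R$, $q(x)=v(x)-\lambda$. Assumption A at $\lambda$: $v\in C^2(\mathbb R)$ and, for some $\rho_0>1$, the function $\big(|q(x)|^{-3}q'(x)^2+q(x)^{-2}|q''(x)|\big)\big|\int_0^x|q(y)|^{1/2}dy\big|^{\rho_0}$ is bounded for sufficiently large $|x|$. Assumption B at $\lambda$: the equation $v(x)=\lambda$ has exactly two solutions $x_-<x_+$ (with $x_\pm=x_\pm(\lambda)$); $v(x)<\lambda$ for $x\in(x_-,x_+)$, $v(x)>\lambda$ for $x\notin[x_-,x_+]$, $\liminf_{|x|\to\infty}v(x)>\lambda$; $v$ is of class $C^3$ in some neighborhoods of $x_\pm$ and $\pm v'(x_\pm)>0$. For $\hbar>0$, $u_\pm(x)=u_\pm(x;\lambda,\hbar)$ denotes the unique solution of $-u''(x)+\hbar^{-2}q(x)u(x)=0$ on $\mathbb R$ such that $$u_\pm(x)=2^{-1}\pi^{-1/2}\hbar^{1/6}q(x)^{-1/4}\exp\Big(\mp\hbar^{-1}\int_{x_\pm}^x q(y)^{1/2}dy\Big)(1+o(1)),\quad x\to\pm\infty.$$ The functions $\xi_\pm$ are defined by $\xi_+(x)=\big(\tfrac32\int_{x_+}^x q(y)^{1/2}dy\big)^{2/3}$ for $x\ge x_+$, $\xi_+(x)=-\big(\tfrac32\int_x^{x_+}|q(y)|^{1/2}dy\big)^{2/3}$ for $x_-<x\le x_+$; $\xi_-(x)=\big(\tfrac32\int_x^{x_-}q(y)^{1/2}dy\big)^{2/3}$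 for $x\le x_-$, $\xi_-(x)=-\big(\tfrac32\int_{x_-}^x|q(y)|^{1/2}dy\big)^{2/3}$ for $x_-\le x<x_+$. They are of class $C^3$ on their domains and $\pm\xi_\pm'>0$. $\mathrm{Ai}$ is the standard Airy function, $\mathrm{Ai}(t)\sim 2^{-1}\pi^{-1/2}t^{-1/4}e^{-2t^{3/2}/3}$ as $t\to+\infty$. *)

theory Defs
  imports "HOL-Analysis.Analysis" "HOL-Library.Landau_Symbols"
begin

text \<open>Class \<open>C\<^sup>k\<close> on an open set \<open>S\<close> of reals (the derivatives are two-sided).\<close>

definition C_k_on :: "nat \<Rightarrow> (real \<Rightarrow> real) \<Rightarrow> real set \<Rightarrow> bool" where
  "C_k_on k f S \<longleftrightarrow>
     (\<forall>j<k. \<forall>x\<in>S. (deriv ^^ j) f differentiable (at x)) \<and>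
     (\<forall>j\<le>k. continuous_on S ((deriv ^^ j) f))"

definition assumption_A :: "(real \<Rightarrow> real) \<Rightarrow> real \<Rightarrow> real \<Rightarrow> bool" where
  "assumption_A v lam rho0 \<longleftrightarrow>
     C_k_on 2 v UNIV \<and> rho0 > 1 \<and>
     (let q = (\<lambda>x. v x - lam) in
      \<exists>M R. \<forall>x. \<bar>x\<bar> \<ge> R \<longrightarrow>
        \<bar>((deriv q x)\<^sup>2 / \<bar>q x\<bar> ^ 3 + \<bar>deriv (deriv q) x\<bar> / (q x)\<^sup>2)
           * \<bar>LBINT y=0..x. sqrt \<bar>q y\<bar>\<bar> powr rho0\<bar> \<le> M)"

definition assumption_B :: "(real \<Rightarrow> real) \<Rightarrow> real \<Rightarrow> real \<Rightarrow> real \<Rightarrow> bool" where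
  "assumption_B v lam xm xp \<longleftrightarrow>
     xm < xp \<and> {x. v x = lam} = {xm, xp} \<and>
     (\<forall>x\<in>{xm<..<xp}. v x < lam) \<and>
     (\<forall>x. x \<notin> {xm..xp} \<longrightarrow> v x > lam) \<and>
     Liminf at_infinity (\<lambda>x. ereal (v x)) > ereal lam \<and>
     (\<exists>U. open U \<and> xm \<in> U \<and> C_k_on 3 v U) \<and>
     (\<exists>U. open U \<and> xp \<in> U \<and> C_k_on 3 v U) \<and>
     deriv v xp > 0 \<and> deriv v xm < 0"

definition schroedinger_sol :: "(real \<Rightarrow> real) \<Rightarrow> real \<Rightarrow> real \<Rightarrow> (real \<Rightarrow> real) \<Rightarrow> bool" where
  "schroedinger_sol v lam h u \<longleftrightarrow>
     C_k_on 2 u UNIV \<and>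
     (\<forall>x. - deriv (deriv u) x + (v x - lam) * u x / h\<^sup>2 = 0)"

text \<open>The integrals below are oriented: the one in \<open>u_minus\<close> is negative for \<open>x < xm\<close>, so that
  both solutions decay.\<close>

definition u_plus :: "(real \<Rightarrow> real) \<Rightarrow> real \<Rightarrow> real \<Rightarrow> real \<Rightarrow> real \<Rightarrow> real" where
  "u_plus v lam xp h = (THE u. schroedinger_sol v lam h u \<and>
     u \<sim>[at_top] (\<lambda>x. 1 / (2 * sqrt pi) * h powr (1/6) * (v x - lam) powr (-1/4)
        * exp (- (1 / h) * (LBINT y=xp..x. sqrt (v y - lam)))))"

definition u_minus :: "(real \<Rightarrow> real) \<Rightarrow> real \<Rightarrow> real \<Rightarrow> real \<Rightarrow> real \<Rightarrow> real" where
  "u_minus v lam xm h = (THE u. schroedinger_sol v lam h u \<and>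
     u \<sim>[at_bot] (\<lambda>x. 1 / (2 * sqrt pi) * h powr (1/6) * (v x - lam) powr (-1/4)
        * exp ((1 / h) * (LBINT y=xm..x. sqrt (v y - lam)))))"

text \<open>\<open>xi_plus\<close> is meant on the interval from \<open>xm\<close> (excluded) to infinity, and \<open>xi_minus\<close> on that
  from minus infinity to \<open>xp\<close> (excluded).\<close>

definition xi_plus :: "(real \<Rightarrow> real) \<Rightarrow> real \<Rightarrow> real \<Rightarrow> real \<Rightarrow> real" where
  "xi_plus v lam xp x =
     (if x \<ge> xp then (3/2 * (LBINT y=xp..x. sqrt (v y - lam))) powr (2/3)
      else - ((3/2 * (LBINT y=x..xp. sqrt \<bar>v y - lam\<bar>)) powr (2/3)))"

definition xi_minus :: "(real \<Rightarrow> real) \<Rightarrow> real \<Rightarrow> real \<Rightarrow> real \<Rightarrow> real" where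
  "xi_minus v lam xm x =
     (if x \<le> xm then (3/2 * (LBINT y=x..xm. sqrt (v y - lam))) powr (2/3)
      else - ((3/2 * (LBINT y=xm..x. sqrt \<bar>v y - lam\<bar>)) powr (2/3)))"

text \<open>The Airy function: the recessive solution of Airy's equation \<open>w'' = t w\<close>, which is
  determined uniquely, normalization included, by its asymptotics at \<open>+\<infinity>\<close>.\<close>

definition Ai :: "real \<Rightarrow> real" where
  "Ai = (THE w. C_k_on 2 w UNIV \<and> (\<forall>t. deriv (deriv w) t = t * w t) \<and>
     w \<sim>[at_top] (\<lambda>t. 1 / (2 * sqrt pi) * t powr (-1/4) * exp (- 2 * t powr (3/2) / 3)))"

end

theory Submission
  imports Defs "HOL-Real_Asymp.Real_Asymp"
begin

text \<open>
  Put \<open>\<delta> = h\<^bsup>2/3\<^esup>\<close> and \<open>\<psi> = \<bar>\<xi>'\<bar>\<^bsup>-1/2\<^esup>\<close>. The Liouville transformation shows that \<open>A = \<psi> Ai (\<xi> / \<delta>)\<close> solves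
  \<open>A'' = (q / h\<^sup>2 + \<psi>'' / \<psi>) A\<close>, and Assumption A bounds \<open>\<psi>'' / \<psi>\<close> by \<open>C \<xi>'\<^sup>2 (1 + \<xi>)\<^bsup>- \<rho> - 1/2\<^esup>\<close>. Writing
  \<open>u = A (1 + \<epsilon>)\<close> turns the equation for \<open>u\<close> into \<open>(A\<^sup>2 \<epsilon>')' = - (\<psi>'' / \<psi>) A\<^sup>2 (1 + \<epsilon>)\<close>, so any \<open>E\<close> decreasing to \<open>0\<close>
  with \<open>(A\<^sup>2 E')' \<ge> \<bar>\<psi>'' / \<psi>\<bar> A\<^sup>2\<close> and \<open>E \<le> 1/2\<close> gives \<open>\<bar>\<epsilon>\<bar> \<le> 2 E\<close> for the recessive solution; since
  \<open>- Ai' / Ai\<close> is at least of order \<open>(1 + t)\<^bsup>1/2\<^esup>\<close>, the choice \<open>E = K h (1 + (\<delta> + \<xi>)\<^bsup>1/2\<^esup>)\<^bsup>-2\<rho>\<^esup>\<close> works. The same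
  argument applied to \<open>t\<^bsup>-1/4\<^esup> exp (- 2 t\<^bsup>3/2\<^esup> / 3)\<close> constructs the Airy function. Beyond the turning point
  the difference \<open>u / \<psi> - Ai (\<xi> / \<delta>)\<close> solves a perturbed Airy equation with small data and is controlled by a
  corrected adiabatic energy. The solution \<open>u_minus\<close> is treated by the reflection \<open>x \<mapsto> - x\<close>.
\<close>

section \<open>Linear equations of second order\<close>

text \<open>A Volterra equation for \<epsilon> would call for a second Airy solution and bounds on a
  product kernel; a monotone supersolution needs only the lower bound for - Ai' / Ai. The exponent
  \<rho> has two sources. At infinity \<psi>'' \<psi>^3 consists of - 5 / (16 \<xi>^2) and of terms
  that Assumption A bounds by a multiple of \<xi>^(1 - 3 rho0 / 2), so it decays like \<xi>^(-\<nu>)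
  with \<nu> = min (2, 3 rho0 / 2 - 1) = \<rho> + 1/2; integration against \<xi>^(-1/2) costs the
  half. At the turning point these pieces are singular although their sum is not. There \<xi> / q is
  shown to be of class C^2 by means of Hadamard quotients, and this is where the third derivative of
  v enters. The shift by \<delta> in E fits the scaling: (1 + \<xi> / \<delta>)^(1/2) = ((\<delta> +
  \<xi>) / \<delta>)^(1/2) cancels the inverse square root produced by differentiating E, and
  \<delta>^(3/2) = h makes the constants uniform in h. Ai, u_plus and u_minus are definite
  descriptions, so uniqueness of recessive solutions is needed before any estimate can be attached
  to them.\<close>

lemma DERIV_le_imp_diff_le:
  fixes f g :: "real \<Rightarrow> real"
  assumes "a \<le> b"
    and "\<And>x. a \<le> x \<Longrightarrow> x \<le> b \<Longrightarrow> (f has_real_derivative f' x) (at x)"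
    and "\<And>x. a \<le> x \<Longrightarrow> x \<le> b \<Longrightarrow> (g has_real_derivative g' x) (at x)"
    and "\<And>x. a \<le> x \<Longrightarrow> x \<le> b \<Longrightarrow> f' x \<le> g' x"
  shows "f b - f a \<le> g b - g a"
proof -
  have "(\<lambda>x. g x - f x) a \<le> (\<lambda>x. g x - f x) b"
    by (rule DERIV_nonneg_imp_nondecreasing[OF assms(1)])
      (use assms in \<open>auto intro!: exI derivative_eq_intros\<close>)
  then show ?thesis by simp
qed

lemma DERIV_abs_le_imp_diff_le:
  fixes f g :: "real \<Rightarrow> real"
  assumes "a \<le> b"
    and "\<And>x. a \<le> x \<Longrightarrow> x \<le> b \<Longrightarrow> (f has_real_derivative f' x) (at x)"
    and "\<And>x. a \<le> x \<Longrightarrow> x \<le> b \<Longrightarrow> (g has_real_derivative g' x) (at x)"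
    and "\<And>x. a \<le> x \<Longrightarrow> x \<le> b \<Longrightarrow> \<bar>f' x\<bar> \<le> g' x"
  shows "\<bar>f b - f a\<bar> \<le> g b - g a"
proof -
  have "f b - f a \<le> g b - g a"
    by (rule DERIV_le_imp_diff_le[OF assms(1-3)]) (use assms(4) in \<open>auto simp: abs_le_iff\<close>)
  moreover have "- f b - - f a \<le> g b - g a"
    by (rule DERIV_le_imp_diff_le[OF assms(1) DERIV_minus[OF assms(2)] assms(3)])
      (use assms(4) in \<open>auto simp: abs_le_iff\<close>)
  ultimately show ?thesis by linarith
qed

text \<open>One step of the Picard iteration below: each antidifferentiation raises the power by one
  and divides by the new exponent, which accumulates to a factorial.\<close>

lemma DERIV_power_bound:
  fixes F f :: "real \<Rightarrow> real"
  assumes F: "\<And>x. (F has_real_derivative f x) (at x)" and F0: "F x0 = 0"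
    and f: "\<And>x. \<bar>x - x0\<bar> \<le> N \<Longrightarrow> \<bar>f x\<bar> \<le> c * \<bar>x - x0\<bar> ^ k"
    and x: "\<bar>x - x0\<bar> \<le> N"
  shows "\<bar>F x\<bar> \<le> c * \<bar>x - x0\<bar> ^ Suc k / real (Suc k)"
proof (cases "x \<ge> x0")
  case True
  have "\<bar>F x - F x0\<bar> \<le> c * (x - x0) ^ Suc k / real (Suc k) - c * (x0 - x0) ^ Suc k / real (Suc k)"
  proof (rule DERIV_abs_le_imp_diff_le[OF True F])
    fix y assume y: "x0 \<le> y" "y \<le> x"
    show "((\<lambda>x. c * (x - x0) ^ Suc k / real (Suc k)) has_real_derivative c * (y - x0) ^ k) (at y)"
      by (auto intro!: derivative_eq_intros simp del: power_Suc)
    show "\<bar>f y\<bar> \<le> c * (y - x0) ^ k"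
      using f[of y] x y by (auto simp: abs_if split: if_splits)
  qed
  then show ?thesis using True F0 by simp
next
  case False
  then have le: "x \<le> x0" by simp
  have "\<bar>F x0 - F x\<bar> \<le> - (c * (x0 - x0) ^ Suc k / real (Suc k)) - - (c * (x0 - x) ^ Suc k / real (Suc k))"
  proof (rule DERIV_abs_le_imp_diff_le[OF le F])
    fix y assume y: "x \<le> y" "y \<le> x0"
    show "((\<lambda>x. - (c * (x0 - x) ^ Suc k / real (Suc k))) has_real_derivative c * (x0 - y) ^ k) (at y)"
      by (auto intro!: derivative_eq_intros simp del: power_Suc)
    have "\<bar>y - x0\<bar> = x0 - y" using y by simp
    then show "\<bar>f y\<bar> \<le> c * (x0 - y) ^ k"
      using f[of y] x y by simp
  qed
  then show ?thesis using False F0 by simp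
qed

lemma antiderivative_exists:
  fixes f :: "real \<Rightarrow> real"
  assumes "continuous_on UNIV f"
  shows "\<exists>F. F x0 = 0 \<and> (\<forall>x. (F has_real_derivative f x) (at x))"
proof -
  have "\<exists>F. \<forall>x::real. -\<infinity> < ereal x \<longrightarrow> ereal x < \<infinity> \<longrightarrow> (F has_vector_derivative f x) (at x)"
    by (rule einterval_antiderivative)
      (use assms in \<open>auto simp: continuous_on_eq_continuous_within\<close>)
  then obtain F where "\<And>x. (F has_real_derivative f x) (at x)"
    by (auto simp: has_real_derivative_iff_has_vector_derivative)
  then show ?thesis
    by (intro exI[of _ "\<lambda>x. F x - F x0"]) (auto intro!: derivative_eq_intros)
qed

text \<open>The derivative is a second argument, so that Cauchy data and Wronskians can be formed
  without \<open>deriv\<close>.\<close>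

definition linear_ode_sol :: "(real \<Rightarrow> real) \<Rightarrow> (real \<Rightarrow> real) \<Rightarrow> (real \<Rightarrow> real) \<Rightarrow> bool" where
  "linear_ode_sol Q u u' \<longleftrightarrow>
     (\<forall>x. (u has_real_derivative u' x) (at x) \<and> (u' has_real_derivative Q x * u x) (at x))"

lemma linear_ode_solD:
  assumes "linear_ode_sol Q u u'"
  shows "(u has_real_derivative u' x) (at x)" "(u' has_real_derivative Q x * u x) (at x)"
  using assms by (auto simp: linear_ode_sol_def)

lemma linear_ode_sol_lincomb:
  assumes "linear_ode_sol Q u u'" "linear_ode_sol Q w w'"
  shows "linear_ode_sol Q (\<lambda>x. a * u x + b * w x) (\<lambda>x. a * u' x + b * w' x)"
  using assms unfolding linear_ode_sol_def
  by (auto intro!: derivative_eq_intros simp: algebra_simps)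

text \<open>Successive approximation. On a ball where \<bar>Q\<bar> \<le> M the n-th correction is
  at most B * M^n * \<bar>x - x0\<bar>^(2n) / (2n)!, so the series converges on every ball and the
  solution is global.\<close>

lemma linear_ode_exists:
  fixes Q :: "real \<Rightarrow> real"
  assumes Q: "continuous_on UNIV Q"
  shows "\<exists>u u'. linear_ode_sol Q u u' \<and> u x0 = a \<and> u' x0 = b"
proof -
  define J where "J f = (SOME F. F x0 = 0 \<and> (\<forall>x. (F has_real_derivative f x) (at x)))"
    for f :: "real \<Rightarrow> real"
  have J: "J f x0 = 0 \<and> (\<forall>x. (J f has_real_derivative f x) (at x))" if "continuous_on UNIV f" for f
    unfolding J_def by (rule someI_ex[OF antiderivative_exists[OF that]])
  define z where "z = rec_nat (\<lambda>x. a + b * (x - x0)) (\<lambda>_ f. J (J (\<lambda>x. Q x * f x)))"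
  define z' where "z' n = (case n of 0 \<Rightarrow> (\<lambda>x. b) | Suc m \<Rightarrow> J (\<lambda>x. Q x * z m x))" for n
  define z'' where "z'' n = (case n of 0 \<Rightarrow> (\<lambda>x. 0) | Suc m \<Rightarrow> (\<lambda>x. Q x * z m x))" for n
  have z_0: "z 0 = (\<lambda>x. a + b * (x - x0))" and z_Suc: "z (Suc n) = J (J (\<lambda>x. Q x * z n x))" for n
    by (simp_all add: z_def)
  have cont: "continuous_on UNIV f" if "\<And>x. (f has_real_derivative f' x) (at x)" for f f' :: "real \<Rightarrow> real"
    using that by (auto simp: continuous_on_eq_continuous_within intro!: DERIV_isCont)
  have Jc: "continuous_on UNIV (J f)" if "continuous_on UNIV f" for f
    by (rule cont) (use J[OF that] in blast)
  have zc: "continuous_on UNIV (z n)" for n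
  proof (induction n)
    case 0 then show ?case by (simp add: z_0 continuous_intros)
  next
    case (Suc n)
    then have "continuous_on UNIV (\<lambda>x. Q x * z n x)" by (intro continuous_intros Q)
    then have "continuous_on UNIV (J (\<lambda>x. Q x * z n x))" by (rule Jc)
    then show ?case unfolding z_Suc by (rule Jc)
  qed
  have c: "continuous_on UNIV (\<lambda>x. Q x * z n x)" for n by (intro continuous_intros Q zc)
  have dz': "(z' n has_real_derivative z'' n x) (at x)" for n x
    using J[OF c] by (auto simp: z'_def z''_def split: nat.split)
  have dz: "(z n has_real_derivative z' n x) (at x)" for n x
  proof (cases n)
    case 0 then show ?thesis by (auto simp: z_0 z'_def intro!: derivative_eq_intros)
  next
    case (Suc m) then show ?thesis using J[OF cont[OF dz', of n]] by (simp add: z_Suc z'_def)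
  qed
  have z0: "z (Suc n) x0 = 0" "z' (Suc n) x0 = 0" for n
  proof -
    show "z' (Suc n) x0 = 0" using J[OF c] by (simp add: z'_def)
    show "z (Suc n) x0 = 0" using J[OF cont[OF dz', of "Suc n"]] by (simp add: z_Suc z'_def)
  qed
  have conv: "summable (\<lambda>n. z n x)" "((\<lambda>x. \<Sum>n. z n x) has_real_derivative (\<Sum>n. z' n x)) (at x)"
    "((\<lambda>x. \<Sum>n. z' n x) has_real_derivative (\<Sum>n. z'' n x)) (at x)" for x
  proof -
    \<comment> \<open>The extra 1 puts \<open>x\<close> into the interior of the ball, as termwise
      differentiation requires.\<close>
    define N where "N = \<bar>x - x0\<bar> + 1"
    define S where "S = cball x0 N"
    have S: "y \<in> S \<longleftrightarrow> \<bar>y - x0\<bar> \<le> N" for y by (auto simp: S_def dist_real_def)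
    have "compact S" by (simp add: S_def)
    then have "bounded (Q ` S)"
      by (intro compact_imp_bounded compact_continuous_image continuous_on_subset[OF Q]) auto
    then obtain M0 where "\<forall>y\<in>Q ` S. norm y \<le> M0" unfolding bounded_iff by blast
    then obtain M where M: "M \<ge> 1" "\<And>y. y \<in> S \<Longrightarrow> \<bar>Q y\<bar> \<le> M"
      by (metis image_eqI max.cobounded1 max.coboundedI2 real_norm_def max.commute)
    define B where "B = \<bar>a\<bar> + \<bar>b\<bar> * N"
    have N: "N \<ge> 1" by (simp add: N_def)
    have B: "B \<ge> 0" "\<bar>b\<bar> \<le> B" using N mult_left_mono[of 1 N "\<bar>b\<bar>"] by (auto simp: B_def)
    have bQ: "\<bar>Q y * z n y\<bar> \<le> (B * M ^ Suc n / fact (2*n)) * \<bar>y - x0\<bar> ^ (2*n)"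
      if "\<bar>z n y\<bar> \<le> B * M ^ n / fact (2*n) * \<bar>y - x0\<bar> ^ (2*n)" "y \<in> S" for n y
    proof -
      have "\<bar>Q y * z n y\<bar> \<le> M * (B * M ^ n / fact (2*n) * \<bar>y - x0\<bar> ^ (2*n))"
        unfolding abs_mult by (intro mult_mono that M) (use M in auto)
      then show ?thesis by (simp add: mult_ac)
    qed
    have b2: "\<bar>z n y\<bar> \<le> B * M ^ n / fact (2*n) * \<bar>y - x0\<bar> ^ (2*n)" if "y \<in> S" for n y
      using that
    proof (induction n arbitrary: y)
      case 0
      have "\<bar>a + b * (y - x0)\<bar> \<le> \<bar>a\<bar> + \<bar>b\<bar> * \<bar>y - x0\<bar>"
        by (metis abs_mult abs_triangle_ineq)
      also have "\<dots> \<le> B" unfolding B_def using 0 S by (intro add_mono mult_left_mono) auto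
      finally show ?case by (simp add: z_0)
    next
      case (Suc n)
      have "\<bar>z' (Suc n) y\<bar> \<le> (B * M ^ Suc n / fact (2*n)) * \<bar>y - x0\<bar> ^ Suc (2*n) / real (Suc (2*n))"
        if "\<bar>y - x0\<bar> \<le> N" for y
        by (rule DERIV_power_bound[OF dz' z0(2) _ that])
          (use bQ[OF Suc.IH] S in \<open>auto simp: z''_def\<close>)
      then have "\<bar>z (Suc n) y\<bar> \<le> (B * M ^ Suc n / fact (2*n) / real (Suc (2*n))) * \<bar>y - x0\<bar> ^ Suc (Suc (2*n)) / real (Suc (Suc (2*n)))"
        by (intro DERIV_power_bound[OF dz z0(1)]) (use Suc.prems S in auto)
      also have "\<dots> = B * M ^ Suc n / fact (2 * Suc n) * \<bar>y - x0\<bar> ^ (2 * Suc n)"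
        by (simp add: fact_Suc divide_simps mult_ac del: of_nat_Suc)
      finally show ?case .
    qed
    \<comment> \<open>Weakening (2n)! to n! turns the majorant into an exponential series; up to the
      factor \<open>N\<close> and the first term it serves for the series and both derived
      series.\<close>
    define L where "L n = B * M * (M * N\<^sup>2) ^ n / fact n" for n
    have L: "summable L"
      unfolding L_def using summable_mult[OF summable_exp[of "M * N\<^sup>2"], of "B * M"]
      by (simp add: field_simps)
    have le: "B * M ^ Suc n / fact (2*n) * \<bar>y - x0\<bar> ^ (2*n) \<le> L n" if "y \<in> S" for n y
    proof -
      have "\<bar>y - x0\<bar> ^ (2*n) \<le> N ^ (2*n)" using that S by (intro power_mono) auto
      moreover have "B * M ^ Suc n / fact (2*n) \<le> B * M ^ Suc n / fact n"
        using B M by (intro divide_left_mono fact_mono) (auto intro!: mult_nonneg_nonneg)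
      ultimately have "B * M ^ Suc n / fact (2*n) * \<bar>y - x0\<bar> ^ (2*n) \<le> B * M ^ Suc n / fact n * N ^ (2*n)"
        using B M by (intro mult_mono) auto
      also have "\<dots> = L n" by (simp add: L_def power_mult_distrib power_mult)
      finally show ?thesis .
    qed
    have bz'': "norm (z'' n y) \<le> (case n of 0 \<Rightarrow> 0 | Suc m \<Rightarrow> L m)" if "y \<in> S" for n y
      using order_trans[OF bQ[OF b2] le] that by (auto simp: z''_def split: nat.split)
    have bz: "norm (z n y) \<le> L n" if "y \<in> S" for n y
    proof -
      have "\<bar>z n y\<bar> \<le> B * M ^ n / fact (2*n) * \<bar>y - x0\<bar> ^ (2*n)" by (rule b2[OF that])
      also have "\<dots> \<le> B * M ^ Suc n / fact (2*n) * \<bar>y - x0\<bar> ^ (2*n)"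
        using B M by (intro mult_right_mono divide_right_mono mult_left_mono power_increasing) auto
      also have "\<dots> \<le> L n" by (rule le[OF that])
      finally show ?thesis by simp
    qed
    have bz': "norm (z' n y) \<le> (case n of 0 \<Rightarrow> B | Suc m \<Rightarrow> L m * N)" if "y \<in> S" for n y
    proof (cases n)
      case 0 then show ?thesis using B by (simp add: z'_def)
    next
      case (Suc m)
      have "\<bar>z' (Suc m) y\<bar> \<le> L m * \<bar>y - x0\<bar> ^ Suc 0 / real (Suc 0)"
        by (rule DERIV_power_bound[OF dz' z0(2)])
          (use bz''[of _ "Suc m"] S that in auto)
      also have "\<dots> \<le> L m * N" using that S order_trans[OF norm_ge_zero bz, of y m]
        by (auto intro!: mult_left_mono)
      finally show ?thesis using Suc by simp
    qed
    have sum': "summable (\<lambda>n. case n of 0 \<Rightarrow> B | Suc m \<Rightarrow> L m * N)"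
      by (subst summable_Suc_iff[symmetric]) (simp add: summable_mult2[OF L])
    have sum'': "summable (\<lambda>n. case n of 0 \<Rightarrow> 0 | Suc m \<Rightarrow> L m)"
      by (subst summable_Suc_iff[symmetric]) (simp add: L)
    have u1: "uniformly_convergent_on S (\<lambda>n y. \<Sum>i<n. z' i y)"
      by (rule Weierstrass_m_test'[OF bz' sum'])
    have u2: "uniformly_convergent_on S (\<lambda>n y. \<Sum>i<n. z'' i y)"
      by (rule Weierstrass_m_test'[OF bz'' sum''])
    have x0S: "x0 \<in> S" using N S by auto
    have xS: "x \<in> interior S" by (auto simp: S_def N_def dist_real_def)
    have s1: "summable (\<lambda>n. z n x0)" by (rule summable_comparison_test'[OF L bz[OF x0S]])
    have s2: "summable (\<lambda>n. z' n x0)" by (rule summable_comparison_test'[OF sum' bz'[OF x0S]])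
    have cS: "convex S" by (simp add: S_def)
    show "summable (\<lambda>n. z n x)" "((\<lambda>x. \<Sum>n. z n x) has_real_derivative (\<Sum>n. z' n x)) (at x)"
      using has_field_derivative_series'[OF cS has_field_derivative_at_within[OF dz] u1 x0S s1 xS] by auto
    show "((\<lambda>x. \<Sum>n. z' n x) has_real_derivative (\<Sum>n. z'' n x)) (at x)"
      using has_field_derivative_series'[OF cS has_field_derivative_at_within[OF dz'] u2 x0S s2 xS] by auto
  qed
  have z''_sum: "(\<Sum>n. z'' n x) = Q x * (\<Sum>n. z n x)" for x
  proof -
    have "(\<lambda>n. z'' (Suc n) x) sums (Q x * (\<Sum>n. z n x))"
      using sums_mult[OF summable_sums[OF conv(1)], of "Q x" x] by (simp add: z''_def)
    then have "(\<lambda>n. z'' n x) sums (Q x * (\<Sum>n. z n x) + z'' 0 x)" by (rule sums_Suc)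
    then show ?thesis by (simp add: z''_def sums_iff)
  qed
  have "linear_ode_sol Q (\<lambda>x. \<Sum>n. z n x) (\<lambda>x. \<Sum>n. z' n x)"
    using conv(2,3) by (simp add: linear_ode_sol_def z''_sum)
  moreover have "(\<Sum>n. z n x0) = a"
  proof -
    have "(\<Sum>n. z n x0) = (\<Sum>n\<in>{0}. z n x0)"
      by (rule suminf_finite) (auto simp: gr0_conv_Suc z0)
    then show ?thesis by (simp add: z_0)
  qed
  moreover have "(\<Sum>n. z' n x0) = b"
  proof -
    have "(\<Sum>n. z' n x0) = (\<Sum>n\<in>{0}. z' n x0)"
      by (rule suminf_finite) (auto simp: gr0_conv_Suc z0)
    then show ?thesis by (simp add: z'_def)
  qed
  ultimately show ?thesis by blast
qed

lemma linear_ode_wronskian: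
  assumes "linear_ode_sol Q u u'" "linear_ode_sol Q w w'"
  shows "u x * w' x - u' x * w x = u y * w' y - u' y * w y"
proof -
  have "\<forall>x. ((\<lambda>x. u x * w' x - u' x * w x) has_real_derivative 0) (at x)"
    using assms[THEN linear_ode_solD(1)] assms[THEN linear_ode_solD(2)]
    by (auto intro!: derivative_eq_intros)
  then show ?thesis using DERIV_isconst_all by blast
qed

text \<open>Cramer's rule: the coefficients are Wronskians, which are constant and may be evaluated
  at \<open>x0\<close>. Uniqueness and continuous dependence on the data both follow from this
  formula.\<close>

lemma linear_ode_eq_lincomb:
  assumes u: "linear_ode_sol Q u u'"
    and y: "linear_ode_sol Q y y'" "y x0 = 1" "y' x0 = 0"
    and w: "linear_ode_sol Q w w'" "w x0 = 0" "w' x0 = 1"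
  shows "u x = u x0 * y x + u' x0 * w x" "u' x = u x0 * y' x + u' x0 * w' x"
proof -
  have e: "u x * y' x - u' x * y x = - u' x0" "u x * w' x - u' x * w x = u x0"
    "y x * w' x - y' x * w x = 1"
    using linear_ode_wronskian[OF u y(1), of x x0] linear_ode_wronskian[OF u w(1), of x x0]
      linear_ode_wronskian[OF y(1) w(1), of x x0] y w by auto
  have "u x0 * y x + u' x0 * w x = (u x * w' x - u' x * w x) * y x - (u x * y' x - u' x * y x) * w x"
    by (simp add: e)
  also have "\<dots> = u x * (y x * w' x - y' x * w x)" by (simp add: algebra_simps)
  finally show "u x = u x0 * y x + u' x0 * w x" by (simp add: e)
  have "u x0 * y' x + u' x0 * w' x = (u x * w' x - u' x * w x) * y' x - (u x * y' x - u' x * y x) * w' x"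
    by (simp add: e)
  also have "\<dots> = u' x * (y x * w' x - y' x * w x)" by (simp add: algebra_simps)
  finally show "u' x = u x0 * y' x + u' x0 * w' x" by (simp add: e)
qed

lemma linear_ode_unique:
  assumes Q: "continuous_on UNIV Q"
    and u: "linear_ode_sol Q u u'" and w: "linear_ode_sol Q w w'"
    and "u x0 = w x0" "u' x0 = w' x0"
  shows "u = w" "u' = w'"
proof -
  obtain y y' where y: "linear_ode_sol Q y y'" "y x0 = 1" "y' x0 = 0"
    using linear_ode_exists[OF Q] by blast
  obtain z z' where z: "linear_ode_sol Q z z'" "z x0 = 0" "z' x0 = 1"
    using linear_ode_exists[OF Q] by blast
  show "u = w"
  proof
    show "u x = w x" for x
      unfolding linear_ode_eq_lincomb(1)[OF u y z, of x] linear_ode_eq_lincomb(1)[OF w y z, of x] assms(4,5) ..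
  qed
  show "u' = w'"
  proof
    show "u' x = w' x" for x
      unfolding linear_ode_eq_lincomb(2)[OF u y z, of x] linear_ode_eq_lincomb(2)[OF w y z, of x] assms(4,5) ..
  qed
qed

lemma linear_ode_sol_reflect:
  assumes "linear_ode_sol Q u u'"
  shows "linear_ode_sol (\<lambda>x. Q (- x)) (\<lambda>x. u (- x)) (\<lambda>x. - u' (- x))"
proof -
  have "((\<lambda>x. u (- x)) has_real_derivative - u' (- x)) (at x)" for x
    using linear_ode_solD(1)[OF assms, of "- x"] by (simp add: DERIV_mirror)
  moreover have "((\<lambda>x. - u' (- x)) has_real_derivative Q (- x) * u (- x)) (at x)" for x
    using linear_ode_solD(2)[OF assms, of "- x"] DERIV_minus[of "\<lambda>x. u' (- x)" "- (Q (- x) * u (- x))" x UNIV]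
    by (simp add: DERIV_mirror)
  ultimately show ?thesis by (simp add: linear_ode_sol_def)
qed

section \<open>Recessive solutions\<close>

text \<open>\<open>E\<close> is a supersolution with flux \<open>D = - A\<^sup>2 E'\<close>. The solutions which agree with \<open>A\<close> to first order
  at \<open>a + n\<close> satisfy the bounds on \<open>[a, a + n]\<close>; their data at \<open>a\<close> stay in a compact set, and a limit point
  of these data gives the recessive solution.\<close>

lemma recessive_solution:
  fixes Q R A A' D D' E :: "real \<Rightarrow> real"
  assumes Q: "continuous_on UNIV Q"
    and A: "\<And>x. x \<ge> a \<Longrightarrow> A x > 0"
    and dA: "\<And>x. x \<ge> a \<Longrightarrow> (A has_real_derivative A' x) (at x)"
    and dA': "\<And>x. x \<ge> a \<Longrightarrow> (A' has_real_derivative (Q x + R x) * A x) (at x)"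
    and dD: "\<And>x. x \<ge> a \<Longrightarrow> (D has_real_derivative D' x) (at x)"
    and D': "\<And>x. x \<ge> a \<Longrightarrow> D' x \<le> - \<bar>R x\<bar> * (A x)\<^sup>2"
    and dE: "\<And>x. x \<ge> a \<Longrightarrow> (E has_real_derivative - D x / (A x)\<^sup>2) (at x)"
    and D: "\<And>x. x \<ge> a \<Longrightarrow> D x \<ge> 0" and E: "\<And>x. x \<ge> a \<Longrightarrow> E x \<ge> 0" and Ea: "E a \<le> 1 / 2"
  obtains u u' where "linear_ode_sol Q u u'"
    "\<And>x. x \<ge> a \<Longrightarrow> \<bar>u x / A x - 1\<bar> \<le> 2 * E x"
    "\<And>x. x \<ge> a \<Longrightarrow> \<bar>u' x * A x - u x * A' x\<bar> \<le> 2 * D x"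
proof -
  have step: "\<exists>u u'. linear_ode_sol Q u u' \<and> (\<forall>x\<in>{a..N}. \<bar>u x / A x - 1\<bar> \<le> 2 * E x) \<and>
      (\<forall>x\<in>{a..N}. \<bar>u' x * A x - u x * A' x\<bar> \<le> 2 * D x)" if N: "N \<ge> a" for N
  proof -
    obtain u u' where u: "linear_ode_sol Q u u'" "u N = A N" "u' N = A' N"
      using linear_ode_exists[OF Q] by blast
    define e where "e x = u x / A x" for x
    define z where "z x = u' x * A x - u x * A' x" for x
    have de: "(e has_real_derivative z x / (A x)\<^sup>2) (at x)" if "x \<ge> a" for x
      unfolding e_def z_def using A[OF that] linear_ode_solD[OF u(1)] dA[OF that]
      by (auto intro!: derivative_eq_intros simp: field_simps power2_eq_square)
    have dz: "(z has_real_derivative - R x * A x * u x) (at x)" if "x \<ge> a" for x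
      unfolding z_def using linear_ode_solD[OF u(1)] dA[OF that] dA'[OF that]
      by (auto intro!: derivative_eq_intros simp: algebra_simps)
    \<comment> \<open>The maximum K of \<bar>e\<bar> is an a priori bound that enters both estimates
      linearly. It is made explicit only at the end: since E is nonincreasing and \<open>E a\<close>
      is at most 1/2, one gets K \<le> 1 + K / 2.\<close>
    have "continuous_on {a..N} (\<lambda>x. \<bar>e x\<bar>)"
      by (intro continuous_intros continuous_at_imp_continuous_on ballI DERIV_isCont[OF de]) auto
    then obtain xs where xs: "xs \<in> {a..N}" "\<And>x. x \<in> {a..N} \<Longrightarrow> \<bar>e x\<bar> \<le> \<bar>e xs\<bar>"
      using continuous_attains_sup[of "{a..N}" "\<lambda>x. \<bar>e x\<bar>"] N by auto
    define K where "K = \<bar>e xs\<bar>"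
    have K: "\<bar>e x\<bar> \<le> K" if "a \<le> x" "x \<le> N" for x using xs that by (auto simp: K_def)
    have K0: "K \<ge> 0" by (simp add: K_def)
    have zb: "\<bar>z x\<bar> \<le> K * D x" if x: "a \<le> x" "x \<le> N" for x
    proof -
      have "\<bar>z N - z x\<bar> \<le> - K * D N - - K * D x"
      proof (rule DERIV_abs_le_imp_diff_le[OF x(2) dz])
        fix y assume y: "x \<le> y" "y \<le> N"
        then have ya: "y \<ge> a" using x by simp
        show "((\<lambda>x. - K * D x) has_real_derivative - K * D' y) (at y)"
          using dD[OF ya] by (auto intro!: derivative_eq_intros)
        have "u y = e y * A y" using A[OF ya] by (simp add: e_def)
        then have "\<bar>- R y * A y * u y\<bar> = \<bar>e y\<bar> * (\<bar>R y\<bar> * (A y)\<^sup>2)"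
          using A[OF ya] by (simp add: abs_mult power2_eq_square mult_ac)
        also have "\<dots> \<le> K * (\<bar>R y\<bar> * (A y)\<^sup>2)" using K[OF ya y(2)] by (intro mult_right_mono) auto
        also have "\<dots> \<le> K * (- D' y)" using D'[OF ya] K0 by (intro mult_left_mono) auto
        finally show "\<bar>- R y * A y * u y\<bar> \<le> - K * D' y" by simp
      qed (use x in auto)
      moreover have "z N = 0" using u by (simp add: z_def)
      ultimately show ?thesis using mult_nonneg_nonneg[OF K0 D[OF N]] by linarith
    qed
    have eb: "\<bar>e x - 1\<bar> \<le> K * E x" if x: "a \<le> x" "x \<le> N" for x
    proof -
      have "\<bar>e N - e x\<bar> \<le> - K * E N - - K * E x"
      proof (rule DERIV_abs_le_imp_diff_le[OF x(2) de])
        fix y assume y: "x \<le> y" "y \<le> N"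
        then have ya: "y \<ge> a" using x by simp
        show "((\<lambda>x. - K * E x) has_real_derivative K * D y / (A y)\<^sup>2) (at y)"
          using dE[OF ya] by (auto intro!: derivative_eq_intros)
        show "\<bar>z y / (A y)\<^sup>2\<bar> \<le> K * D y / (A y)\<^sup>2"
          using zb[OF ya y(2)] by (simp add: divide_right_mono)
      qed (use x in auto)
      moreover have "e N = 1" using u A[OF N] by (simp add: e_def)
      ultimately show ?thesis using mult_nonneg_nonneg[OF K0 E[OF N]] by (simp add: abs_minus_commute)
    qed
    have "E xs \<le> E a"
    proof -
      have "E xs - E a \<le> (\<lambda>_. 0) xs - (\<lambda>_. 0) a"
        by (rule DERIV_le_imp_diff_le[OF _ dE, where g' = "\<lambda>_. 0"]) (use xs D in \<open>auto simp: divide_nonpos_nonneg\<close>)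
      then show ?thesis by simp
    qed
    then have "K * E xs \<le> K * (1 / 2)" using Ea K0 by (intro mult_left_mono) auto
    moreover have "K \<le> 1 + \<bar>e xs - 1\<bar>" by (simp add: K_def)
    ultimately have K2: "K \<le> 2" using eb[of xs] xs by simp
    have "\<bar>u x / A x - 1\<bar> \<le> 2 * E x \<and> \<bar>u' x * A x - u x * A' x\<bar> \<le> 2 * D x" if "x \<in> {a..N}" for x
      using eb[of x] zb[of x] that mult_right_mono[OF K2 E[of x]] mult_right_mono[OF K2 D[of x]]
      by (auto simp: e_def z_def)
    then show ?thesis using u(1) by blast
  qed
  then have "\<forall>n. \<exists>u u'. linear_ode_sol Q u u' \<and> (\<forall>x\<in>{a..a + real n}. \<bar>u x / A x - 1\<bar> \<le> 2 * E x) \<and>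
      (\<forall>x\<in>{a..a + real n}. \<bar>u' x * A x - u x * A' x\<bar> \<le> 2 * D x)" by simp
  then obtain U U' where U: "\<And>n. linear_ode_sol Q (U n) (U' n)"
    "\<And>n x. x \<in> {a..a + real n} \<Longrightarrow> \<bar>U n x / A x - 1\<bar> \<le> 2 * E x"
    "\<And>n x. x \<in> {a..a + real n} \<Longrightarrow> \<bar>U' n x * A x - U n x * A' x\<bar> \<le> 2 * D x"
    by metis
  have Aa: "A a > 0" using A by simp
  have "\<bar>U n a\<bar> \<le> 2 * A a" for n
  proof -
    have "\<bar>U n a / A a\<bar> \<le> 2" using U(2)[of a n] Ea by auto
    then show ?thesis using Aa by (simp add: field_simps)
  qed
  note b1 = this
  let ?b = "(2 * D a + 2 * A a * \<bar>A' a\<bar>) / A a"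
  have b2: "\<bar>U' n a\<bar> \<le> ?b" for n
  proof -
    have "\<bar>U' n a\<bar> * A a = \<bar>U' n a * A a\<bar>" using Aa by (simp add: abs_mult)
    also have "\<dots> \<le> \<bar>U' n a * A a - U n a * A' a\<bar> + \<bar>U n a * A' a\<bar>" by simp
    also have "\<dots> \<le> 2 * D a + 2 * A a * \<bar>A' a\<bar>"
      using U(3)[of a n] b1[of n] by (intro add_mono) (auto simp: abs_mult intro: mult_right_mono)
    finally show ?thesis using Aa by (simp add: field_simps)
  qed
  let ?box = "cbox (- (2 * A a), - (?b))
       (2 * A a, ?b)"
  have "bounded (range (\<lambda>n. (U n a, U' n a)))"
  proof (rule bounded_subset)
    show "bounded (?box)" by (rule bounded_cbox)
    show "range (\<lambda>n. (U n a, U' n a)) \<subseteq> ?box"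
      using b1 b2 by (auto simp: cbox_Pair_eq abs_le_iff minus_le_iff)
  qed
  then obtain c r where r: "strict_mono r" "((\<lambda>n. (U n a, U' n a)) \<circ> r) \<longlonglongrightarrow> c"
    using bounded_imp_convergent_subsequence by blast
  have c: "(\<lambda>n. U (r n) a) \<longlonglongrightarrow> fst c" "(\<lambda>n. U' (r n) a) \<longlonglongrightarrow> snd c"
    using tendsto_fst[OF r(2)] tendsto_snd[OF r(2)] by (auto simp: o_def)
  obtain y y' where y: "linear_ode_sol Q y y'" "y a = 1" "y' a = 0"
    using linear_ode_exists[OF Q] by blast
  obtain w w' where w: "linear_ode_sol Q w w'" "w a = 0" "w' a = 1"
    using linear_ode_exists[OF Q] by blast
  \<comment> \<open>Solutions are linear in their data at \<open>a\<close>, so convergence of the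
    data gives convergence at every point, and the bounds at a fixed x hold along the sequence as
    soon as \<open>a + r n\<close> exceeds x.\<close>
  define u where "u x = fst c * y x + snd c * w x" for x
  define u' where "u' x = fst c * y' x + snd c * w' x" for x
  have lim: "(\<lambda>n. U (r n) x) \<longlonglongrightarrow> u x" "(\<lambda>n. U' (r n) x) \<longlonglongrightarrow> u' x" for x
    unfolding linear_ode_eq_lincomb(1)[OF U(1) y w, of _ x] linear_ode_eq_lincomb(2)[OF U(1) y w, of _ x] u_def u'_def
    by (intro tendsto_intros c)+
  have ev: "eventually (\<lambda>n. x \<in> {a..a + real (r n)}) sequentially" if "x \<ge> a" for x
  proof -
    obtain n0 :: nat where n0: "x - a \<le> real n0" using real_arch_simple by blast
    have "x \<in> {a..a + real (r n)}" if "n \<ge> n0" for n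
      using seq_suble[OF r(1), of n] that n0 \<open>x \<ge> a\<close> by auto
    then show ?thesis unfolding eventually_sequentially by blast
  qed
  show thesis
  proof
    show "linear_ode_sol Q u u'"
      using linear_ode_sol_lincomb[OF y(1) w(1), of "fst c" "snd c"] by (simp add: u_def[abs_def] u'_def[abs_def])
    fix x assume x: "x \<ge> a"
    have "(\<lambda>n. \<bar>U (r n) x / A x - 1\<bar>) \<longlonglongrightarrow> \<bar>u x / A x - 1\<bar>"
      by (intro tendsto_intros lim) (use A[OF x] in auto)
    then show "\<bar>u x / A x - 1\<bar> \<le> 2 * E x"
      by (rule tendsto_upperbound) (use eventually_mono[OF ev[OF x] U(2)] in auto)
    have "(\<lambda>n. \<bar>U' (r n) x * A x - U (r n) x * A' x\<bar>) \<longlonglongrightarrow> \<bar>u' x * A x - u x * A' x\<bar>"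
      by (intro tendsto_intros lim)
    then show "\<bar>u' x * A x - u x * A' x\<bar> \<le> 2 * D x"
      by (rule tendsto_upperbound) (use eventually_mono[OF ev[OF x] U(3)] in auto)
  qed
qed

lemma asymp_equiv_eventually_nonzero:
  fixes u f :: "real \<Rightarrow> real"
  assumes "u \<sim>[F] f" "eventually (\<lambda>x. f x > 0) F"
  shows "eventually (\<lambda>x. u x \<noteq> 0) F"
proof -
  have "eventually (\<lambda>x. u x = 0 \<longleftrightarrow> f x = 0) F"
    using asymp_equiv_eventually_zeros[OF assms(1)] .
  then show ?thesis using assms(2) by eventually_elim auto
qed

text \<open>Where \<open>Q \<ge> 0\<close> the square of a solution is convex, so a decaying solution cannot vanish
  anywhere unless it is zero.\<close>

lemma recessive_solution_unique:
  fixes f :: "real \<Rightarrow> real"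
  assumes Q: "continuous_on UNIV Q" and Q0: "\<And>x. x \<ge> X \<Longrightarrow> Q x \<ge> 0"
    and u: "linear_ode_sol Q u u'" and w: "linear_ode_sol Q w w'"
    and uf: "u \<sim>[at_top] f" and wf: "w \<sim>[at_top] f"
    and f0: "(f \<longlongrightarrow> 0) at_top" and f: "eventually (\<lambda>x. f x > 0) at_top"
  shows "u = w"
proof -
  have u0: "(u \<longlongrightarrow> 0) at_top" and w0: "(w \<longlongrightarrow> 0) at_top"
    using f0 tendsto_asymp_equiv_cong[OF uf] tendsto_asymp_equiv_cong[OF wf] by auto
  have eu: "eventually (\<lambda>x. u x \<noteq> 0) at_top" by (rule asymp_equiv_eventually_nonzero[OF uf f])
  then have "eventually (\<lambda>x. u x \<noteq> 0 \<and> x \<ge> X) at_top"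
    using eventually_ge_at_top eventually_conj by blast
  then obtain x0 where x0: "u x0 \<noteq> 0" "x0 \<ge> X"
    using eventually_happens by fastforce
  \<comment> \<open>This k makes \<open>d\<close>, the difference w - k u, vanish at
    \<open>x0\<close>; from there on \<open>d * d'\<close> is nondecreasing, hence nonnegative. In
    the end the common asymptotics force k = 1.\<close>
  define k where "k = w x0 / u x0"
  define d where "d x = 1 * w x + (- k) * u x" for x
  define d' where "d' x = 1 * w' x + (- k) * u' x" for x
  have d: "linear_ode_sol Q d d'"
    using linear_ode_sol_lincomb[OF w u, of 1 "- k"] by (simp add: d_def[abs_def] d'_def[abs_def])
  have dx0: "d x0 = 0" using x0 by (simp add: d_def k_def)
  have d0: "(d \<longlongrightarrow> 0) at_top"
    unfolding d_def by (rule tendsto_eq_intros u0 w0 refl)+ simp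
  have dd': "d x * d' x \<ge> 0" if "x \<ge> x0" for x
  proof -
    have "(\<lambda>_. 0) x - (\<lambda>_. 0) x0 \<le> (\<lambda>x. d x * d' x) x - (\<lambda>x. d x * d' x) x0"
    proof (rule DERIV_le_imp_diff_le[OF that])
      fix y assume y: "x0 \<le> y"
      show "((\<lambda>x. d x * d' x) has_real_derivative (d' y)\<^sup>2 + Q y * (d y)\<^sup>2) (at y)"
        using linear_ode_solD[OF d] by (auto intro!: derivative_eq_intros simp: power2_eq_square)
      show "0 \<le> (d' y)\<^sup>2 + Q y * (d y)\<^sup>2" using Q0[of y] y x0 by auto
    qed auto
    then show ?thesis using dx0 by simp
  qed
  have z: "d x = 0" if x: "x \<ge> x0" for x
  proof -
    have "eventually (\<lambda>y. (d x)\<^sup>2 \<le> (d y)\<^sup>2) at_top"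
      using eventually_ge_at_top[of x]
    proof eventually_elim
      case (elim y)
      have "(\<lambda>_. 0) y - (\<lambda>_. 0) x \<le> (\<lambda>x. (d x)\<^sup>2) y - (\<lambda>x. (d x)\<^sup>2) x"
      proof (rule DERIV_le_imp_diff_le[OF elim])
        fix s assume s: "x \<le> s"
        show "((\<lambda>x. (d x)\<^sup>2) has_real_derivative 2 * (d s * d' s)) (at s)"
          using linear_ode_solD[OF d] by (auto intro!: derivative_eq_intros)
        show "0 \<le> 2 * (d s * d' s)" using dd'[of s] s x by simp
      qed auto
      then show ?case by simp
    qed
    moreover have "((\<lambda>y. (d y)\<^sup>2) \<longlongrightarrow> 0) at_top"
      by (rule tendsto_eq_intros d0 refl)+ simp
    ultimately have "(d x)\<^sup>2 \<le> 0" by (intro tendsto_lowerbound) auto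
    then show ?thesis by simp
  qed
  \<comment> \<open>\<open>d\<close> vanishes on the closed half-line from \<open>x0\<close>; an
    interior point is chosen since a two-sided neighbourhood is needed to conclude that the
    derivative vanishes too.\<close>
  have "d' (x0 + 1) = 0"
  proof (rule DERIV_local_const)
    show "(d has_real_derivative d' (x0 + 1)) (at (x0 + 1))" by (rule linear_ode_solD(1)[OF d])
    show "\<forall>y. \<bar>x0 + 1 - y\<bar> < 1 \<longrightarrow> d (x0 + 1) = d y" using z by auto
  qed auto
  moreover have "linear_ode_sol Q (\<lambda>_. 0) (\<lambda>_. 0)" by (simp add: linear_ode_sol_def)
  ultimately have "d = (\<lambda>_. 0)"
    using linear_ode_unique(1)[OF Q d, of "\<lambda>_. 0" "\<lambda>_. 0" "x0 + 1"] z[of "x0 + 1"] by simp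
  then have wk: "w x = k * u x" for x by (auto simp: d_def fun_eq_iff)
  have "w \<sim>[at_top] u" using wf uf asymp_equiv_sym asymp_equiv_trans by blast
  then have "((\<lambda>x. if w x = 0 \<and> u x = 0 then 1 else w x / u x) \<longlongrightarrow> 1) at_top"
    by (simp add: asymp_equiv_def)
  moreover have "eventually (\<lambda>x. (if w x = 0 \<and> u x = 0 then 1 else w x / u x) = k) at_top"
    using eu by eventually_elim (auto simp: wk)
  ultimately have "((\<lambda>_. k) \<longlongrightarrow> 1) (at_top :: real filter)" by (rule Lim_transform_eventually)
  then have "k = 1" by (simp add: tendsto_const_iff)
  then show ?thesis using wk by auto
qed

text \<open>Bridge between the \<open>deriv\<close> formulation inside the definite descriptions and
  the predicate with an explicit derivative.\<close>

lemma C_2_on_UNIV_linear_ode_iff: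
  assumes Q: "continuous_on UNIV Q"
  shows "C_k_on 2 u UNIV \<and> (\<forall>x. deriv (deriv u) x = Q x * u x) \<longleftrightarrow> (\<exists>u'. linear_ode_sol Q u u')"
proof
  assume *: "C_k_on 2 u UNIV \<and> (\<forall>x. deriv (deriv u) x = Q x * u x)"
  then have "\<forall>j<2. \<forall>x. (deriv ^^ j) u differentiable (at x)" by (simp add: C_k_on_def)
  from this[rule_format, of 0] this[rule_format, of 1] * show "\<exists>u'. linear_ode_sol Q u u'"
    by (auto simp: linear_ode_sol_def DERIV_deriv_iff_real_differentiable intro!: exI[of _ "deriv u"])
      (metis DERIV_deriv_iff_real_differentiable)
next
  assume "\<exists>u'. linear_ode_sol Q u u'"
  then obtain u' where u: "linear_ode_sol Q u u'" by blast
  have 1: "deriv u = u'" using linear_ode_solD(1)[OF u] DERIV_imp_deriv by blast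
  have 2: "deriv u' = (\<lambda>x. Q x * u x)" using linear_ode_solD(2)[OF u] DERIV_imp_deriv by blast
  have c: "continuous_on UNIV u" "continuous_on UNIV u'"
    using linear_ode_solD[OF u] by (auto intro!: continuous_at_imp_continuous_on DERIV_isCont)
  have "\<forall>j<2. \<forall>x\<in>UNIV. (deriv ^^ j) u differentiable (at x)"
    using linear_ode_solD[OF u] by (auto simp: less_2_cases_iff 1 real_differentiable_def)
  moreover have "\<forall>j\<le>2. continuous_on UNIV ((deriv ^^ j) u)"
    using c Q by (auto simp: le_Suc_eq numeral_2_eq_2 1 2 intro!: continuous_intros)
  ultimately show "C_k_on 2 u UNIV \<and> (\<forall>x. deriv (deriv u) x = Q x * u x)"
    by (simp add: C_k_on_def 1 2)
qed

section \<open>The Airy function\<close>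

definition airy_wkb :: "real \<Rightarrow> real" where
  "airy_wkb t = 1 / (2 * sqrt pi) * t powr (-1/4) * exp (- 2 * t powr (3/2) / 3)"

lemma airy_wkb_pos: "t > 0 \<Longrightarrow> airy_wkb t > 0"
  by (simp add: airy_wkb_def)

lemma airy_wkb_deriv:
  assumes t: "t > 0"
  shows "(airy_wkb has_real_derivative (- (1 / (4 * t)) - sqrt t) * airy_wkb t) (at t)"
proof -
  have e: "t powr (- (5 / 4)) = t powr (- (1 / 4)) / t"
    using t powr_diff[of t "-1/4" 1] by simp
  show ?thesis
    unfolding airy_wkb_def[abs_def]
    by (rule derivative_eq_intros refl t | simp)+
      (use t in \<open>simp add: e powr_half_sqrt field_simps\<close>)
qed

text \<open>The residual potential 5 / (16 t^2) remains integrable after multiplication by t^(-1/2);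
  this makes the comparison with \<open>airy_wkb\<close> possible near infinity.\<close>

lemma airy_wkb_deriv2:
  assumes t: "t > 0"
  shows "((\<lambda>t. (- (1 / (4 * t)) - sqrt t) * airy_wkb t) has_real_derivative
     (t + 5 / (16 * t\<^sup>2)) * airy_wkb t) (at t)"
proof -
  obtain s where s: "s > 0" "t = s * s" using t by (intro that[of "sqrt t"]) auto
  have "1 / (4 * t\<^sup>2) - 1 / (2 * sqrt t) + (- (1 / (4 * t)) - sqrt t) * (- (1 / (4 * t)) - sqrt t)
      = t + 5 / (16 * t\<^sup>2)"
    using s by (simp add: field_simps power2_eq_square real_sqrt_mult)
  note e = this[symmetric]
  show ?thesis
    unfolding e using t
    by (auto intro!: derivative_eq_intros airy_wkb_deriv simp: field_simps power2_eq_square)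
qed

lemma airy_recessive:
  obtains u u' where "linear_ode_sol (\<lambda>t. t) u u'"
    "\<And>t. t \<ge> 1 \<Longrightarrow> \<bar>u t / airy_wkb t - 1\<bar> \<le> 5 / 24 * t powr (-3/2)"
    "\<And>t. t \<ge> 1 \<Longrightarrow> \<bar>u' t * airy_wkb t - u t * ((- (1 / (4 * t)) - sqrt t) * airy_wkb t)\<bar>
       \<le> 5 / 16 * t powr (-5/2) * (airy_wkb t)\<^sup>2"
proof -
  define A' where "A' t = (- (1 / (4 * t)) - sqrt t) * airy_wkb t" for t
  \<comment> \<open>Here D = - A^2 E' for the E below. The constant is such that the dominant part
    of D', in which - sqrt t comes from differentiating \<open>airy_wkb\<close>, equals - 5 / (16
    t^2) A^2 exactly; the other terms of D' are nonpositive.\<close>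
  define D where "D t = 5 / 32 * t powr (-5/2) * (airy_wkb t)\<^sup>2" for t
  define D' where "D' t = 5 / 32 * (-5/2 * t powr (-7/2)) * (airy_wkb t)\<^sup>2
    + 5 / 32 * t powr (-5/2) * (2 * airy_wkb t * A' t)" for t
  define E where "E t = 5 / 48 * t powr (-3/2)" for t :: real
  have "continuous_on UNIV (\<lambda>t::real. t)" by simp
  then obtain u u' where u: "linear_ode_sol (\<lambda>t. t) u u'"
    "\<And>t. t \<ge> 1 \<Longrightarrow> \<bar>u t / airy_wkb t - 1\<bar> \<le> 2 * E t"
    "\<And>t. t \<ge> 1 \<Longrightarrow> \<bar>u' t * airy_wkb t - u t * A' t\<bar> \<le> 2 * D t"
  proof (rule recessive_solution[where a=1 and A=airy_wkb and A'=A' and R="\<lambda>t. 5 / (16 * t\<^sup>2)" and D=D and D'=D' and E=E])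
    fix t :: real assume t: "1 \<le> t"
    then have t0: "t > 0" by simp
    show "0 < airy_wkb t" using t by (simp add: airy_wkb_pos)
    show dA: "(airy_wkb has_real_derivative A' t) (at t)"
      unfolding A'_def by (rule airy_wkb_deriv[OF t0])
    show "(A' has_real_derivative (t + 5 / (16 * t\<^sup>2)) * airy_wkb t) (at t)"
      unfolding A'_def[abs_def] by (rule airy_wkb_deriv2[OF t0])
    show "(D has_real_derivative D' t) (at t)"
      unfolding D_def[abs_def] D'_def
      using t0 by (auto intro!: derivative_eq_intros dA)
    have "sqrt t * t powr (-5/2) = t powr (1/2 + -5/2)"
      using t0 unfolding powr_add by (simp add: powr_half_sqrt)
    also have "\<dots> = t powr (- 2)" by simp
    finally have e: "sqrt t * t powr (-5/2) = 1 / t\<^sup>2"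
      using t0 by (simp add: powr_minus inverse_eq_divide)
    have "5 / 32 * (-5/2 * t powr (-7/2)) * (airy_wkb t)\<^sup>2 \<le> 0"
      by (simp add: mult_le_0_iff)
    moreover have "5 / 32 * t powr (-5/2) * (2 * airy_wkb t * A' t)
      = - (5 / 64) * (t powr (-5/2) / t) * (airy_wkb t)\<^sup>2 - 5 / 16 * (sqrt t * t powr (-5/2)) * (airy_wkb t)\<^sup>2"
      using t0 by (simp add: A'_def field_simps power2_eq_square)
    moreover have "- (5 / 64) * (t powr (-5/2) / t) * (airy_wkb t)\<^sup>2 \<le> 0"
      using t0 by (intro mult_nonpos_nonneg) auto
    ultimately have "D' t \<le> - (5 / 16 * (1 / t\<^sup>2) * (airy_wkb t)\<^sup>2)"
      unfolding D'_def e by linarith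
    then show "D' t \<le> - \<bar>5 / (16 * t\<^sup>2)\<bar> * (airy_wkb t)\<^sup>2" by simp
    show "(E has_real_derivative - D t / (airy_wkb t)\<^sup>2) (at t)"
      unfolding E_def[abs_def] D_def
      using t0 airy_wkb_pos[OF t0] by (auto intro!: derivative_eq_intros)
    show "0 \<le> D t" "0 \<le> E t" by (auto simp: D_def E_def)
  qed (auto simp: E_def)
  show thesis
    by (rule that[OF u(1)]) (use u(2,3) in \<open>auto simp: E_def D_def A'_def mult_ac\<close>)
qed

lemma airy_wkb_tendsto_0: "(airy_wkb \<longlongrightarrow> 0) at_top"
  unfolding airy_wkb_def[abs_def] by real_asymp

lemma asymp_equiv_of_quotient_bound:
  fixes u A E :: "real \<Rightarrow> real"
  assumes "eventually (\<lambda>x. A x > 0) at_top" "eventually (\<lambda>x. \<bar>u x / A x - 1\<bar> \<le> E x) at_top"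
    and "(E \<longlongrightarrow> 0) at_top"
  shows "u \<sim>[at_top] A"
proof -
  have "((\<lambda>x. u x / A x - 1) \<longlongrightarrow> 0) at_top"
    by (rule Lim_null_comparison[OF _ assms(3)]) (use assms(2) in simp)
  then have "((\<lambda>x. u x / A x) \<longlongrightarrow> 1) at_top" by (simp add: LIM_zero_iff)
  then show ?thesis
    by (rule asymp_equivI'[OF _])
qed

text \<open>The solution just constructed meets the description of \<open>Ai\<close>, and a decaying
  solution with given leading asymptotics is unique. The explicit constants are kept because the
  sign of Ai' at t = 1 is read off from them.\<close>

lemma Ai_spec:
  obtains Ai' where "linear_ode_sol (\<lambda>t. t) Ai Ai'" "Ai \<sim>[at_top] airy_wkb"
    "\<And>t. t \<ge> 1 \<Longrightarrow> \<bar>Ai t / airy_wkb t - 1\<bar> \<le> 5 / 24 * t powr (-3/2)"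
    "\<And>t. t \<ge> 1 \<Longrightarrow> \<bar>Ai' t * airy_wkb t - Ai t * ((- (1 / (4 * t)) - sqrt t) * airy_wkb t)\<bar>
       \<le> 5 / 16 * t powr (-5/2) * (airy_wkb t)\<^sup>2"
proof -
  obtain u u' where u: "linear_ode_sol (\<lambda>t. t) u u'"
    "\<And>t. t \<ge> 1 \<Longrightarrow> \<bar>u t / airy_wkb t - 1\<bar> \<le> 5 / 24 * t powr (-3/2)"
    "\<And>t. t \<ge> 1 \<Longrightarrow> \<bar>u' t * airy_wkb t - u t * ((- (1 / (4 * t)) - sqrt t) * airy_wkb t)\<bar>
       \<le> 5 / 16 * t powr (-5/2) * (airy_wkb t)\<^sup>2"
    using airy_recessive by blast
  have pos: "eventually (\<lambda>x. airy_wkb x > 0) at_top"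
    using eventually_gt_at_top[of 0] by eventually_elim (rule airy_wkb_pos)
  have ua: "u \<sim>[at_top] airy_wkb"
  proof (rule asymp_equiv_of_quotient_bound[OF pos])
    show "\<forall>\<^sub>F t in at_top. \<bar>u t / airy_wkb t - 1\<bar> \<le> 5 / 24 * t powr (-3/2)"
      using eventually_ge_at_top[of 1] by eventually_elim (rule u(2))
    show "((\<lambda>t::real. 5 / 24 * t powr (-3/2)) \<longlongrightarrow> 0) at_top" by real_asymp
  qed
  have cont: "continuous_on UNIV (\<lambda>t::real. t)" by simp
  note iff = C_2_on_UNIV_linear_ode_iff[OF cont]
  have "Ai = u"
    unfolding Ai_def airy_wkb_def[abs_def, symmetric]
  proof (rule the_equality)
    show "C_k_on 2 u UNIV \<and> (\<forall>t. deriv (deriv u) t = t * u t) \<and> u \<sim>[at_top] airy_wkb"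
      using u(1) ua iff by blast
    fix w assume w: "C_k_on 2 w UNIV \<and> (\<forall>t. deriv (deriv w) t = t * w t) \<and> w \<sim>[at_top] airy_wkb"
    then obtain w' where "linear_ode_sol (\<lambda>t. t) w w'" using iff by blast
    then show "w = u"
      using recessive_solution_unique[OF cont _ _ u(1) _ ua airy_wkb_tendsto_0 pos, of 0] w by auto
  qed
  then show thesis using that u ua by blast
qed

text \<open>Backwards from \<open>t = 1\<close> the sign information persists because \<open>Ai Ai'\<close> is nondecreasing
  on \<open>t \<ge> 0\<close>.\<close>

lemma Ai_decay:
  obtains Ai' c where "linear_ode_sol (\<lambda>t. t) Ai Ai'" "Ai \<sim>[at_top] airy_wkb" "c > 0"
    "\<And>t. t \<ge> 0 \<Longrightarrow> Ai t > 0" "\<And>t. t \<ge> 0 \<Longrightarrow> Ai' t \<le> - c * sqrt (1 + t) * Ai t"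
proof -
  obtain Ai' where Ai: "linear_ode_sol (\<lambda>t. t) Ai Ai'" "Ai \<sim>[at_top] airy_wkb"
    "\<And>t. t \<ge> 1 \<Longrightarrow> \<bar>Ai t / airy_wkb t - 1\<bar> \<le> 5 / 24 * t powr (-3/2)"
    "\<And>t. t \<ge> 1 \<Longrightarrow> \<bar>Ai' t * airy_wkb t - Ai t * ((- (1 / (4 * t)) - sqrt t) * airy_wkb t)\<bar>
       \<le> 5 / 16 * t powr (-5/2) * (airy_wkb t)\<^sup>2"
    using Ai_spec by blast
  note dAi = linear_ode_solD[OF Ai(1)]
  \<comment> \<open>Origin of 2/5: e is at least 19/24, and 5/16 \<le> 2/5 * 19/24, so the error
    costs two fifths of the main term e * sqrt t. The remaining three fifths are converted by sqrt
    (1 + t) \<le> 3/2 * sqrt t, valid for t \<ge> 1.\<close>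
  have ge1: "Ai t > 0 \<and> Ai' t \<le> - (2 / 5) * sqrt (1 + t) * Ai t" if t: "t \<ge> 1" for t
  proof -
    define w where "w = airy_wkb t"
    define e where "e = Ai t / w"
    have w: "w > 0" using t airy_wkb_pos by (simp add: w_def)
    have le1: "t powr (-3/2) \<le> 1" "t powr (-5/2) \<le> 1"
      using t powr_mono[of "-3/2" 0 t] powr_mono[of "-5/2" 0 t] by auto
    have "\<bar>e - 1\<bar> \<le> 5 / 24" using Ai(3)[OF t] le1 by (simp add: e_def w_def)
    then have e: "e \<ge> 19 / 24" by linarith
    have Aie: "Ai t = e * w" using w by (simp add: e_def)
    have s: "sqrt t \<ge> 1" using t by simp
    have "sqrt (1 + t) \<le> sqrt ((3/2)\<^sup>2 * t)" using t by (intro real_sqrt_le_mono) (simp add: power2_eq_square)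
    then have s2: "sqrt (1 + t) \<le> 3/2 * sqrt t" by (simp add: real_sqrt_mult)
    have "Ai' t * w - e * w * ((- (1 / (4 * t)) - sqrt t) * w) \<le> 5 / 16 * t powr (-5/2) * w\<^sup>2"
      using abs_le_D1[OF Ai(4)[OF t]] by (simp only: w_def[symmetric] Aie)
    also have "\<dots> \<le> 5 / 16 * w\<^sup>2" using mult_left_mono[OF le1(2), of "5 / 16 * w\<^sup>2"] by (simp add: mult_ac)
    finally have "Ai' t * w \<le> (5 / 16 * w - e * (1 / (4 * t)) * w - e * sqrt t * w) * w"
      by (simp add: algebra_simps power2_eq_square)
    then have "Ai' t \<le> 5 / 16 * w - e * (1 / (4 * t)) * w - e * sqrt t * w"
      using w by simp
    also have "\<dots> \<le> (5 / 16 - e * sqrt t) * w"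
      using w e t by (simp add: algebra_simps)
    also have "\<dots> \<le> (- (3 / 5) * e * sqrt t) * w"
    proof (rule mult_right_mono)
      have "5 / 16 \<le> 2 / 5 * (19 / 24 * 1 :: real)" by simp
      also have "\<dots> \<le> 2 / 5 * (e * sqrt t)" using e s by (intro mult_left_mono mult_mono) auto
      finally show "5 / 16 - e * sqrt t \<le> - (3 / 5) * e * sqrt t" by simp
    qed (use w in simp)
    also have "\<dots> = - (2 / 5) * (3/2 * sqrt t) * (e * w)" by simp
    also have "\<dots> \<le> - (2 / 5) * sqrt (1 + t) * (e * w)"
      using s2 e w by (intro mult_right_mono) auto
    finally show ?thesis using e w by (simp add: Aie)
  qed
  have prod: "Ai t * Ai' t < 0" if t: "0 \<le> t" "t \<le> 1" for t
  proof -
    have "(\<lambda>_. 0) 1 - (\<lambda>_. 0) t \<le> (\<lambda>t. Ai t * Ai' t) 1 - (\<lambda>t. Ai t * Ai' t) t"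
    proof (rule DERIV_le_imp_diff_le[OF t(2)])
      fix y assume y: "t \<le> y"
      show "((\<lambda>t. Ai t * Ai' t) has_real_derivative (Ai' y)\<^sup>2 + y * (Ai y)\<^sup>2) (at y)"
        using dAi by (auto intro!: derivative_eq_intros simp: power2_eq_square)
      show "0 \<le> (Ai' y)\<^sup>2 + y * (Ai y)\<^sup>2" using y t by auto
    qed auto
    moreover have "Ai 1 * Ai' 1 < 0"
    proof -
      have "- (2 / 5) * sqrt (1 + 1) * Ai 1 < 0" using ge1[of 1] by simp
      then have "Ai' 1 < 0" using ge1[of 1] by linarith
      then show ?thesis using ge1[of 1] by (intro mult_pos_neg) auto
    qed
    ultimately show ?thesis by simp
  qed
  have pos01: "Ai t > 0" if t: "0 \<le> t" "t \<le> 1" for t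
  proof (rule ccontr)
    assume "\<not> Ai t > 0"
    moreover have "continuous_on {t..1} Ai"
      using dAi by (auto intro!: continuous_at_imp_continuous_on DERIV_isCont)
    ultimately obtain s where "t \<le> s" "s \<le> 1" "Ai s = 0"
      using IVT'[of Ai t 0 1] t ge1[of 1] by auto
    then show False using prod[of s] t by simp
  qed
  have "continuous_on {0..1} (\<lambda>t. - Ai' t / Ai t)"
    by (intro continuous_intros continuous_at_imp_continuous_on ballI DERIV_isCont[OF dAi(1)] DERIV_isCont[OF dAi(2)])
      (use pos01 in force)
  then obtain t0 where t0: "t0 \<in> {0..1}" "\<And>t. t \<in> {0..1} \<Longrightarrow> - Ai' t0 / Ai t0 \<le> - Ai' t / Ai t"
    using continuous_attains_inf[of "{0..1::real}" "\<lambda>t. - Ai' t / Ai t"] by auto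
  define m where "m = - Ai' t0 / Ai t0"
  have "Ai' t0 < 0" using prod[of t0] pos01[of t0] t0(1) by (auto simp: mult_less_0_iff)
  then have m: "m > 0" using pos01[of t0] t0(1) by (simp add: m_def divide_neg_pos)
  show thesis
  proof (rule that[OF Ai(1,2)])
    \<comment> \<open>On [0, 1] the continuous function - Ai' / Ai has the positive minimum m, and
      sqrt (1 + t) is at most 2 there, whence m / 2.\<close>
    show "min (2 / 5) (m / 2) > 0" using m by simp
    fix t :: real assume t: "t \<ge> 0"
    show A: "Ai t > 0" using ge1[of t] pos01[of t] t by (cases "t \<le> 1") auto
    show "Ai' t \<le> - min (2 / 5) (m / 2) * sqrt (1 + t) * Ai t"
    proof (cases "t \<le> 1")
      case True
      have "sqrt (1 + t) \<le> sqrt 4" using True by (intro real_sqrt_le_mono) simp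
      then have "min (2 / 5) (m / 2) * sqrt (1 + t) \<le> m / 2 * 2"
        using m t by (intro mult_mono) auto
      also have "\<dots> \<le> - Ai' t / Ai t" using t0(2)[of t] True t by (simp add: m_def)
      finally show ?thesis using A by (simp add: field_simps)
    next
      case False
      have "min (2 / 5) (m / 2) * sqrt (1 + t) * Ai t \<le> 2 / 5 * sqrt (1 + t) * Ai t"
        using A t by (intro mult_right_mono) auto
      moreover have "Ai' t \<le> - (2 / 5) * sqrt (1 + t) * Ai t" using ge1[of t] False by simp
      ultimately show ?thesis by linarith
    qed
  qed
qed

text \<open>With \<open>s = - t\<close> and \<open>\<phi> = (1 + s\<^sup>2)\<^bsup>1/4\<^esup>\<close>, the cross term in \<open>\<phi> y\<^sup>2 + y'\<^sup>2 / \<phi> - (\<phi>' / \<phi>\<^sup>2) y y'\<close>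
  cancels the nonintegrable part of the logarithmic derivative of the adiabatic energy.\<close>

lemma airy_energy_bound:
  fixes s y y' \<theta> f :: "real \<Rightarrow> real" and a b k K h :: real
  assumes ds: "\<And>x. x \<in> {a..b} \<Longrightarrow> (s has_real_derivative - \<theta> x) (at x)"
    and \<theta>: "\<And>x. x \<in> {a..b} \<Longrightarrow> \<theta> x \<ge> 0"
    and s: "\<And>x. x \<in> {a..b} \<Longrightarrow> s x \<ge> 0" and sb: "s b = 0"
    and dy: "\<And>x. x \<in> {a..b} \<Longrightarrow> (y has_real_derivative \<theta> x * y' x) (at x)"
    and dy': "\<And>x. x \<in> {a..b} \<Longrightarrow> (y' has_real_derivative \<theta> x * (f x - s x * y x)) (at x)"
    and f: "\<And>x. x \<in> {a..b} \<Longrightarrow> \<bar>f x\<bar> \<le> k * (\<bar>y x\<bar> + K * (1 + (s x)\<^sup>2) powr (-1/8))"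
    and k: "k \<ge> 0" and K: "K \<ge> 0" and h: "0 < h" "h \<le> 1" and x: "x \<in> {a..b}"
  shows "(1 + (s x)\<^sup>2) powr (1/8) * \<bar>y x\<bar> \<le>
    2 * exp (12 + 20 * (k / h) * sqrt (1 + s x)) * (\<bar>y b\<bar> + \<bar>y' b\<bar> + h * K)"
proof -
  define \<phi> where "\<phi> u = (1 + u\<^sup>2) powr (1/4)" for u :: real
  define c where "c u = u / 2 * (1 + u\<^sup>2) powr (-5/4)" for u :: real
  define d\<phi> where "d\<phi> u = u / 2 * (1 + u\<^sup>2) powr (-3/4)" for u :: real
  define dc where "dc u = 1 / 2 * (1 + u\<^sup>2) powr (-5/4) - 5 / 4 * u\<^sup>2 * (1 + u\<^sup>2) powr (-9/4)" for u :: real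
  \<comment> \<open>Integrating factor. The part of order (1 + u)^(-3/2) pays for the error of the
    unperturbed energy and contributes a bounded amount; the part with k / h pays for
    \<open>f\<close>. The numbers 12 and 20 are those of \<open>s1\<close> and \<open>s2\<close>
    below.\<close>
  define B where "B u = - 24 * (1 + u) powr (-1/2) + 40 * (k / h) * (1 + u) powr (1/2)" for u :: real
  define dB where "dB u = 12 * (1 + u) powr (-3/2) + 20 * (k / h) * (1 + u) powr (-1/2)" for u :: real
  have p: "1 + u\<^sup>2 > 0" for u :: real by (simp add: add_pos_nonneg)
  have D\<phi>: "(\<phi> has_real_derivative d\<phi> u) (at u)" for u
    unfolding \<phi>_def[abs_def] d\<phi>_def
    by (rule derivative_eq_intros refl p | simp)+
  have Dc: "(c has_real_derivative dc u) (at u)" for u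
    unfolding c_def[abs_def] dc_def
    by (rule derivative_eq_intros refl p | simp)+ (simp add: power2_eq_square)
  have DB: "(B has_real_derivative dB u) (at u)" if "u \<ge> 0" for u
  proof -
    have "1 + u > 0" using that by simp
    then have "((\<lambda>u. - 24 * (1 + u) powr (-1/2) + 40 * m * (1 + u) powr (1/2)) has_real_derivative
        12 * (1 + u) powr (-3/2) + 20 * m * (1 + u) powr (-1/2)) (at u)" for m
      by (auto intro!: derivative_eq_intros)
    then show ?thesis unfolding B_def[abs_def] dB_def .
  qed
  define F where "F x = \<phi> (s x) * (y x)\<^sup>2 + (y' x)\<^sup>2 / \<phi> (s x) - c (s x) * y x * y' x" for x
  \<comment> \<open>The added square absorbs the inhomogeneity: products of Y or Z with K are split
    as products with h * K, at the cost of a factor 1 / h.\<close>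
  define H where "H x = F x + (h * K)\<^sup>2" for x
  define F' where "F' x = \<theta> x * (- c (s x) * ((\<phi> (s x))\<^sup>2 - s x) * (y x)\<^sup>2
     + (2 * ((\<phi> (s x))\<^sup>2 - s x) / \<phi> (s x) + dc (s x)) * (y x * y' x)
     + (2 * y' x / \<phi> (s x) - c (s x) * y x) * f x)" for x
  have \<phi>0: "\<phi> u > 0" for u using p[of u] by (simp add: \<phi>_def)
  \<comment> \<open>This says that \<open>c\<close> is \<phi>' / \<phi>^2. With this choice the
    square of y' drops out of F', up to the forcing, and the square of y keeps only the defect
    \<phi>^2 - s.\<close>
  have c\<phi>: "c u * (\<phi> u)\<^sup>2 = d\<phi> u" for u
  proof -
    have "(1 + u\<^sup>2) powr (-5/4) * ((1 + u\<^sup>2) powr (1/4))\<^sup>2 = (1 + u\<^sup>2) powr (-5/4 + 1/4 + 1/4)"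
      unfolding powr_add by (simp add: power2_eq_square)
    then show ?thesis by (simp add: c_def \<phi>_def d\<phi>_def)
  qed
  have DF: "(F has_real_derivative F' x) (at x)" if x: "x \<in> {a..b}" for x
  proof -
    let ?D = "(d\<phi> (s x) * - \<theta> x) * (y x)\<^sup>2 + \<phi> (s x) * (2 * y x * (\<theta> x * y' x))
       + ((2 * y' x * (\<theta> x * (f x - s x * y x))) * \<phi> (s x) - (y' x)\<^sup>2 * (d\<phi> (s x) * - \<theta> x)) / (\<phi> (s x) * \<phi> (s x))
       - (((dc (s x) * - \<theta> x) * y x + c (s x) * (\<theta> x * y' x)) * y' x + c (s x) * y x * (\<theta> x * (f x - s x * y x)))"
    have "((\<lambda>x. \<phi> (s x)) has_real_derivative d\<phi> (s x) * - \<theta> x) (at x)"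
      by (rule DERIV_chain2[OF D\<phi> ds[OF x]])
    moreover have "((\<lambda>x. c (s x)) has_real_derivative dc (s x) * - \<theta> x) (at x)"
      by (rule DERIV_chain2[OF Dc ds[OF x]])
    ultimately have "(F has_real_derivative ?D) (at x)"
      unfolding F_def[abs_def]
      by (auto intro!: derivative_eq_intros dy[OF x] dy'[OF x] simp: \<phi>0[THEN less_imp_neq, symmetric] algebra_simps)
    moreover have "?D = F' x"
      unfolding F'_def c\<phi>[symmetric] using \<phi>0[of "s x"]
      by (simp add: field_simps power2_eq_square)
    ultimately show ?thesis by simp
  qed
  have key: "F x \<ge> ((y x)\<^sup>2 * \<phi> (s x)) / 2 \<and> F x \<ge> 0 \<and> 0 \<le> F' x + \<theta> x * dB (s x) * H x" if x: "x \<in> {a..b}" for x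
  proof -
    define u where "u = s x"
    have u: "u \<ge> 0" using s[OF x] by (simp add: u_def)
    \<comment> \<open>All weights are powers of this q, and u \<le> q^4, so the estimates reduce to
      counting powers.\<close>
    define q where "q = (1 + u\<^sup>2) powr (1/8)"
    have q1: "q \<ge> 1" unfolding q_def by (rule ge_one_powr_ge_zero) auto
    have q0: "q > 0" using q1 by simp
    have qp: "(1 + u\<^sup>2) powr (1/8 * real n) = q ^ n" for n
      unfolding q_def using p[of u] by (simp add: powr_powr powr_realpow[symmetric])
    have qm: "(1 + u\<^sup>2) powr (- (1/8 * real n)) = 1 / q ^ n" for n
      unfolding powr_minus qp by (simp add: inverse_eq_divide)
    have q8: "q ^ 8 = 1 + u\<^sup>2" using qp[of 8] p[of u] by simp
    have \<phi>q: "\<phi> u = q\<^sup>2" using qp[of 2] by (simp add: \<phi>_def)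
    have cq: "c u = u / 2 / q ^ 10" using qm[of 10] by (simp add: c_def)
    have dcq: "dc u = 1 / 2 / q ^ 10 - 5 / 4 * u\<^sup>2 / q ^ 18"
      using qm[of 10] qm[of 18] by (simp add: dc_def)
    have uq: "u \<le> q ^ 4"
    proof (rule power2_le_imp_le)
      show "u\<^sup>2 \<le> (q ^ 4)\<^sup>2" using q8 by (simp flip: power_mult)
    qed (use q0 in simp)
    \<comment> \<open>The defect of \<phi> as a square root of u. Since (q^4 - u) * (q^4 + u) = 1,
      it is at most q^(-4).\<close>
    define \<Delta> where "\<Delta> = (\<phi> u)\<^sup>2 - u"
    have "(q ^ 4 - u) * (q ^ 4 + u) = 1" using q8 by (simp add: algebra_simps power2_eq_square flip: power_add)
    then have "(q ^ 4 - u) * q ^ 4 \<le> 1"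
      using uq u mult_left_mono[of "q ^ 4" "q ^ 4 + u" "q ^ 4 - u"] by simp
    then have \<Delta>: "0 \<le> \<Delta>" "\<Delta> \<le> 1 / q ^ 4"
      using uq q0 by (auto simp: \<Delta>_def \<phi>q field_simps simp flip: power_mult)
    have cb: "0 \<le> c u" "c u \<le> 1 / 2 / q ^ 6"
    proof -
      show "0 \<le> c u" using u q0 by (simp add: cq)
      have "u / 2 / q ^ 10 \<le> q ^ 4 / 2 / q ^ 10" using uq q0 by (intro divide_right_mono) auto
      also have "\<dots> = 1 / 2 / q ^ 6" using q0 by (simp add: field_simps flip: power_add)
      finally show "c u \<le> 1 / 2 / q ^ 6" by (simp add: cq)
    qed
    have i6: "1 / q ^ 6 \<le> 1" "1 / q ^ 10 \<le> 1 / q ^ 6" "1 / q ^ 4 \<le> 1"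
      using q1 q0 by (auto intro!: divide_left_mono power_increasing)
    have dcb: "\<bar>dc u\<bar> \<le> 2 / q ^ 6"
    proof -
      have "5 / 4 * u\<^sup>2 / q ^ 18 \<le> 5 / 4 * q ^ 8 / q ^ 18"
        using q8 q0 by (intro divide_right_mono mult_left_mono) auto
      also have "\<dots> = 5 / 4 / q ^ 10" using q0 by (simp add: field_simps flip: power_add)
      finally have "5 / 4 * u\<^sup>2 / q ^ 18 \<le> 5 / 4 / q ^ 10" .
      moreover have "0 \<le> 5 / 4 * u\<^sup>2 / q ^ 18" "0 \<le> 1 / 2 / q ^ 10" using q0 by auto
      ultimately have "\<bar>dc u\<bar> \<le> 1 / 2 / q ^ 10 + 5 / 4 / q ^ 10"
        unfolding dcq by linarith
      also have "\<dots> = 7 / 4 * (1 / q ^ 10)" by simp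
      also have "\<dots> \<le> 2 * (1 / q ^ 6)" using i6(2) q0 by (intro mult_mono) auto
      also have "\<dots> = 2 / q ^ 6" by simp
      finally show ?thesis .
    qed
    \<comment> \<open>In these variables the energy is Y^2 + Z^2 - c * Y * Z with c between 0 and
      1/2, hence at least half of Y^2 + Z^2.\<close>
    define Y where "Y = q * y x"
    define Z where "Z = y' x / q"
    have yx: "y x = Y / q" "y' x = q * Z" using q0 by (auto simp: Y_def Z_def)
    define N where "N = Y\<^sup>2 + Z\<^sup>2"
    have N0: "N \<ge> 0" by (simp add: N_def)
    have YZ: "2 * \<bar>Y * Z\<bar> \<le> N" "\<bar>Y * Z\<bar> = \<bar>Y\<bar> * \<bar>Z\<bar>"
      using sum_squares_bound[of "\<bar>Y\<bar>" "\<bar>Z\<bar>"] by (auto simp: N_def abs_mult)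
    have Fx: "F x = N - c u * (Y * Z)"
      unfolding F_def N_def u_def[symmetric] \<phi>q yx using q0 by (simp add: field_simps power2_eq_square)
    have "\<bar>c u * (Y * Z)\<bar> \<le> 1 / 2 * (N / 2)"
      unfolding abs_mult[of "c u"] using cb YZ(1) i6(1) by (intro mult_mono) auto
    then have FN: "F x \<ge> N / 2" using N0 unfolding Fx by linarith
    have "N \<ge> Y\<^sup>2" by (simp add: N_def)
    then have FY: "F x \<ge> ((y x)\<^sup>2 * \<phi> (s x)) / 2"
      using FN q0 unfolding u_def[symmetric] \<phi>q yx by (simp add: power_divide)
    have "F' x = \<theta> x * (- (c u * \<Delta> / q\<^sup>2) * Y\<^sup>2 + (2 * \<Delta> / q\<^sup>2 + dc u) * (Y * Z)
        + (2 * Z - c u * Y) / q * f x)"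
      unfolding F'_def u_def[symmetric] \<Delta>_def[symmetric] unfolding \<phi>q yx
      using q0 by (simp add: field_simps power2_eq_square)
    moreover have "0 \<le> (- (c u * \<Delta> / q\<^sup>2) * Y\<^sup>2 + (2 * \<Delta> / q\<^sup>2 + dc u) * (Y * Z)
        + (2 * Z - c u * Y) / q * f x) + dB u * H x"
    proof -
      have t1: "c u * \<Delta> / q\<^sup>2 * Y\<^sup>2 \<le> 1 / q ^ 6 * N"
      proof (rule mult_mono)
        have "c u * \<Delta> \<le> 1 * (1 / q ^ 4)" using cb \<Delta> i6 by (intro mult_mono) auto
        then have "c u * \<Delta> / q\<^sup>2 \<le> 1 / q ^ 4 / q\<^sup>2" using q0 by (intro divide_right_mono) auto
        then show "c u * \<Delta> / q\<^sup>2 \<le> 1 / q ^ 6" by (simp flip: power_add)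
      qed (use q0 \<open>N \<ge> Y\<^sup>2\<close> in auto)
      have t2: "\<bar>(2 * \<Delta> / q\<^sup>2 + dc u) * (Y * Z)\<bar> \<le> 4 / q ^ 6 * (N / 2)"
        unfolding abs_mult[of "2 * \<Delta> / q\<^sup>2 + dc u"]
      proof (rule mult_mono)
        have "\<Delta> / q\<^sup>2 \<le> 1 / q ^ 4 / q\<^sup>2" using q0 \<Delta> by (intro divide_right_mono) auto
        then have "\<Delta> / q\<^sup>2 \<le> 1 / q ^ 6" by (simp flip: power_add)
        moreover have "0 \<le> \<Delta> / q\<^sup>2" using \<Delta> by simp
        ultimately show "\<bar>2 * \<Delta> / q\<^sup>2 + dc u\<bar> \<le> 4 / q ^ 6" using dcb by simp
      qed (use q0 YZ in auto)
      have t3: "\<bar>(2 * Z - c u * Y) / q * f x\<bar> \<le> k / q\<^sup>2 * (10 / h * H x)"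
      proof -
        have "(1 + u\<^sup>2) powr (-1/8) = 1 / q" using qm[of 1] by simp
        then have fb: "\<bar>f x\<bar> \<le> k * (\<bar>Y\<bar> + K) / q"
          using f[OF x] q0 unfolding u_def[symmetric] yx by (simp add: abs_mult field_simps)
        have "\<bar>c u * Y\<bar> \<le> 1 * \<bar>Y\<bar>" unfolding abs_mult using cb i6 by (intro mult_right_mono) auto
        then have "\<bar>2 * Z - c u * Y\<bar> \<le> 2 * \<bar>Z\<bar> + \<bar>Y\<bar>"
          using abs_triangle_ineq4[of "2 * Z" "c u * Y"] by simp
        then have "\<bar>(2 * Z - c u * Y) / q\<bar> \<le> (2 * \<bar>Z\<bar> + \<bar>Y\<bar>) / q"
          using q0 by (simp add: divide_right_mono)
        then have "\<bar>(2 * Z - c u * Y) / q * f x\<bar> \<le> (2 * \<bar>Z\<bar> + \<bar>Y\<bar>) / q * (k * (\<bar>Y\<bar> + K) / q)"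
          unfolding abs_mult using fb q0 by (intro mult_mono) auto
        also have "\<dots> = k / q\<^sup>2 * ((2 * \<bar>Z\<bar> + \<bar>Y\<bar>) * (\<bar>Y\<bar> + K))"
          by (simp add: power2_eq_square)
        also have "\<dots> \<le> k / q\<^sup>2 * (10 / h * H x)"
        proof (rule mult_left_mono)
          have "h * ((2 * \<bar>Z\<bar> + \<bar>Y\<bar>) * (\<bar>Y\<bar> + K)) = h * ((2 * \<bar>Z\<bar> + \<bar>Y\<bar>) * \<bar>Y\<bar>) + (2 * \<bar>Z\<bar> + \<bar>Y\<bar>) * (h * K)"
            by (simp add: algebra_simps)
          moreover have "h * ((2 * \<bar>Z\<bar> + \<bar>Y\<bar>) * \<bar>Y\<bar>) \<le> 1 * ((2 * \<bar>Z\<bar> + \<bar>Y\<bar>) * \<bar>Y\<bar>)"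
            using h by (intro mult_right_mono) auto
          moreover have "1 * ((2 * \<bar>Z\<bar> + \<bar>Y\<bar>) * \<bar>Y\<bar>) = 2 * \<bar>Y * Z\<bar> + Y\<^sup>2"
            by (simp add: YZ(2) algebra_simps power2_eq_square)
          moreover have "2 * ((2 * \<bar>Z\<bar> + \<bar>Y\<bar>) * (h * K)) \<le> (2 * \<bar>Z\<bar> + \<bar>Y\<bar>)\<^sup>2 + (h * K)\<^sup>2"
            using sum_squares_bound[of "2 * \<bar>Z\<bar> + \<bar>Y\<bar>" "h * K"] by (simp only: mult.assoc)
          moreover have "(2 * \<bar>Z\<bar> + \<bar>Y\<bar>)\<^sup>2 = 4 * Z\<^sup>2 + 4 * \<bar>Y * Z\<bar> + Y\<^sup>2"
            by (simp add: power2_eq_square algebra_simps abs_mult)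
          moreover have "H x = F x + (h * K)\<^sup>2" "N = Y\<^sup>2 + Z\<^sup>2" "0 \<le> (h * K)\<^sup>2" "0 \<le> Z\<^sup>2" "0 \<le> Y\<^sup>2"
            by (simp_all add: H_def N_def)
          ultimately have "h * ((2 * \<bar>Z\<bar> + \<bar>Y\<bar>) * (\<bar>Y\<bar> + K)) \<le> 10 * H x"
            using FN N0 YZ(1) by linarith
          then show "(2 * \<bar>Z\<bar> + \<bar>Y\<bar>) * (\<bar>Y\<bar> + K) \<le> 10 / h * H x"
            using h by (simp add: field_simps)
        qed (use k in auto)
        finally show ?thesis .
      qed
      have "F x \<le> H x" by (simp add: H_def)
      then have HN: "N \<le> 2 * H x" using FN by linarith
      have H0: "H x \<ge> 0" "N \<le> 2 * H x" using HN N0 by auto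
      have le: "(1 + u)\<^sup>2 / 2 \<le> 1 + u\<^sup>2"
        using sum_squares_bound[of 1 u] by (simp add: power2_sum)
      have u1: "1 + u > 0" using u by simp
      have pw: "(1 + u\<^sup>2) powr (- r) \<le> 2 * (1 + u) powr (- 2 * r)" if "0 \<le> r" "r \<le> 1" for r
      proof -
        have "(1 + u\<^sup>2) powr (- r) \<le> ((1 + u)\<^sup>2 / 2) powr (- r)"
          using u that le by (intro powr_mono2') auto
        also have "\<dots> = ((1 + u) powr 2) powr (- r) / 2 powr (- r)"
          using u1 by (simp add: powr_divide)
        also have "\<dots> = 2 powr r * (1 + u) powr (- 2 * r)"
          unfolding powr_powr by (simp add: powr_minus field_simps)
        also have "\<dots> \<le> 2 powr 1 * (1 + u) powr (- 2 * r)"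
          using that by (intro mult_right_mono powr_mono) auto
        finally show ?thesis by simp
      qed
      have q6: "1 / q ^ 6 \<le> 2 * (1 + u) powr (-3/2)" using pw[of "3/4"] qm[of 6] by simp
      have q2: "1 / q\<^sup>2 \<le> 2 * (1 + u) powr (-1/2)" using pw[of "1/4"] qm[of 2] by simp
      have "3 * (1 / q ^ 6) * N \<le> 3 * (2 * (1 + u) powr (-3/2)) * (2 * H x)"
        using q6 q0 H0 N0 by (intro mult_mono) auto
      then have s1: "1 / q ^ 6 * N + 4 / q ^ 6 * (N / 2) \<le> 12 * (1 + u) powr (-3/2) * H x" by simp
      have "k / q\<^sup>2 * (10 / h * H x) = 1 / q\<^sup>2 * (k * (10 / h * H x))" by simp
      also have "\<dots> \<le> 2 * (1 + u) powr (-1/2) * (k * (10 / h * H x))"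
        using q2 k h H0 by (intro mult_right_mono) auto
      also have "\<dots> = 20 * (k / h) * (1 + u) powr (-1/2) * H x" by (simp add: mult_ac)
      finally have s2: "k / q\<^sup>2 * (10 / h * H x) \<le> 20 * (k / h) * (1 + u) powr (-1/2) * H x" .
      have s3: "dB u * H x = 12 * (1 + u) powr (-3/2) * H x + 20 * (k / h) * (1 + u) powr (-1/2) * H x"
        by (simp only: dB_def distrib_right)
      have gen: "0 \<le> - a1 + a2 + a3 + d" if "a1 \<le> n1" "- a2 \<le> n2" "- a3 \<le> n3" "n1 + n2 \<le> d1" "n3 \<le> d2"
        "d = d1 + d2" for a1 a2 a3 n1 n2 n3 d d1 d2 :: real
        using that by linarith
      show ?thesis
        unfolding mult_minus_left
        by (rule gen[OF t1 abs_le_D2[OF t2] abs_le_D2[OF t3] s1 s2 s3])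
    qed
    ultimately have "0 \<le> F' x + \<theta> x * (dB u * H x)"
      using mult_nonneg_nonneg[OF \<theta>[OF x]] by (simp only: distrib_left[symmetric])
    then show ?thesis using FY FN N0 by (simp add: u_def mult_ac)
  qed
  \<comment> \<open>As x increases, \<open>s\<close> does not increase, so the weight exp (- B (s
    x)) carries the bound from the turning point b back into the oscillatory region.\<close>
  have mono: "H x * exp (- B (s x)) \<le> H b * exp (- B (s b))" if x: "x \<in> {a..b}" for x
  proof -
    have d: "((\<lambda>x. H x * exp (- B (s x))) has_real_derivative
          (F' z + \<theta> z * dB (s z) * H z) * exp (- B (s z))) (at z)" if z: "z \<in> {a..b}" for z
    proof -
      have "((\<lambda>x. B (s x)) has_real_derivative dB (s z) * - \<theta> z) (at z)"
        by (rule DERIV_chain2[OF DB[OF s[OF z]] ds[OF z]])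
      then show ?thesis
        unfolding H_def[abs_def] using DF[OF z]
        by (auto intro!: derivative_eq_intros simp: algebra_simps)
    qed
    have nn: "0 \<le> (F' z + \<theta> z * dB (s z) * H z) * exp (- B (s z))" if z: "z \<in> {a..b}" for z
      using key[OF z] by (intro mult_nonneg_nonneg exp_ge_zero) (elim conjE)
    have "x \<le> b" using x by simp
    then show ?thesis
    proof (rule DERIV_nonneg_imp_nondecreasing[where f = "\<lambda>x. H x * exp (- B (s x))"])
      fix z assume "x \<le> z" "z \<le> b"
      then have z: "z \<in> {a..b}" using x by simp
      show "\<exists>y. ((\<lambda>x. H x * exp (- B (s x))) has_real_derivative y) (at z) \<and> 0 \<le> y"
        by (intro exI conjI) (rule d[OF z], rule nn[OF z])
    qed
  qed
  have Hb: "H b \<le> (\<bar>y b\<bar> + \<bar>y' b\<bar> + h * K)\<^sup>2"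
  proof -
    have "H b = \<bar>y b\<bar>\<^sup>2 + \<bar>y' b\<bar>\<^sup>2 + (h * K)\<^sup>2" by (simp add: H_def F_def sb \<phi>_def c_def)
    also have "\<dots> \<le> (\<bar>y b\<bar> + \<bar>y' b\<bar> + h * K)\<^sup>2"
      using h K by (simp add: power2_sum)
    finally show ?thesis .
  qed
  have B0: "- B (s b) \<le> 24" using k h by (simp add: B_def sb)
  have Bx: "B (s x) \<le> 40 * (k / h) * sqrt (1 + s x)"
    using s[OF x] by (simp add: B_def powr_half_sqrt)
  have Hx: "H x \<le> (\<bar>y b\<bar> + \<bar>y' b\<bar> + h * K)\<^sup>2 * exp (24 + 40 * (k / h) * sqrt (1 + s x))"
  proof -
    have "H x = H x * exp (- B (s x)) * exp (B (s x))" by (simp add: exp_minus)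
    also have "\<dots> \<le> H b * exp (- B (s b)) * exp (B (s x))"
      using mono[OF x] by (intro mult_right_mono) auto
    also have "\<dots> = H b * exp (- B (s b) + B (s x))" by (simp only: exp_add mult.assoc)
    also have "\<dots> \<le> (\<bar>y b\<bar> + \<bar>y' b\<bar> + h * K)\<^sup>2 * exp (24 + 40 * (k / h) * sqrt (1 + s x))"
      using Hb B0 Bx by (intro mult_mono) auto
    finally show ?thesis .
  qed
  have "((1 + (s x)\<^sup>2) powr (1/8) * \<bar>y x\<bar>)\<^sup>2 = (y x)\<^sup>2 * \<phi> (s x)"
    by (simp add: power_mult_distrib \<phi>_def power2_eq_square mult_ac flip: powr_add)
  also have "\<dots> \<le> 2 * H x"
  proof -
    have "F x \<le> H x" by (simp add: H_def)
    moreover have "(y x)\<^sup>2 * \<phi> (s x) / 2 \<le> F x" using key[OF x] by (elim conjE)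
    ultimately show ?thesis by linarith
  qed
  also have "\<dots> \<le> 2 * ((\<bar>y b\<bar> + \<bar>y' b\<bar> + h * K)\<^sup>2 * exp (24 + 40 * (k / h) * sqrt (1 + s x)))"
    using Hx by (intro mult_left_mono) auto
  also have "\<dots> \<le> 4 * ((\<bar>y b\<bar> + \<bar>y' b\<bar> + h * K)\<^sup>2 * exp (24 + 40 * (k / h) * sqrt (1 + s x)))"
    by (intro mult_right_mono) auto
  also have "exp (24 + 40 * (k / h) * sqrt (1 + s x)) = (exp (12 + 20 * (k / h) * sqrt (1 + s x)))\<^sup>2"
    by (simp add: power2_eq_square flip: exp_add)
  also have "4 * ((\<bar>y b\<bar> + \<bar>y' b\<bar> + h * K)\<^sup>2 * \<dots>)
      = (2 * exp (12 + 20 * (k / h) * sqrt (1 + s x)) * (\<bar>y b\<bar> + \<bar>y' b\<bar> + h * K))\<^sup>2"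
    by (simp add: power_mult_distrib)
  finally show ?thesis
    using h K by (elim power2_le_imp_le) auto
qed

text \<open>The unperturbed case of the energy bound, with f = 0 and s = - t. The weight is
  \<bar>t\<bar>^(-1/4) made regular at 0.\<close>

lemma Ai_oscillatory_bound:
  obtains C where "C \<ge> 0" "\<And>t. t \<le> 0 \<Longrightarrow> \<bar>Ai t\<bar> \<le> C * (1 + t\<^sup>2) powr (-1/8)"
proof -
  obtain Ai' where Ai: "linear_ode_sol (\<lambda>t. t) Ai Ai'" using Ai_spec by blast
  define C where "C = 2 * exp 12 * (\<bar>Ai 0\<bar> + \<bar>Ai' 0\<bar>)"
  show thesis
  proof
    show "C \<ge> 0" by (simp add: C_def)
    fix t :: real assume t: "t \<le> 0"
    have "(1 + (- t)\<^sup>2) powr (1/8) * \<bar>Ai t\<bar> \<le>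
      2 * exp (12 + 20 * (0 / 1) * sqrt (1 + - t)) * (\<bar>Ai 0\<bar> + \<bar>Ai' 0\<bar> + 1 * 0)"
      by (rule airy_energy_bound[where s = uminus and f = "\<lambda>_. 0" and \<theta> = "\<lambda>_. 1" and a = t])
        (use t linear_ode_solD[OF Ai] in \<open>auto intro!: derivative_eq_intros\<close>)
    then have "(1 + t\<^sup>2) powr (1/8) * \<bar>Ai t\<bar> \<le> C" by (simp add: C_def)
    moreover have "(1 + t\<^sup>2) powr (1/8) > 0" by (simp add: add_nonneg_eq_0_iff)
    ultimately show "\<bar>Ai t\<bar> \<le> C * (1 + t\<^sup>2) powr (-1/8)"
      by (simp add: powr_minus field_simps)
  qed
qed

section \<open>The Liouville variable at a turning point\<close>

lemma DERIV_imp_continuous_on: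
  fixes f :: "real \<Rightarrow> real"
  assumes "\<And>x. x \<in> S \<Longrightarrow> (f has_real_derivative f' x) (at x)"
  shows "continuous_on S f"
  using assms by (blast intro: continuous_at_imp_continuous_on DERIV_isCont)

text \<open>Both derivatives are witnesses on an open neighbourhood, so products, powers and
  quotients can be handled without evaluating \<open>deriv\<close>; \<open>C2_at_deriv\<close>
  returns to \<open>deriv\<close> once at the end.\<close>

definition C2_at :: "(real \<Rightarrow> real) \<Rightarrow> real \<Rightarrow> bool" where
  "C2_at f x \<longleftrightarrow> (\<exists>f1 f2 U. open U \<and> x \<in> U \<and>
     (\<forall>y\<in>U. (f has_real_derivative f1 y) (at y) \<and> (f1 has_real_derivative f2 y) (at y)) \<and>
     continuous_on U f2)"

lemma C2_atI:
  assumes "open U" "x \<in> U" "\<And>y. y \<in> U \<Longrightarrow> (f has_real_derivative f1 y) (at y)"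
    "\<And>y. y \<in> U \<Longrightarrow> (f1 has_real_derivative f2 y) (at y)" "continuous_on U f2"
  shows "C2_at f x"
  using assms unfolding C2_at_def by blast

lemma C2_at_cong:
  assumes "open V" "x \<in> V" "\<And>y. y \<in> V \<Longrightarrow> f y = g y" "C2_at f x"
  shows "C2_at g x"
proof -
  obtain f1 f2 U where U: "open U" "x \<in> U"
    "\<And>y. y \<in> U \<Longrightarrow> (f has_real_derivative f1 y) (at y)"
    "\<And>y. y \<in> U \<Longrightarrow> (f1 has_real_derivative f2 y) (at y)" "continuous_on U f2"
    using assms(4) unfolding C2_at_def by blast
  show ?thesis
  proof (rule C2_atI[of "U \<inter> V"])
    show "(g has_real_derivative f1 y) (at y)" if "y \<in> U \<inter> V" for y
      by (rule has_field_derivative_transform_within_open[OF U(3)]) (use that assms(1-3) in auto)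
    show "continuous_on (U \<inter> V) f2" using U(5) continuous_on_subset by blast
  qed (use U assms in auto)
qed

lemma C2_at_deriv:
  assumes "C2_at f x"
  shows "(f has_real_derivative deriv f x) (at x)" "(deriv f has_real_derivative deriv (deriv f) x) (at x)"
    "isCont (deriv (deriv f)) x"
proof -
  obtain f1 f2 U where U: "open U" "x \<in> U"
    "\<And>y. y \<in> U \<Longrightarrow> (f has_real_derivative f1 y) (at y)"
    "\<And>y. y \<in> U \<Longrightarrow> (f1 has_real_derivative f2 y) (at y)" "continuous_on U f2"
    using assms unfolding C2_at_def by blast
  have 1: "deriv f y = f1 y" if "y \<in> U" for y using U(3)[OF that] by (rule DERIV_imp_deriv)
  show "(f has_real_derivative deriv f x) (at x)" using U 1 by simp
  have d: "(deriv f has_real_derivative f2 y) (at y)" if "y \<in> U" for y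
    by (rule has_field_derivative_transform_within_open[OF U(4)[OF that] U(1) that]) (simp add: 1)
  then have 2: "deriv (deriv f) y = f2 y" if "y \<in> U" for y using that by (blast intro: DERIV_imp_deriv)
  show "(deriv f has_real_derivative deriv (deriv f) x) (at x)" using d[OF U(2)] 2[OF U(2)] by simp
  have "continuous_on U (deriv (deriv f))" using U(5) by (rule continuous_on_eq) (simp add: 2)
  then show "isCont (deriv (deriv f)) x" using U by (simp add: continuous_on_eq_continuous_at)
qed

lemma C2_at_mult:
  assumes "C2_at f x" "C2_at g x"
  shows "C2_at (\<lambda>x. f x * g x) x"
proof -
  obtain f1 f2 U where U: "open U" "x \<in> U"
    "\<And>y. y \<in> U \<Longrightarrow> (f has_real_derivative f1 y) (at y)"
    "\<And>y. y \<in> U \<Longrightarrow> (f1 has_real_derivative f2 y) (at y)" "continuous_on U f2"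
    using assms(1) unfolding C2_at_def by blast
  obtain g1 g2 V where V: "open V" "x \<in> V"
    "\<And>y. y \<in> V \<Longrightarrow> (g has_real_derivative g1 y) (at y)"
    "\<And>y. y \<in> V \<Longrightarrow> (g1 has_real_derivative g2 y) (at y)" "continuous_on V g2"
    using assms(2) unfolding C2_at_def by blast
  have c: "continuous_on (U \<inter> V) f" "continuous_on (U \<inter> V) f1" "continuous_on (U \<inter> V) g" "continuous_on (U \<inter> V) g1"
    using U V by (auto intro!: continuous_at_imp_continuous_on DERIV_isCont)
  have c2: "continuous_on (U \<inter> V) f2" "continuous_on (U \<inter> V) g2"
    using U V by (auto intro: continuous_on_subset)
  show ?thesis
  proof (rule C2_atI[of "U \<inter> V" x _ "\<lambda>y. f1 y * g y + f y * g1 y" "\<lambda>y. f2 y * g y + 2 * (f1 y * g1 y) + f y * g2 y"])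
    fix y assume "y \<in> U \<inter> V"
    then show "((\<lambda>x. f x * g x) has_real_derivative f1 y * g y + f y * g1 y) (at y)"
      "((\<lambda>y. f1 y * g y + f y * g1 y) has_real_derivative f2 y * g y + 2 * (f1 y * g1 y) + f y * g2 y) (at y)"
      using U V by (auto intro!: derivative_eq_intros)
  qed (use U V c c2 in \<open>auto intro!: continuous_intros\<close>)
qed

lemma C2_at_powr:
  assumes "C2_at f x" "f x > 0"
  shows "C2_at (\<lambda>x. f x powr r) x"
proof -
  obtain f1 f2 U where U: "open U" "x \<in> U"
    "\<And>y. y \<in> U \<Longrightarrow> (f has_real_derivative f1 y) (at y)"
    "\<And>y. y \<in> U \<Longrightarrow> (f1 has_real_derivative f2 y) (at y)" "continuous_on U f2"
    using assms(1) unfolding C2_at_def by blast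
  have cU: "continuous_on U f"
    using U by (auto intro!: continuous_at_imp_continuous_on DERIV_isCont)
  define V where "V = U \<inter> f -` {0<..}"
  have V: "open V" "x \<in> V" unfolding V_def
    using continuous_open_preimage[OF cU U(1), of "{0<..}"] U assms by auto
  have pos: "f y > 0" "y \<in> U" if "y \<in> V" for y using that by (auto simp: V_def)
  have c: "continuous_on V f" "continuous_on V f1" "continuous_on V f2"
    using pos(2) by (auto intro: DERIV_imp_continuous_on[OF U(3)] DERIV_imp_continuous_on[OF U(4)] continuous_on_subset[OF U(5)])
  show ?thesis
  proof (rule C2_atI[OF V, of _ "\<lambda>y. r * f y powr (r - 1) * f1 y"
        "\<lambda>y. r * ((r - 1) * f y powr (r - 1 - 1) * f1 y) * f1 y + r * f y powr (r - 1) * f2 y"])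
    fix y assume y: "y \<in> V"
    show "((\<lambda>x. f x powr r) has_real_derivative r * f y powr (r - 1) * f1 y) (at y)"
      using DERIV_fun_powr[OF U(3)[OF pos(2)[OF y]] pos(1)[OF y], of r] by (simp add: mult_ac)
    have d: "((\<lambda>x. f x powr (r - 1)) has_real_derivative (r - 1) * f y powr (r - 1 - 1) * f1 y) (at y)"
      using DERIV_fun_powr[OF U(3)[OF pos(2)[OF y]] pos(1)[OF y], of "r - 1"] by (simp add: mult_ac)
    show "((\<lambda>y. r * f y powr (r - 1) * f1 y) has_real_derivative
        r * ((r - 1) * f y powr (r - 1 - 1) * f1 y) * f1 y + r * f y powr (r - 1) * f2 y) (at y)"
      using DERIV_mult[OF DERIV_cmult[OF d, of r] U(4)[OF pos(2)[OF y]]] by (simp add: mult_ac)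
  qed (use pos(1) in \<open>auto intro!: continuous_intros c dest: less_imp_neq[symmetric]\<close>)
qed

lemma C2_at_const: "C2_at (\<lambda>_. c) x"
  by (rule C2_atI[of UNIV _ _ "\<lambda>_. 0" "\<lambda>_. 0"]) auto

lemma C2_at_cmult: "C2_at f x \<Longrightarrow> C2_at (\<lambda>x. c * f x) x"
  by (rule C2_at_mult[OF C2_at_const])

lemma C2_at_divide:
  assumes "C2_at f x" "C2_at g x" "g x > 0"
  shows "C2_at (\<lambda>x. f x / g x) x"
proof -
  obtain U g1 where U: "open U" "x \<in> U" "\<And>y. y \<in> U \<Longrightarrow> (g has_real_derivative g1 y) (at y)"
    using assms(2) unfolding C2_at_def by blast
  show ?thesis
  proof (rule C2_at_cong)
    show "open (U \<inter> g -` {0<..})"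
      using continuous_open_preimage[OF DERIV_imp_continuous_on[OF U(3)] U(1), of "{0<..}"] by simp
    show "C2_at (\<lambda>x. f x * g x powr (- 1)) x"
      by (intro C2_at_mult C2_at_powr assms)
  qed (use U(2) assms(3) in \<open>auto simp: powr_minus_divide\<close>)
qed

section \<open>Weighted averages along segments issuing from a point\<close>

lemma segment_bound:
  fixes s d r :: real
  assumes "\<bar>d\<bar> < r" "s \<in> {0..1}"
  shows "\<bar>s * d\<bar> < r"
proof -
  have "\<bar>s * d\<bar> \<le> 1 * \<bar>d\<bar>" unfolding abs_mult using assms by (intro mult_right_mono) auto
  then show ?thesis using assms by simp
qed

text \<open>Differentiation under the integral sign multiplies the weight by s. The result has the
  same shape, so the lemma can be applied again to its own output.\<close>

lemma weighted_average_deriv: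
  fixes f f1 w :: "real \<Rightarrow> real"
  assumes w: "continuous_on {0..1} w" and r: "r > 0"
    and f: "\<And>x. \<bar>x - x0\<bar> < r \<Longrightarrow> (f has_real_derivative f1 x) (at x)"
    and f1: "continuous_on {x0 - r<..<x0 + r} f1" and x: "\<bar>x - x0\<bar> < r"
  shows "((\<lambda>x. integral {0..1} (\<lambda>s. w s * f (x0 + s * (x - x0)))) has_real_derivative
    integral {0..1} (\<lambda>s. w s * s * f1 (x0 + s * (x - x0)))) (at x)"
proof -
  let ?U = "{x0 - r<..<x0 + r}"
  have in_U: "x0 + s * (x - x0) \<in> ?U" if "x \<in> ?U" "s \<in> {0..1}" for x s
    using segment_bound[of "x - x0" r s] that by (auto simp: abs_less_iff)
  have fc: "continuous_on ?U f"
    by (rule DERIV_imp_continuous_on, rule f) (auto simp: abs_less_iff)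
  have "((\<lambda>x. integral (cbox 0 1) (\<lambda>s. w s * f (x0 + s * (x - x0)))) has_real_derivative
    integral (cbox 0 1) (\<lambda>s. w s * s * f1 (x0 + s * (x - x0)))) (at x within ?U)"
  proof (rule leibniz_rule_field_derivative[where U = ?U])
    fix x s assume xs: "x \<in> ?U" "s \<in> cbox 0 (1::real)"
    then have "(f has_real_derivative f1 (x0 + s * (x - x0))) (at (x0 + s * (x - x0)))"
      using in_U[of x s] by (intro f) (auto simp: abs_less_iff)
    then show "((\<lambda>x. w s * f (x0 + s * (x - x0))) has_real_derivative w s * s * f1 (x0 + s * (x - x0))) (at x within ?U)"
      by (auto intro!: derivative_eq_intros DERIV_chain'[of _ _ _ _ f])
  next
    fix x assume "x \<in> ?U"
    then show "(\<lambda>s. w s * f (x0 + s * (x - x0))) integrable_on cbox 0 1"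
      by (intro integrable_continuous) (use in_U w in \<open>auto intro!: continuous_intros continuous_on_compose2[OF fc]\<close>)
  next
    show "continuous_on (?U \<times> cbox 0 1) (\<lambda>(x, s). w s * s * f1 (x0 + s * (x - x0)))"
      unfolding split_beta
      by (intro continuous_intros continuous_on_compose2[OF f1] continuous_on_compose2[OF w])
        (use in_U in auto)
  qed (use x in \<open>auto simp: abs_less_iff\<close>)
  moreover have "at x within ?U = at x" using x by (intro at_within_open) (auto simp: abs_less_iff)
  ultimately show ?thesis by simp
qed

text \<open>Averaging preserves class C^2. Dividing out the zero at the turning point therefore
  loses no regularity beyond that of the function averaged.\<close>

lemma C2_weighted_average:
  fixes f f1 f2 w :: "real \<Rightarrow> real"
  assumes w: "continuous_on {0..1} w" and r: "r > 0"
    and f: "\<And>x. \<bar>x - x0\<bar> < r \<Longrightarrow> (f has_real_derivative f1 x) (at x)"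
    and f1: "\<And>x. \<bar>x - x0\<bar> < r \<Longrightarrow> (f1 has_real_derivative f2 x) (at x)"
    and f2: "continuous_on {x0 - r<..<x0 + r} f2" and x: "\<bar>x - x0\<bar> < r"
  shows "C2_at (\<lambda>x. integral {0..1} (\<lambda>s. w s * f (x0 + s * (x - x0)))) x"
proof -
  let ?U = "{x0 - r<..<x0 + r}"
  have f1c: "continuous_on ?U f1"
    by (rule DERIV_imp_continuous_on, rule f1) (auto simp: abs_less_iff)
  have in_U: "x0 + s * (x - x0) \<in> ?U" if "x \<in> ?U" "s \<in> {0..1}" for x s
    using segment_bound[of "x - x0" r s] that by (auto simp: abs_less_iff)
  show ?thesis
  proof (rule C2_atI)
    show "open ?U" "x \<in> ?U" using x by (auto simp: abs_less_iff)
    fix y assume "y \<in> ?U"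
    then have y: "\<bar>y - x0\<bar> < r" by (auto simp: abs_less_iff)
    show "((\<lambda>x. integral {0..1} (\<lambda>s. w s * f (x0 + s * (x - x0)))) has_real_derivative
        integral {0..1} (\<lambda>s. w s * s * f1 (x0 + s * (y - x0)))) (at y)"
      by (rule weighted_average_deriv[OF w r f f1c y])
    show "((\<lambda>x. integral {0..1} (\<lambda>s. w s * s * f1 (x0 + s * (x - x0)))) has_real_derivative
        integral {0..1} (\<lambda>s. w s * s * s * f2 (x0 + s * (y - x0)))) (at y)"
      by (rule weighted_average_deriv[OF _ r f1 f2 y]) (intro continuous_intros w)
  next
    have "continuous_on ?U (\<lambda>x. integral (cbox 0 1) (\<lambda>s. w s * s * s * f2 (x0 + s * (x - x0))))"
      by (rule integral_continuous_on_param, unfold split_beta,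
          intro continuous_intros continuous_on_compose2[OF f2] continuous_on_compose2[OF w])
        (use in_U in auto)
    then show "continuous_on ?U (\<lambda>x. integral {0..1} (\<lambda>s. w s * s * s * f2 (x0 + s * (x - x0))))" by simp
  qed
qed

section \<open>The action integral and the variable \<open>xi\<close> at a turning point\<close>

lemma LBINT_deriv:
  fixes f :: "real \<Rightarrow> real" and a x :: real
  assumes "continuous_on UNIV f"
  shows "((\<lambda>x. LBINT y=a..x. f y) has_real_derivative f x) (at x)"
proof -
  define l :: real where "l = min a x - 1"
  define u :: real where "u = max a x + 1"
  have "((\<lambda>x. LBINT y=a..x. f y) has_vector_derivative f x) (at x within {l..u})"
    by (rule interval_integral_FTC2) (use assms in \<open>auto simp: l_def u_def intro: continuous_on_subset\<close>)
  moreover have "at x within {l..u} = at x" by (rule at_within_interior) (auto simp: l_def u_def)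
  ultimately show ?thesis by (simp add: has_real_derivative_iff_has_vector_derivative)
qed

lemma powr_three_halves: assumes "(a::real) > 0" shows "(a * sqrt a * b) powr (2/3) = a * b powr (2/3)"
proof -
  have "a * sqrt a = a powr (1 + 1/2)" unfolding powr_add using assms by (simp add: powr_half_sqrt)
  also have "\<dots> = a powr (3/2)" by simp
  finally show ?thesis using assms by (simp add: powr_mult powr_powr)
qed

text \<open>Models the right turning point; the left one becomes an instance after reflection. The
  bound r \<le> xp - xm keeps the ball around \<open>xp\<close> to the right of \<open>xm\<close>,
  where \<open>g\<close> is positive.\<close>

locale turning_point =
  fixes q q1 q2 q3 :: "real \<Rightarrow> real" and xm xp r :: real
  assumes dq: "(q has_real_derivative q1 x) (at x)" and dq1: "(q1 has_real_derivative q2 x) (at x)"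
    and q2_cont: "continuous_on UNIV q2"
    and r: "r > 0" "r \<le> xp - xm"
    and dq2: "\<bar>x - xp\<bar> < r \<Longrightarrow> (q2 has_real_derivative q3 x) (at x)"
    and q3_cont: "continuous_on {xp - r<..<xp + r} q3"
    and q_xp: "q xp = 0" and q1_xp: "q1 xp > 0"
    and q_neg: "xm < x \<Longrightarrow> x < xp \<Longrightarrow> q x < 0" and q_pos: "x > xp \<Longrightarrow> q x > 0"
begin

text \<open>Hadamard quotients: \<open>q = (x - xp) g\<close> and \<open>S = (x - xp) \<bar>x - xp\<bar>\<^bsup>1/2\<^esup> G\<close>, whence \<open>xi = (x - xp) k\<close> near
  \<open>xp\<close>. The value of \<open>P = xi / q = xi'\<^bsup>-2\<^esup>\<close> at \<open>xp\<close> is the one that makes it continuous.\<close>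

definition "g x = integral {0..1} (\<lambda>s. q1 (xp + s * (x - xp)))"
definition "G x = integral {0..1} (\<lambda>s. sqrt s * g (xp + s * (x - xp)) powr (1/2))"
definition "S (x::real) = (LBINT y=xp..x. sqrt \<bar>q y\<bar>)"
definition "xi x = (if x \<ge> xp then (3/2 * S x) powr (2/3) else - ((3/2 * - S x) powr (2/3)))"
definition "k x = (3/2 * G x) powr (2/3)"
definition "P x = (if x = xp then k xp / g xp else xi x / q x)"

lemma q_cont: "continuous_on A q" "continuous_on A q1"
  using dq dq1 by (auto intro: DERIV_imp_continuous_on)

text \<open>Fundamental theorem of calculus along the segment from \<open>xp\<close> to x.\<close>

lemma q_eq: "q x = (x - xp) * g x"
proof -
  have "((\<lambda>s. (x - xp) * q1 (xp + s * (x - xp))) has_integral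
      q (xp + 1 * (x - xp)) - q (xp + 0 * (x - xp))) {0..1}"
  proof (rule fundamental_theorem_of_calculus)
    fix s :: real
    show "((\<lambda>s. q (xp + s * (x - xp))) has_vector_derivative (x - xp) * q1 (xp + s * (x - xp))) (at s within {0..1})"
      unfolding has_real_derivative_iff_has_vector_derivative[symmetric]
      by (rule DERIV_cong[OF DERIV_chain2[OF dq]]) (auto intro!: derivative_eq_intros)
  qed simp
  then have "q x = integral {0..1} (\<lambda>s. (x - xp) * q1 (xp + s * (x - xp)))"
    using q_xp by (simp add: has_integral_iff)
  then show ?thesis by (simp add: g_def)
qed

lemma g_pos: assumes "xm < x" shows "g x > 0"
proof (cases "x = xp")
  case True
  then show ?thesis using q1_xp by (simp add: g_def)
next
  case False
  then show ?thesis
    using q_eq[of x] q_neg[of x] q_pos[of x] assms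
    by (cases "x < xp") (auto simp: zero_less_mult_iff mult_less_0_iff)
qed

lemma ball_xm: "\<bar>x - xp\<bar> < r \<Longrightarrow> xm < x"
  using r by (auto simp: abs_less_iff)

text \<open>\<open>g\<close> averages q', which is of class C^2 where q is of class C^3; the
  restriction to the ball comes from here.\<close>

lemma g_C2: assumes "\<bar>x - xp\<bar> < r" shows "C2_at g x"
  using C2_weighted_average[of "\<lambda>_. 1" r xp q1 q2 q3 x] assms dq1 dq2 q3_cont r
  by (simp add: g_def[abs_def])

lemma sqrt_g_C2: assumes "\<bar>x - xp\<bar> < r" shows "C2_at (\<lambda>x. g x powr (1/2)) x"
  by (rule C2_at_powr[OF g_C2[OF assms] g_pos[OF ball_xm[OF assms]]])

lemma G_C2: assumes "\<bar>x - xp\<bar> < r" shows "C2_at G x"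
  unfolding G_def[abs_def]
proof (rule C2_weighted_average[where w = sqrt and f = "\<lambda>x. g x powr (1/2)", OF _ r(1) _ _ _ assms])
  show "continuous_on {0..1} sqrt" by (intro continuous_intros)
  show "((\<lambda>x. g x powr (1/2)) has_real_derivative deriv (\<lambda>x. g x powr (1/2)) x) (at x)"
    "(deriv (\<lambda>x. g x powr (1/2)) has_real_derivative deriv (deriv (\<lambda>x. g x powr (1/2))) x) (at x)"
    if "\<bar>x - xp\<bar> < r" for x
    using C2_at_deriv[OF sqrt_g_C2[OF that]] by auto
  show "continuous_on {xp - r<..<xp + r} (deriv (deriv (\<lambda>x. g x powr (1/2))))"
    by (intro continuous_at_imp_continuous_on ballI C2_at_deriv(3)[OF sqrt_g_C2]) (auto simp: abs_less_iff)
qed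

lemma S_deriv: "(S has_real_derivative sqrt \<bar>q x\<bar>) (at x)"
  unfolding S_def[abs_def] by (rule LBINT_deriv) (intro continuous_intros q_cont)

lemma S_xp: "S xp = 0"
  by (simp add: S_def)

lemma S_pos: assumes "x > xp" shows "S x > 0"
proof -
  have "S xp < S x"
  proof (rule DERIV_pos_imp_increasing_open[OF assms])
    show "\<exists>d. (S has_real_derivative d) (at y) \<and> 0 < d" if "xp < y" for y
      using q_pos[OF that] by (intro exI[of _ "sqrt \<bar>q y\<bar>"] conjI S_deriv) simp
  qed (rule DERIV_imp_continuous_on[OF S_deriv])
  then show ?thesis by (simp add: S_xp)
qed

lemma S_neg: assumes "xm < x" "x < xp" shows "S x < 0"
proof -
  have "S x < S xp"
  proof (rule DERIV_pos_imp_increasing_open[OF assms(2)])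
    show "\<exists>d. (S has_real_derivative d) (at y) \<and> 0 < d" if "x < y" "y < xp" for y
      using q_neg[of y] that assms by (intro exI[of _ "sqrt \<bar>q y\<bar>"] conjI S_deriv) simp
  qed (rule DERIV_imp_continuous_on[OF S_deriv])
  then show ?thesis by (simp add: S_xp)
qed

text \<open>Substituting y = xp + s (x - xp) and inserting q = (x - xp) g lets the factor of order
  3/2 leave the integral; what remains is smooth.\<close>

lemma S_eq: assumes x: "\<bar>x - xp\<bar> < r" shows "S x = (x - xp) * sqrt \<bar>x - xp\<bar> * G x"
proof -
  have "(LBINT s=0..1. (x - xp) *\<^sub>R sqrt \<bar>q (xp + s * (x - xp))\<bar>)
      = (LBINT y=ereal (xp + 0 * (x - xp))..ereal (xp + 1 * (x - xp)). sqrt \<bar>q y\<bar>)"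
    unfolding zero_ereal_def one_ereal_def
    by (rule interval_integral_substitution_finite) (auto intro!: derivative_eq_intros continuous_intros q_cont)
  then have "S x = (LBINT s=ereal 0..ereal 1. (x - xp) * sqrt \<bar>q (xp + s * (x - xp))\<bar>)"
    by (simp add: S_def zero_ereal_def one_ereal_def)
  also have "\<dots> = integral {0..1} (\<lambda>s. (x - xp) * sqrt \<bar>q (xp + s * (x - xp))\<bar>)"
    by (rule interval_integral_eq_integral)
      (auto intro!: borel_integrable_atLeastAtMost' continuous_intros continuous_on_compose2[OF q_cont(1)[of UNIV]])
  also have "\<dots> = integral {0..1} (\<lambda>s. ((x - xp) * sqrt \<bar>x - xp\<bar>) * (sqrt s * g (xp + s * (x - xp)) powr (1/2)))"
  proof (rule integral_cong)
    fix s :: real assume s: "s \<in> {0..1}"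
    have "g (xp + s * (x - xp)) > 0" using segment_bound[OF x s] by (intro g_pos ball_xm) auto
    then show "(x - xp) * sqrt \<bar>q (xp + s * (x - xp))\<bar> =
        ((x - xp) * sqrt \<bar>x - xp\<bar>) * (sqrt s * g (xp + s * (x - xp)) powr (1/2))"
      using s by (simp add: q_eq[of "xp + s * (x - xp)"] abs_mult real_sqrt_mult powr_half_sqrt)
  qed
  finally show ?thesis by (simp add: G_def)
qed

text \<open>The average of sqrt s over [0, 1] is 2/3, which cancels the 3/2 in the definition of
  \<open>xi\<close>.\<close>

lemma G_xp: "3/2 * G xp = g xp powr (1/2)"
proof -
  have "((\<lambda>s. sqrt s) has_integral 2/3 * 1 powr (3/2) - 2/3 * 0 powr (3/2)) {0..1::real}"
  proof (rule fundamental_theorem_of_calculus_interior)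
    show "continuous_on {0..1} (\<lambda>s::real. 2/3 * s powr (3/2))"
      by (intro continuous_on_mult continuous_on_const continuous_on_powr' continuous_on_id) auto
    fix s :: real assume "s \<in> {0<..<1}"
    then show "((\<lambda>s. 2/3 * s powr (3/2)) has_vector_derivative sqrt s) (at s)"
      unfolding has_real_derivative_iff_has_vector_derivative[symmetric]
      by (auto intro!: derivative_eq_intros simp: powr_half_sqrt)
  qed simp
  then show ?thesis by (simp add: G_def has_integral_iff)
qed

lemma G_pos: assumes x: "\<bar>x - xp\<bar> < r" shows "G x > 0"
proof (cases "x = xp")
  case True
  have "3/2 * G xp > 0" unfolding G_xp using g_pos[OF ball_xm[OF x]] True by simp
  then show ?thesis using True by simp
next
  case False
  then show ?thesis
    using S_eq[OF x] S_pos[of x] S_neg[OF ball_xm[OF x]]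
    by (cases "x < xp") (auto simp: zero_less_mult_iff mult_less_0_iff)
qed

lemma xi_eq: assumes x: "\<bar>x - xp\<bar> < r" shows "xi x = (x - xp) * k x"
proof -
  note S = S_eq[OF x]
  show ?thesis
  proof (cases x xp rule: linorder_cases)
    case less
    then have e: "3/2 * - S x = (xp - x) * sqrt (xp - x) * (3/2 * G x)"
      unfolding S by (simp add: algebra_simps)
    have "(3/2 * - S x) powr (2/3) = (xp - x) * k x"
      unfolding e k_def using less by (intro powr_three_halves) simp
    then have "xi x = - ((xp - x) * k x)" using less by (simp add: xi_def)
    then show ?thesis by (simp add: algebra_simps)
  next
    case equal then show ?thesis by (simp add: xi_def S_xp)
  next
    case greater
    then have e: "3/2 * S x = (x - xp) * sqrt (x - xp) * (3/2 * G x)"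
      unfolding S by (simp add: algebra_simps)
    have "(3/2 * S x) powr (2/3) = (x - xp) * k x"
      unfolding e k_def using greater by (intro powr_three_halves) simp
    then show ?thesis using greater by (simp add: xi_def)
  qed
qed

lemma k_C2: assumes "\<bar>x - xp\<bar> < r" shows "C2_at k x"
  unfolding k_def[abs_def] using G_pos[OF assms]
  by (intro C2_at_powr C2_at_cmult G_C2[OF assms]) simp

lemma P_eq: assumes x: "\<bar>x - xp\<bar> < r" shows "P x = k x / g x"
  using xi_eq[OF x] q_eq[of x] by (simp add: P_def)

lemma xi_pos: "x > xp \<Longrightarrow> xi x > 0" using S_pos[of x] by (simp add: xi_def)

lemma xi_neg: "xm < x \<Longrightarrow> x < xp \<Longrightarrow> xi x < 0" using S_neg[of x] by (simp add: xi_def)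

lemma P_pos: assumes "xm < x" shows "P x > 0"
proof (cases x xp rule: linorder_cases)
  case equal
  then show ?thesis using g_pos[of xp] G_pos[of xp] r assms by (simp add: P_def k_def)
qed (use assms xi_pos xi_neg q_pos q_neg in \<open>auto simp: P_def divide_neg_neg\<close>)

lemma xi_P: assumes "xm < x" shows "xi x = P x * q x"
  using q_pos[of x] q_neg[of x] assms q_xp by (cases x xp rule: linorder_cases) (auto simp: P_def xi_def S_xp)

lemma xi_S: "x \<ge> xp \<Longrightarrow> 2/3 * xi x powr (3/2) = S x"
  using S_pos[of x] S_xp by (cases "x = xp") (auto simp: xi_def powr_powr)

lemma sqrt_q_deriv: assumes "xm < x" "x \<noteq> xp"
  shows "((\<lambda>x. sqrt \<bar>q x\<bar>) has_real_derivative q1 x * sgn (q x) / (2 * sqrt \<bar>q x\<bar>)) (at x)"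
proof -
  define U where "U = (if x < xp then {xm<..<xp} else {xp<..})"
  have U: "open U" "x \<in> U" "\<And>y. y \<in> U \<Longrightarrow> sgn (q y) = sgn (q x)" "q x \<noteq> 0"
    using assms q_pos q_neg by (auto simp: U_def split: if_splits) (metis less_irrefl linorder_neqE)+
  define c where "c = sgn (q x)"
  have abs_q: "\<bar>q y\<bar> = c * q y" if "y \<in> U" for y
    using U(3)[OF that] unfolding c_def by (metis abs_sgn mult.commute)
  have "c * q x > 0" using U(4) abs_q[OF U(2)] by (metis zero_less_abs_iff)
  then have "((\<lambda>y. sqrt (c * q y)) has_real_derivative inverse (sqrt (c * q x)) / 2 * (c * q1 x)) (at x)"
    by (intro DERIV_chain2[OF DERIV_real_sqrt] DERIV_cmult dq)
  moreover have "inverse s / 2 * (a * b) = b * a / (2 * s)" for a b s :: real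
    by (cases "s = 0") (auto simp: field_simps)
  ultimately have "((\<lambda>y. sqrt (c * q y)) has_real_derivative q1 x * c / (2 * sqrt \<bar>q x\<bar>)) (at x)"
    unfolding abs_q[OF U(2)] by (simp only:)
  then show ?thesis
    unfolding c_def[symmetric]
    by (rule has_field_derivative_transform_within_open[OF _ U(1,2)]) (simp add: abs_q)
qed

lemma S_C2: assumes "xm < x" "x \<noteq> xp" shows "C2_at S x"
proof (rule C2_atI)
  show "open ({xm<..} - {xp})" by auto
  show "x \<in> {xm<..} - {xp}" using assms by auto
  fix y assume "y \<in> {xm<..} - {xp}"
  then show "(S has_real_derivative sqrt \<bar>q y\<bar>) (at y)"
    "((\<lambda>x. sqrt \<bar>q x\<bar>) has_real_derivative q1 y * sgn (q y) / (2 * sqrt \<bar>q y\<bar>)) (at y)"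
    using S_deriv sqrt_q_deriv by auto
next
  have "q y \<noteq> 0" if "xm < y" "y \<noteq> xp" for y using q_pos[of y] q_neg[of y] that by (cases "y < xp") auto
  then show "continuous_on ({xm<..} - {xp}) (\<lambda>y. q1 y * sgn (q y) / (2 * sqrt \<bar>q y\<bar>))"
    by (intro continuous_intros q_cont) auto
qed

lemma q_C2: "C2_at q x"
  by (rule C2_atI[of UNIV, OF _ _ dq dq1 q2_cont]) auto

text \<open>Away from \<open>xp\<close> the function is a quotient of a power of S or - S by q or -
  q, all without zeros. At \<open>xp\<close> this form is singular; the common factor x - xp is
  cancelled first, which leaves k / g.\<close>

lemma P_C2: assumes "xm < x" shows "C2_at P x"
proof (cases x xp rule: linorder_cases)
  case equal
  have c: "C2_at (\<lambda>x. k x / g x) xp"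
    using r g_pos[of xp] assms equal by (intro C2_at_divide k_C2 g_C2) auto
  have "C2_at P xp"
  proof (rule C2_at_cong[OF _ _ _ c])
    show "open {xp - r<..<xp + r}" "xp \<in> {xp - r<..<xp + r}" using r by auto
    show "k y / g y = P y" if "y \<in> {xp - r<..<xp + r}" for y
      using P_eq[of y] that by (simp add: abs_less_iff)
  qed
  then show ?thesis using equal by simp
next
  case greater
  have c: "C2_at (\<lambda>x. (3/2 * S x) powr (2/3) / q x) x"
    using greater assms S_pos[of x] q_pos[of x] by (intro C2_at_divide C2_at_powr C2_at_cmult S_C2 q_C2) auto
  show ?thesis
  proof (rule C2_at_cong[OF _ _ _ c])
    show "open {xp<..}" "x \<in> {xp<..}" using greater by auto
    show "(3/2 * S y) powr (2/3) / q y = P y" if "y \<in> {xp<..}" for y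
      using that by (simp add: P_def xi_def)
  qed
next
  case less
  have c: "C2_at (\<lambda>x. (3/2 * (- 1 * S x)) powr (2/3) / (- 1 * q x)) x"
    using less assms S_neg[of x] q_neg[of x] by (intro C2_at_divide C2_at_powr C2_at_cmult S_C2 q_C2) auto
  show ?thesis
  proof (rule C2_at_cong[OF _ _ _ c])
    show "open {..<xp}" "x \<in> {..<xp}" using less by auto
    show "(3/2 * (- 1 * S y)) powr (2/3) / (- 1 * q y) = P y" if "y \<in> {..<xp}" for y
      using that by (simp add: P_def xi_def)
  qed
qed

text \<open>Off the turning point this is the eikonal equation xi * xi'^2 = q. At \<open>xp\<close>
  the product rule applied to (x - xp) * k gives k xp = g xp powr (1/3), and P xp = g xp powr (-2/3)
  agrees with it.\<close>

lemma xi_deriv: assumes "xm < x" shows "(xi has_real_derivative P x powr (-1/2)) (at x)"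
proof (cases x xp rule: linorder_cases)
  case equal
  have g0: "g xp > 0" using g_pos assms equal by simp
  have kx: "k xp = g xp powr (1/3)" unfolding k_def G_xp by (simp add: powr_powr)
  have "P xp = g xp powr (1/3) / g xp powr 1" using g0 by (simp add: P_def kx)
  also have "\<dots> = g xp powr (1/3 - 1)" by (simp only: powr_diff)
  also have "\<dots> = g xp powr (- 2/3)" by simp
  finally have Pk: "P xp powr (-1/2) = k xp" by (simp add: powr_powr kx)
  have "((\<lambda>x. (x - xp) * k x) has_real_derivative k xp) (at xp)"
    using C2_at_deriv(1)[OF k_C2, of xp] r by (auto intro!: derivative_eq_intros)
  then have "(xi has_real_derivative k xp) (at xp)"
    by (rule has_field_derivative_transform_within_open[of _ _ _ "{xp - r<..<xp + r}"])
      (use r xi_eq in \<open>auto simp: abs_less_iff\<close>)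
  then show ?thesis using equal Pk by simp
next
  case greater
  have S: "S x > 0" and q: "q x > 0" using S_pos q_pos greater by auto
  have "P x powr (-1/2) = ((3/2 * S x) powr (2/3) / q x) powr (-1/2)"
    using greater by (simp add: P_def xi_def)
  also have "\<dots> = (3/2 * S x) powr (2/3 * (-1/2)) / q x powr (-1/2)"
    unfolding powr_powr[symmetric] by (rule powr_divide)
  also have "\<dots> = (3/2 * S x) powr (-1/3) * sqrt (q x)"
    using q by (simp add: powr_minus powr_half_sqrt field_simps)
  finally have e: "P x powr (-1/2) = (3/2 * S x) powr (-1/3) * sqrt (q x)" .
  have "((\<lambda>x. (3/2 * S x) powr (2/3)) has_real_derivative P x powr (-1/2)) (at x)"
    unfolding e using S q DERIV_fun_powr[OF DERIV_cmult[OF S_deriv, of "3/2"], of x "2/3"]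
    by (simp add: mult_ac)
  then show ?thesis
    by (rule has_field_derivative_transform_within_open[of _ _ _ "{xp<..}"]) (use greater in \<open>auto simp: xi_def\<close>)
next
  case less
  have S: "- S x > 0" and q: "- q x > 0" using S_neg q_neg less assms by auto
  have "P x powr (-1/2) = ((3/2 * - S x) powr (2/3) / (- q x)) powr (-1/2)"
    using less by (simp add: P_def xi_def)
  also have "\<dots> = (3/2 * - S x) powr (2/3 * (-1/2)) / (- q x) powr (-1/2)"
    unfolding powr_powr[symmetric] by (rule powr_divide)
  also have "\<dots> = (3/2 * - S x) powr (-1/3) * sqrt (- q x)"
    using q by (simp add: powr_minus powr_half_sqrt field_simps)
  finally have e: "P x powr (-1/2) = (3/2 * - S x) powr (-1/3) * sqrt (- q x)" .
  have d: "((\<lambda>x. 3/2 * - S x) has_real_derivative 3/2 * - sqrt \<bar>q x\<bar>) (at x)"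
    by (intro DERIV_cmult DERIV_minus S_deriv)
  have "((\<lambda>x. - ((3/2 * - S x) powr (2/3))) has_real_derivative P x powr (-1/2)) (at x)"
    unfolding e using S q DERIV_minus[OF DERIV_fun_powr[OF d, of "2/3"]]
    by (simp add: mult_ac)
  then show ?thesis
    by (rule has_field_derivative_transform_within_open[of _ _ _ "{..<xp}"]) (use less in \<open>auto simp: xi_def\<close>)
qed

end

section \<open>Comparison with the Airy function\<close>

lemma powr_nonpos_le_one: "(s::real) \<ge> 1 \<Longrightarrow> p \<le> 0 \<Longrightarrow> s powr p \<le> 1"
  using powr_mono[of p 0 s] by simp

text \<open>Conversions between h and \<delta>; in particular \<delta>^3 = h^2 scales the equation,
  and \<delta>^(3/2) = h measures the errors.\<close>

lemma two_thirds_powr: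
  assumes h: "(h::real) > 0"
  shows "h powr (2/3) > 0" "(h powr (2/3)) ^ 3 = h\<^sup>2" "sqrt (h powr (2/3)) * h powr (2/3) = h"
    "h powr (-2/3) = 1 / h powr (2/3)" "h powr (1/6) = (h powr (2/3)) powr (1/4)"
proof -
  show "h powr (2/3) > 0" using h by simp
  have "(h powr (2/3)) ^ 3 = (h powr (2/3)) powr 3" using h by simp
  also have "\<dots> = h powr 2" unfolding powr_powr by simp
  finally show "(h powr (2/3)) ^ 3 = h\<^sup>2" using h by simp
  have "sqrt (h powr (2/3)) * h powr (2/3) = (h powr (2/3)) powr (1/2) * h powr (2/3)"
    by (simp add: powr_half_sqrt)
  also have "\<dots> = h powr 1" unfolding powr_powr by (simp flip: powr_add)
  finally show "sqrt (h powr (2/3)) * h powr (2/3) = h" using h by simp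
  show "h powr (-2/3) = 1 / h powr (2/3)" by (simp add: powr_minus_divide)
  show "h powr (1/6) = (h powr (2/3)) powr (1/4)" by (simp add: powr_powr)
qed

text \<open>The two claims of the theorem: \<open>X\<close> is the classically forbidden half-line, \<open>Y\<close> the interval on the
  oscillatory side of the turning point \<open>x0\<close>.\<close>

definition airy_estimate ::
    "(real \<Rightarrow> real) \<Rightarrow> (real \<Rightarrow> real) \<Rightarrow> real \<Rightarrow> real \<Rightarrow> real \<Rightarrow> real set \<Rightarrow> real set \<Rightarrow> real \<Rightarrow> bool" where
  "airy_estimate u xi h rho x0 X Y C \<longleftrightarrow>
     (\<exists>eps. \<forall>x\<in>X. u x = \<bar>deriv xi x\<bar> powr (-1/2) * Ai (h powr (-2/3) * xi x) * (1 + eps x) \<and>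
        \<bar>eps x\<bar> \<le> C * h * (1 + \<bar>xi x\<bar>) powr (- rho)) \<and>
     (\<forall>x\<in>Y. \<bar>u x - \<bar>deriv xi x\<bar> powr (-1/2) * Ai (h powr (-2/3) * xi x)\<bar>
        \<le> C * h powr (7/6) * (h powr (2/3) + \<bar>x - x0\<bar>) powr (-1/4))"

lemma airy_estimate_mono:
  assumes "airy_estimate u xi h rho x0 X Y C" "C \<le> D" "h > 0"
  shows "airy_estimate u xi h rho x0 X Y D"
proof -
  have "C * h * z powr a \<le> D * h * z powr a" "C * h powr b * z powr a \<le> D * h powr b * z powr a" for z a b
    using assms(2,3) by (auto intro!: mult_right_mono)
  then show ?thesis using assms(1) unfolding airy_estimate_def by (meson order_trans)
qed

text \<open>Only \<bar>xi'\<bar> enters, so its change of sign is harmless; the differentiability of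
  \<open>xi\<close> allows \<open>deriv\<close> of the reflected function to be evaluated.\<close>

lemma airy_estimate_reflect:
  assumes est: "airy_estimate u xi h rho x0 X Y C"
    and xi: "\<And>x. x \<in> X \<union> Y \<Longrightarrow> (xi has_real_derivative deriv xi x) (at x)"
  shows "airy_estimate (\<lambda>x. u (- x)) (\<lambda>x. xi (- x)) h rho (- x0) (uminus ` X) (uminus ` Y) C"
proof -
  have d: "\<bar>deriv (\<lambda>x. xi (- x)) (- x)\<bar> = \<bar>deriv xi x\<bar>" if "x \<in> X \<union> Y" for x
  proof -
    have "((\<lambda>x. xi (- x)) has_real_derivative - deriv xi x) (at (- x))"
      using xi[OF that] by (simp add: DERIV_mirror)
    from DERIV_imp_deriv[OF this] show ?thesis by simp
  qed
  obtain eps where "\<forall>x\<in>X. u x = \<bar>deriv xi x\<bar> powr (-1/2) * Ai (h powr (-2/3) * xi x) * (1 + eps x) \<and>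
        \<bar>eps x\<bar> \<le> C * h * (1 + \<bar>xi x\<bar>) powr (- rho)"
    using est unfolding airy_estimate_def by blast
  then show ?thesis
    using est unfolding airy_estimate_def ball_simps(9)
    by (intro conjI exI[of _ "\<lambda>x. eps (- x)"]) (simp_all add: d abs_minus_commute)
qed

text \<open>The half of Assumption A that concerns the right end, together with a quantitative form
  of the lower limit in Assumption B. The integral still starts at 0 rather than at the turning
  point.\<close>

locale decaying_turning_point = turning_point +
  fixes rho0 M R \<eta> :: real
  assumes rho0: "rho0 > 1"
    and bound: "x \<ge> R \<Longrightarrow> ((q1 x)\<^sup>2 / \<bar>q x\<bar> ^ 3 + \<bar>q2 x\<bar> / (q x)\<^sup>2) *
      \<bar>LBINT y=0..x. sqrt \<bar>q y\<bar>\<bar> powr rho0 \<le> M"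
    and \<eta>: "\<eta> > 0" "x \<ge> R \<Longrightarrow> q x \<ge> \<eta>"
begin

text \<open>With \<open>\<psi> = P\<^bsup>1/4\<^esup>\<close> one has \<open>rem = \<psi>'' \<psi>\<^sup>3\<close>.\<close>

definition "rem x = deriv (deriv P) x / 4 - 3/16 * (deriv P x)\<^sup>2 / P x"
definition "rho = 3/2 * min (rho0 - 1) 1"
text \<open>Decay exponent of \<open>rem\<close> in terms of \<open>xi\<close>; the extra 1/2 is
  spent when the bound is integrated against xi^(-1/2).\<close>

definition "nu = rho + 1/2"

lemma rho_nu: "rho > 0" "nu > 0" "nu \<le> 2" "nu \<le> 3/2 * rho0 - 1" "rho \<le> 3/2"
proof -
  have m: "min (rho0 - 1) 1 > 0" "min (rho0 - 1) 1 \<le> 1" "min (rho0 - 1) 1 \<le> rho0 - 1" using rho0 by auto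
  show "rho > 0" "nu > 0" "nu \<le> 2" "nu \<le> 3/2 * rho0 - 1" "rho \<le> 3/2"
    unfolding nu_def rho_def using m by (simp_all add: field_simps del: min_less_iff_conj min.bounded_iff)
qed

section \<open>The residual potential and its decay at infinity\<close>

lemmas P_derivs = C2_at_deriv[OF P_C2]

lemma P_deriv_eq: assumes x: "x > xp"
  shows "deriv P x = P x powr (-1/2) / q x - P x * q1 x / q x"
proof -
  have xm: "x > xm" using x r by linarith
  have q: "q x > 0" using q_pos x by simp
  let ?D = "(P x powr (-1/2) * q x - xi x * q1 x) / (q x * q x)"
  have "((\<lambda>x. xi x / q x) has_real_derivative ?D) (at x)"
    using q by (intro DERIV_divide xi_deriv[OF xm] dq) simp
  then have "(P has_real_derivative ?D) (at x)"
    by (rule has_field_derivative_transform_within_open[of _ _ _ "{xp<..}"]) (use x in \<open>auto simp: P_def\<close>)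
  then have "deriv P x = ?D" by (rule DERIV_imp_deriv)
  then show ?thesis using q by (simp add: xi_P[OF xm] diff_divide_distrib)
qed

text \<open>A form adapted to infinity, where each term can be estimated alone. Its terms are
  singular at \<open>xp\<close>, and so \<open>rem\<close> itself is defined through
  \<open>P\<close>.\<close>

lemma rem_eq: assumes x: "x > xp"
  shows "rem x = - (5 / (16 * (xi x)\<^sup>2)) + 5/16 * (P x * (q1 x)\<^sup>2 / (q x)\<^sup>2) - P x * q2 x / (4 * q x)"
proof -
  have xm: "x > xm" using x r by linarith
  have q: "q x > 0" using q_pos x by simp
  have P: "P x > 0" by (rule P_pos[OF xm])
  define s where "s = sqrt (P x)"
  have s: "s > 0" "P x = s\<^sup>2" using P by (auto simp: s_def)
  have Ps: "P x powr (-1/2) = 1 / s" "P x powr (-1/2 - 1) = 1 / s ^ 3"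
  proof -
    show "P x powr (-1/2) = 1 / s" using P by (simp add: s_def powr_minus powr_half_sqrt inverse_eq_divide)
    then have "P x powr (-1/2 - 1) = 1 / s / s\<^sup>2" unfolding powr_diff using s by simp
    then show "P x powr (-1/2 - 1) = 1 / s ^ 3" by (simp add: power3_eq_cube power2_eq_square)
  qed
  have dP: "(P has_real_derivative deriv P x) (at x)" by (rule P_derivs(1)[OF xm])
  have d1: "((\<lambda>x. P x powr (-1/2)) has_real_derivative deriv P x * (-1/2 * P x powr (-1/2 - 1))) (at x)"
    using DERIV_fun_powr[OF dP P, of "-1/2"] by (simp add: mult_ac)
  let ?D = "((deriv P x * (-1/2 * P x powr (-1/2 - 1))) * q x - P x powr (-1/2) * q1 x) / (q x * q x)
     - ((deriv P x * q1 x + q2 x * P x) * q x - P x * q1 x * q1 x) / (q x * q x)"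
  have "((\<lambda>x. P x powr (-1/2) / q x - P x * q1 x / q x) has_real_derivative ?D) (at x)"
    using q by (intro DERIV_diff DERIV_divide DERIV_mult dq dq1 dP d1) auto
  then have "(deriv P has_real_derivative ?D) (at x)"
    by (rule has_field_derivative_transform_within_open[of _ _ _ "{xp<..}"]) (use x in \<open>auto simp: P_deriv_eq\<close>)
  then have P2: "deriv (deriv P) x = ?D" by (rule DERIV_imp_deriv)
  \<comment> \<open>With s = sqrt P one has P' = s (u - w). Every other term except the one with
    \<open>q2\<close> becomes quadratic in u and w, and the mixed products cancel.\<close>
  define u where "u = 1 / (s\<^sup>2 * q x)"
  define w where "w = s * q1 x / q x"
  have P1: "deriv P x = s * (u - w)"
    unfolding P_deriv_eq[OF x] Ps(1) unfolding s(2) u_def w_def using s(1) q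
    by (simp add: right_diff_distrib power2_eq_square)
  have split: "(A * b - B) / (b * b) - ((C + E) * b - F) / (b * b) = A / b - B / (b * b) - C / b - E / b + F / (b * b)"
    if "b \<noteq> 0" for A B C E F b :: real using that by (simp add: field_simps)
  have t1: "deriv P x * (-1/2 * P x powr (-1/2 - 1)) / q x = - 1/2 * ((u - w) * u)"
    unfolding P1 Ps using s q by (simp add: u_def power3_eq_cube power2_eq_square)
  have t2: "P x powr (-1/2) * q1 x / (q x * q x) = u * w"
    unfolding Ps using s q by (simp add: u_def w_def power2_eq_square)
  have t3: "deriv P x * q1 x / q x = (u - w) * w"
    unfolding P1 by (simp add: w_def)
  have t4: "P x * q1 x * q1 x / (q x * q x) = w\<^sup>2"
    unfolding s(2) by (simp add: w_def power2_eq_square)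
  have P2': "deriv (deriv P) x = - 1/2 * ((u - w) * u) - u * w - (u - w) * w - q2 x * P x / q x + w\<^sup>2"
    unfolding P2 split[OF less_imp_neq[OF q, symmetric]] t1 t2 t3 t4 ..
  have t5: "(deriv P x)\<^sup>2 / P x = (u - w)\<^sup>2"
    unfolding P1 s(2) using s(1) by (simp add: power2_eq_square)
  have t6: "5 / (16 * (xi x)\<^sup>2) = 5/16 * u\<^sup>2"
    unfolding xi_P[OF xm] s(2) by (simp add: u_def power_divide)
  have t7: "P x * (q1 x)\<^sup>2 / (q x)\<^sup>2 = w\<^sup>2"
    unfolding s(2) by (simp add: w_def power2_eq_square)
  have "rem x = deriv (deriv P) x / 4 - 3/16 * ((deriv P x)\<^sup>2 / P x)" by (simp add: rem_def)
  also have "\<dots> = - (5/16 * u\<^sup>2) + 5/16 * w\<^sup>2 - P x * q2 x / (4 * q x)"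
    unfolding t5 P2' by (simp add: algebra_simps power2_eq_square add_divide_distrib diff_divide_distrib)
  finally show ?thesis unfolding t6 t7 .
qed

lemma rem_cont: "continuous_on {xm<..} rem"
proof -
  have "isCont (deriv P) x" "isCont P x" if "x > xm" for x
    using DERIV_isCont P_derivs(1,2)[OF that] by blast+
  moreover have "P x \<noteq> 0" if "x > xm" for x using P_pos[OF that] by simp
  ultimately show ?thesis
    unfolding rem_def[abs_def] using P_derivs(3)
    by (intro continuous_at_imp_continuous_on ballI continuous_intros) auto
qed

lemma xi_cont: "continuous_on {xm<..} xi"
  by (rule DERIV_imp_continuous_on, rule xi_deriv) auto

lemma xm_less_xp: "xm < xp" using r by linarith

lemma S_at_top: "filterlim S at_top at_top"
proof (rule filterlim_at_top_mono)
  define a where "a = max xp R"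
  show "filterlim (\<lambda>x. S a + (sqrt \<eta> * x - sqrt \<eta> * a)) at_top at_top"
  proof -
    have "filterlim (\<lambda>x. b + (c * x - c * d)) at_top at_top" if "c > 0" for b c d :: real
      using that by real_asymp
    then show ?thesis using \<eta>(1) by simp
  qed
  show "eventually (\<lambda>x. S a + (sqrt \<eta> * x - sqrt \<eta> * a) \<le> S x) at_top"
    using eventually_ge_at_top[of a]
  proof eventually_elim
    case (elim x)
    have "sqrt \<eta> * x - sqrt \<eta> * a \<le> S x - S a"
    proof (rule DERIV_le_imp_diff_le[OF elim _ S_deriv])
      show "((*) (sqrt \<eta>) has_real_derivative sqrt \<eta>) (at y)" for y
        by (auto intro!: derivative_eq_intros)
      show "sqrt \<eta> \<le> sqrt \<bar>q y\<bar>" if "a \<le> y" for y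
        using \<eta>(2)[of y] that by (auto simp: a_def)
    qed
    then show ?case by simp
  qed
qed

lemma xi_at_top: "filterlim xi at_top at_top"
proof -
  have "filterlim (\<lambda>s::real. (3/2 * s) powr (2/3)) at_top at_top" by real_asymp
  then have "filterlim (\<lambda>x. (3/2 * S x) powr (2/3)) at_top at_top"
    by (rule filterlim_compose[OF _ S_at_top])
  moreover have "eventually (\<lambda>x. (3/2 * S x) powr (2/3) = xi x) at_top"
    using eventually_ge_at_top[of xp] by eventually_elim (simp add: xi_def)
  ultimately show ?thesis using filterlim_cong[OF refl refl] by fast
qed

lemma integral_from_0_eq: "(LBINT y=0..ereal x. sqrt \<bar>q y\<bar>) = (LBINT y=0..ereal xp. sqrt \<bar>q y\<bar>) + S x"
proof -
  have "((\<lambda>x. (LBINT y=ereal 0..ereal x. sqrt \<bar>q y\<bar>) - S x) has_real_derivative sqrt \<bar>q x\<bar> - sqrt \<bar>q x\<bar>) (at x)" for x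
    by (intro DERIV_diff S_deriv LBINT_deriv continuous_intros q_cont)
  then have "\<forall>x. ((\<lambda>x. (LBINT y=ereal 0..ereal x. sqrt \<bar>q y\<bar>) - S x) has_real_derivative 0) (at x)" by simp
  from DERIV_isconst_all[OF this, of x xp] show ?thesis by (simp add: S_xp zero_ereal_def)
qed

text \<open>The term xi^(-2) requires nu \<le> 2; the terms with q' and q'' are xi times the
  quantity in Assumption A and require nu \<le> 3/2 * rho0 - 1.\<close>

lemma rem_bound_at_top:
  "eventually (\<lambda>x. \<bar>rem x\<bar> \<le> (5/16 + M * 3 powr rho0) * xi x powr (- nu)) at_top"
proof -
  define I0 where "I0 = (LBINT y=0..ereal xp. sqrt \<bar>q y\<bar>)"
  show ?thesis
    using eventually_gt_at_top[of xp] eventually_ge_at_top[of R]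
      filterlim_at_top[THEN iffD1, OF S_at_top, rule_format, of "2 * \<bar>I0\<bar>"]
      filterlim_at_top[THEN iffD1, OF xi_at_top, rule_format, of 1]
  proof eventually_elim
    case (elim x)
    have q: "q x > 0" using q_pos elim by simp
    have xi: "xi x \<ge> 1" by fact
    have S: "S x = 2/3 * xi x powr (3/2)" using xi_S[of x] elim by simp
    have xm: "x > xm" using elim xm_less_xp by linarith
    define W where "W = (q1 x)\<^sup>2 / \<bar>q x\<bar> ^ 3 + \<bar>q2 x\<bar> / (q x)\<^sup>2"
    have W0: "W \<ge> 0" by (simp add: W_def)
    \<comment> \<open>Moving the lower limit from 0 to \<open>xp\<close> adds the constant
      \<open>I0\<close>, harmless once S x \<ge> 2 * \<bar>I0\<bar>. As S x / 2 is a third of xi x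
      powr (3/2), the factor 3 powr rho0 arises.\<close>
    have "S x / 2 \<le> \<bar>I0 + S x\<bar>" "0 \<le> S x / 2" using elim by linarith+
    then have "(S x / 2) powr rho0 \<le> \<bar>I0 + S x\<bar> powr rho0"
      using rho0 by (intro powr_mono2) auto
    then have "W * (S x / 2) powr rho0 \<le> W * \<bar>I0 + S x\<bar> powr rho0" using W0 by (rule mult_left_mono)
    also have "\<dots> = W * \<bar>LBINT y=0..ereal x. sqrt \<bar>q y\<bar>\<bar> powr rho0"
      by (simp only: I0_def integral_from_0_eq[of x])
    also have "\<dots> \<le> M" unfolding W_def by (rule bound[OF elim(2)])
    finally have WM: "W * (S x / 2) powr rho0 \<le> M" .
    have S2: "S x / 2 = xi x powr (3/2) / 3" by (simp add: S)
    have "(S x / 2) powr rho0 = xi x powr (3/2 * rho0) / 3 powr rho0"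
      unfolding S2 by (simp only: powr_divide powr_powr)
    then have WM': "W * xi x powr (3/2 * rho0) \<le> M * 3 powr rho0"
      using WM by (simp add: pos_divide_le_eq)
    have Pq: "P x = xi x / q x" using elim by (simp add: P_def)
    have "rem x = - (5 / (16 * (xi x)\<^sup>2)) + (5/16 * (xi x * (q1 x)\<^sup>2 / q x ^ 3) - xi x * q2 x / (4 * (q x)\<^sup>2))"
      unfolding rem_eq[OF elim(1)] Pq using q by (simp add: power2_eq_square power3_eq_cube)
    also have "\<bar>\<dots>\<bar> \<le> 5/16 * (1 / (xi x)\<^sup>2) + xi x * W"
    proof -
      have a: "0 \<le> xi x * (q1 x)\<^sup>2 / q x ^ 3" using xi q by simp
      have b: "\<bar>xi x * q2 x / (4 * (q x)\<^sup>2)\<bar> = 1/4 * (xi x * (\<bar>q2 x\<bar> / (q x)\<^sup>2))" using xi by (simp add: abs_mult)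
      have c: "0 \<le> xi x * (\<bar>q2 x\<bar> / (q x)\<^sup>2)" using xi by simp
      have d: "xi x * W = xi x * (q1 x)\<^sup>2 / q x ^ 3 + xi x * (\<bar>q2 x\<bar> / (q x)\<^sup>2)"
        using q by (simp add: W_def algebra_simps)
      have e: "\<bar>- (5 / (16 * (xi x)\<^sup>2))\<bar> = 5/16 * (1 / (xi x)\<^sup>2)" by simp
      have gen: "\<bar>z + (5/16 * A - B)\<bar> \<le> z' + W'" if "\<bar>z\<bar> = z'" "0 \<le> A" "\<bar>B\<bar> = 1/4 * C" "0 \<le> C" "W' = A + C"
        for z z' A B C W' :: real using that by (simp add: abs_if split: if_splits)
      show ?thesis by (rule gen[OF e a b c d])
    qed
    also have "\<dots> \<le> 5/16 * xi x powr (- nu) + M * 3 powr rho0 * xi x powr (- nu)"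
    proof (rule add_mono)
      have "1 / (xi x)\<^sup>2 = xi x powr (- 2)" using xi by (simp add: powr_minus inverse_eq_divide)
      also have "\<dots> \<le> xi x powr (- nu)" using xi rho_nu by (intro powr_mono) auto
      finally show "5/16 * (1 / (xi x)\<^sup>2) \<le> 5/16 * xi x powr (- nu)" by simp
      have "xi x * W = xi x powr (1 - 3/2 * rho0) * (W * xi x powr (3/2 * rho0))"
        using xi by (simp add: powr_diff)
      also have "\<dots> \<le> xi x powr (- nu) * (M * 3 powr rho0)"
      proof (rule mult_mono)
        show "xi x powr (1 - 3/2 * rho0) \<le> xi x powr (- nu)"
          using xi rho_nu by (intro powr_mono) auto
      qed (use WM' W0 in auto)
      finally show "xi x * W \<le> M * 3 powr rho0 * xi x powr (- nu)" by (simp add: mult_ac)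
    qed
    also have "\<dots> = (5/16 + M * 3 powr rho0) * xi x powr (- nu)" by (simp add: algebra_simps)
    finally show ?case .
  qed
qed

text \<open>Compactness joins the bound near infinity to the turning point, because
  \<open>rem\<close> is continuous across \<open>xp\<close>.\<close>

lemma rem_bound:
  obtains C where "C > 0" "\<And>x. x \<ge> xp \<Longrightarrow> \<bar>rem x\<bar> \<le> C * (1 + xi x) powr (- nu)"
proof -
  note nu = rho_nu(2)
  have xi0: "xi x \<ge> 0" if "x \<ge> xp" for x using that by (simp add: xi_def)
  obtain X where X: "\<And>x. x \<ge> X \<Longrightarrow> \<bar>rem x\<bar> \<le> (5/16 + M * 3 powr rho0) * xi x powr (- nu)"
    "\<And>x. x \<ge> X \<Longrightarrow> xi x \<ge> 1"
    using eventually_conj[OF rem_bound_at_top filterlim_at_top[THEN iffD1, OF xi_at_top, rule_format, of 1]]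
    unfolding eventually_at_top_linorder by blast
  define Y where "Y = max X xp"
  have "continuous_on {xp..Y} (\<lambda>x. \<bar>rem x\<bar> * (1 + xi x) powr nu)"
  proof (intro continuous_intros)
    show "continuous_on {xp..Y} rem" using rem_cont xm_less_xp by (rule_tac continuous_on_subset) auto
    show "continuous_on {xp..Y} xi" using xi_cont xm_less_xp by (rule_tac continuous_on_subset) auto
    show "\<forall>x\<in>{xp..Y}. 1 + xi x \<noteq> 0" using xi0 by (metis add_nonneg_eq_0_iff atLeastAtMost_iff zero_le_one zero_neq_one)
  qed
  then have "bounded ((\<lambda>x. \<bar>rem x\<bar> * (1 + xi x) powr nu) ` {xp..Y})"
    by (intro compact_imp_bounded compact_continuous_image) auto
  then obtain B where "\<forall>y\<in>(\<lambda>x. \<bar>rem x\<bar> * (1 + xi x) powr nu) ` {xp..Y}. norm y \<le> B"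
    unfolding bounded_iff by blast
  then have B: "\<bar>rem x\<bar> * (1 + xi x) powr nu \<le> B" if "xp \<le> x" "x \<le> Y" for x
    using that by (force simp: abs_mult)
  define D where "D = \<bar>5/16 + M * 3 powr rho0\<bar> * 2 powr nu"
  show thesis
  proof (rule that[of "\<bar>B\<bar> + D + 1"])
    show "\<bar>B\<bar> + D + 1 > 0" by (simp add: D_def add_nonneg_pos)
    fix x assume x: "x \<ge> xp"
    have "\<bar>rem x\<bar> * (1 + xi x) powr nu \<le> \<bar>B\<bar> + D + 1"
    proof (cases "x \<le> Y")
      case True
      then show ?thesis using B[OF x True] by (auto simp: D_def add_increasing2)
    next
      case False
      then have X': "x \<ge> X" by (simp add: Y_def)
      have xi1: "xi x \<ge> 1" by (rule X(2)[OF X'])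
      have "(1 + xi x) powr nu \<le> (2 * xi x) powr nu" using xi1 nu by (intro powr_mono2) auto
      also have "\<dots> = 2 powr nu * xi x powr nu" using xi1 by (simp add: powr_mult)
      finally have "\<bar>rem x\<bar> * (1 + xi x) powr nu \<le>
          (\<bar>5/16 + M * 3 powr rho0\<bar> * xi x powr (- nu)) * (2 powr nu * xi x powr nu)"
        using X(1)[OF X'] by (intro mult_mono) (auto intro: order_trans[OF _ mult_right_mono])
      also have "\<dots> = D" using xi1 by (simp add: D_def powr_minus field_simps)
      finally show ?thesis by simp
    qed
    then show "\<bar>rem x\<bar> \<le> (\<bar>B\<bar> + D + 1) * (1 + xi x) powr (- nu)"
      using xi0[OF x] by (simp add: powr_minus field_simps)
  qed
qed

section \<open>The Liouville transform of the Airy function\<close>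

definition "psi x = P x powr (1/4)"
definition "psi1 x = deriv P x / (4 * psi x ^ 3)"
definition "airy_approx h x = psi x * Ai (h powr (-2/3) * xi x)"

lemma airy_approx_eq: "h > 0 \<Longrightarrow> airy_approx h x = psi x * Ai (xi x / h powr (2/3))"
  unfolding airy_approx_def two_thirds_powr(4) by simp

lemma psi_pos: "xm < x \<Longrightarrow> psi x > 0"
  using P_pos[of x] by (simp add: psi_def)

lemma psi_power: assumes "xm < x" shows "psi x ^ 4 = P x" "P x powr (-1/2) = 1 / psi x ^ 2"
proof -
  have P: "P x > 0" by (rule P_pos[OF assms])
  have "psi x ^ 4 = psi x powr 4" using psi_pos[OF assms] by simp
  then show "psi x ^ 4 = P x" unfolding psi_def powr_powr using P by simp
  have "psi x ^ 2 = psi x powr 2" using psi_pos[OF assms] by simp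
  then show "P x powr (-1/2) = 1 / psi x ^ 2" unfolding psi_def powr_powr using P by (simp add: powr_minus_divide)
qed

lemma psi_deriv: assumes "xm < x" shows "(psi has_real_derivative psi1 x) (at x)"
proof -
  have P: "P x > 0" by (rule P_pos[OF assms])
  have "psi x ^ 3 = psi x powr 3" using psi_pos[OF assms] by simp
  then have "P x powr (1/4 - 1) = 1 / psi x ^ 3"
    unfolding psi_def powr_powr by (simp add: powr_minus_divide)
  then show ?thesis
    unfolding psi_def[abs_def] psi1_def
    using DERIV_fun_powr[OF P_derivs(1)[OF assms] P, of "1/4"] by (simp add: psi_def)
qed

lemma psi1_deriv: assumes x: "xm < x"
  shows "(psi1 has_real_derivative rem x / psi x ^ 3) (at x)"
proof -
  have p: "psi x > 0" by (rule psi_pos[OF x])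
  have "(psi1 has_real_derivative (deriv (deriv P) x * (4 * psi x ^ 3) - deriv P x * (4 * (3 * psi x ^ 2 * psi1 x)))
      / ((4 * psi x ^ 3) * (4 * psi x ^ 3))) (at x)"
    unfolding psi1_def[abs_def]
    using p by (intro DERIV_divide P_derivs(2)[OF x]) (auto intro!: derivative_eq_intros psi_deriv[OF x, unfolded psi1_def])
  moreover have "(D2 * (4 * s ^ 3) - D1 * (4 * (3 * s ^ 2 * (D1 / (4 * s ^ 3))))) / ((4 * s ^ 3) * (4 * s ^ 3))
      = (D2 / 4 - 3/16 * D1\<^sup>2 / s ^ 4) / s ^ 3" if "s > 0" for D1 D2 s :: real
    using that by (simp add: field_simps eval_nat_numeral)
  ultimately show ?thesis unfolding rem_def psi1_def psi_power(1)[OF x, symmetric] using p by simp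
qed

lemma xi_deriv_psi: "xm < x \<Longrightarrow> (xi has_real_derivative 1 / psi x ^ 2) (at x)"
  using xi_deriv[of x] psi_power[of x] by simp

lemma xi_psi: "xm < x \<Longrightarrow> xi x = psi x ^ 4 * q x"
  using xi_P[of x] psi_power[of x] by simp

lemma xi_xp: "xi xp = 0" by (simp add: xi_def S_xp)

lemma xi_nonneg: "x \<ge> xp \<Longrightarrow> xi x \<ge> 0" by (simp add: xi_def)

text \<open>The terms with Ai' cancel in the second derivative because xi' * psi^2 = 1, and xi =
  psi^4 * q together with \<delta>^3 = h^2 turns the Airy potential into q / h^2. What is left over
  is psi'' / psi.\<close>

lemma airy_approx_deriv:
  assumes h: "h > 0" and Ai: "linear_ode_sol (\<lambda>t. t) Ai Ai'" and x: "xm < x"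
  defines "\<delta> \<equiv> h powr (2/3)"
  shows "(airy_approx h has_real_derivative psi1 x * Ai (xi x / \<delta>) + Ai' (xi x / \<delta>) / (\<delta> * psi x)) (at x)"
    "((\<lambda>x. psi1 x * Ai (xi x / \<delta>) + Ai' (xi x / \<delta>) / (\<delta> * psi x)) has_real_derivative
      (q x / h\<^sup>2 + rem x / psi x ^ 4) * airy_approx h x) (at x)"
proof -
  note t = two_thirds_powr[OF h, folded \<delta>_def]
  have p: "psi x > 0" by (rule psi_pos[OF x])
  have dt: "((\<lambda>x. xi x / \<delta>) has_real_derivative 1 / (\<delta> * psi x ^ 2)) (at x)"
    using DERIV_cdivide[OF xi_deriv_psi[OF x], of \<delta>] by (simp add: mult.commute)
  have A0: "((\<lambda>x. Ai (xi x / \<delta>)) has_real_derivative Ai' (xi x / \<delta>) * (1 / (\<delta> * psi x ^ 2))) (at x)"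
    by (rule DERIV_chain2[OF linear_ode_solD(1)[OF Ai] dt])
  have A1: "((\<lambda>x. Ai' (xi x / \<delta>)) has_real_derivative (xi x / \<delta> * Ai (xi x / \<delta>)) * (1 / (\<delta> * psi x ^ 2))) (at x)"
    by (rule DERIV_chain2[OF linear_ode_solD(2)[OF Ai] dt])
  have app: "airy_approx h = (\<lambda>x. psi x * Ai (xi x / \<delta>))"
    unfolding \<delta>_def by (rule ext) (rule airy_approx_eq[OF h])
  have "((\<lambda>x. psi x * Ai (xi x / \<delta>)) has_real_derivative
      psi1 x * Ai (xi x / \<delta>) + Ai' (xi x / \<delta>) * (1 / (\<delta> * psi x ^ 2)) * psi x) (at x)"
    by (rule DERIV_mult[OF psi_deriv[OF x] A0])
  then show "(airy_approx h has_real_derivative psi1 x * Ai (xi x / \<delta>) + Ai' (xi x / \<delta>) / (\<delta> * psi x)) (at x)"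
    unfolding app using p by (simp add: power2_eq_square)
  have "((\<lambda>x. psi1 x * Ai (xi x / \<delta>) + Ai' (xi x / \<delta>) / (\<delta> * psi x)) has_real_derivative
     (rem x / psi x ^ 3 * Ai (xi x / \<delta>) + Ai' (xi x / \<delta>) * (1 / (\<delta> * psi x ^ 2)) * psi1 x) +
     ((xi x / \<delta> * Ai (xi x / \<delta>)) * (1 / (\<delta> * psi x ^ 2)) * (\<delta> * psi x) - Ai' (xi x / \<delta>) * (\<delta> * psi1 x)) / ((\<delta> * psi x) * (\<delta> * psi x))) (at x)"
    using p t(1) by (intro DERIV_add DERIV_mult DERIV_divide DERIV_cmult psi1_deriv[OF x] psi_deriv[OF x] A0 A1) auto
  moreover have "(rm / s ^ 3 * a + a' * (1 / (d * s ^ 2)) * s1) +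
     ((s ^ 4 * Q / d * a) * (1 / (d * s ^ 2)) * (d * s) - a' * (d * s1)) / ((d * s) * (d * s))
     = (Q / d ^ 3 + rm / s ^ 4) * (s * a)" if "s > 0" "d > 0" for rm s a a' d s1 Q :: real
    using that by (simp add: field_simps eval_nat_numeral)
  ultimately show "((\<lambda>x. psi1 x * Ai (xi x / \<delta>) + Ai' (xi x / \<delta>) / (\<delta> * psi x)) has_real_derivative
      (q x / h\<^sup>2 + rem x / psi x ^ 4) * airy_approx h x) (at x)"
    unfolding app t(2)[symmetric] xi_psi[OF x] using p t(1) by simp
qed

section \<open>Error bounds on the two sides of the turning point\<close>

lemma Q_cont: "continuous_on UNIV (\<lambda>x. q x / h\<^sup>2)"
  by (cases "h = 0") (auto intro!: continuous_intros q_cont)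

text \<open>The bound on the quotient is the forbidden-side estimate. Together with the Wronskian
  bound at \<open>xp\<close> it controls the Cauchy data from which the oscillatory side is
  estimated.\<close>

definition "close_to_airy K h u u' \<longleftrightarrow> linear_ode_sol (\<lambda>x. q x / h\<^sup>2) u u' \<and>
  (\<forall>x\<ge>xp. \<bar>u x / airy_approx h x - 1\<bar> \<le> K * h * (1 + xi x) powr (- rho)) \<and>
  \<bar>u' xp * airy_approx h xp - u xp * deriv (airy_approx h) xp\<bar> \<le> K * h powr (2/3)"

lemma recessive_near_airy:
  obtains h0 K where "h0 > 0" "h0 \<le> 1" "K > 0"
    "\<And>h. 0 < h \<Longrightarrow> h \<le> h0 \<Longrightarrow> \<exists>u u'. close_to_airy K h u u'"
proof -
  obtain Ai' c where Ai: "linear_ode_sol (\<lambda>t. t) Ai Ai'" and c: "c > 0"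
    and Ai_pos: "\<And>t. t \<ge> 0 \<Longrightarrow> Ai t > 0" and Ai'_le: "\<And>t. t \<ge> 0 \<Longrightarrow> Ai' t \<le> - c * sqrt (1 + t) * Ai t"
    using Ai_decay by metis
  obtain C where C: "C > 0" "\<And>x. x \<ge> xp \<Longrightarrow> \<bar>rem x\<bar> \<le> C * (1 + xi x) powr (- nu)"
    using rem_bound by blast
  \<comment> \<open>Solves 2 * c * rho * K = C * 4 powr nu, so that the decay of Ai^2 in the flux
    outweighs \<open>rem\<close>. The value of \<open>h0\<close> then gives E xp \<le> 1/2.\<close>
  define K where "K = C * 4 powr nu / (2 * c * rho)"
  have K: "K > 0" using C c rho_nu by (simp add: K_def)
  define h0 where "h0 = min 1 (1 / (2 * K))"
  \<comment> \<open>The two entries serve the bound 2 E on the quotient and the flux bound 2 D at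
    \<open>xp\<close>.\<close>
  define K2 where "K2 = max (2 * K) (2 * (K * rho * (Ai 0)\<^sup>2))"
  have K2: "2 * K \<le> K2" "2 * (K * rho * (Ai 0)\<^sup>2) \<le> K2" by (simp_all add: K2_def)
  have main: "\<exists>u u'. close_to_airy K2 h u u'" if h: "0 < h" "h \<le> h0" for h
  proof -
    define \<delta> where "\<delta> = h powr (2/3)"
    note t = two_thirds_powr[OF h(1), folded \<delta>_def]
    have h1: "h \<le> 1" and hK: "K * h \<le> 1/2" using h K by (auto simp: h0_def field_simps)
    have \<delta>1: "\<delta> \<le> 1" unfolding \<delta>_def using h(1) h1 by (intro powr_le1) auto
    define A' where "A' x = psi1 x * Ai (xi x / \<delta>) + Ai' (xi x / \<delta>) / (\<delta> * psi x)" for x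
    \<comment> \<open>Because y' = psi^(-2) and the approximation is psi * Ai, the flux of E is K *
      h * rho * Ai^2 * gg (y x), free of psi; here 2 * rho + 1 = 2 * nu.\<close>
    define y where "y x = \<delta> + xi x" for x
    define gg where "gg y = (1 + sqrt y) powr (- 2 * nu) * y powr (-1/2)" for y
    define dgg where "dgg y = - 2 * nu * (1 + sqrt y) powr (- 2 * nu - 1) * (inverse (sqrt y) / 2) * y powr (-1/2)
      + (-1/2) * y powr (-1/2 - 1) * (1 + sqrt y) powr (- 2 * nu)" for y
    define E where "E x = K * h * (1 + sqrt (y x)) powr (- 2 * rho)" for x
    define D where "D x = K * h * rho * (Ai (xi x / \<delta>))\<^sup>2 * gg (y x)" for x
    define D' where "D' x = K * h * rho * ((2 * Ai (xi x / \<delta>) * (Ai' (xi x / \<delta>) * (1 / (\<delta> * psi x ^ 2)))) * gg (y x)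
      + (Ai (xi x / \<delta>))\<^sup>2 * (dgg (y x) * (1 / psi x ^ 2)))" for x
    have sq: "1 + sqrt z > 0" if "z > 0" for z using that by (simp add: add_pos_pos)
    have dgg: "(gg has_real_derivative dgg z) (at z)" if "z > 0" for z
    proof -
      have "((\<lambda>z. 1 + sqrt z) has_real_derivative inverse (sqrt z) / 2) (at z)"
        using DERIV_add[OF DERIV_const DERIV_real_sqrt[OF that], of 1] by simp
      from DERIV_fun_powr[OF this sq[OF that], of "- 2 * nu"]
      have a: "((\<lambda>z. (1 + sqrt z) powr (- 2 * nu)) has_real_derivative
          - 2 * nu * (1 + sqrt z) powr (- 2 * nu - 1) * (inverse (sqrt z) / 2)) (at z)" by simp
      have b: "((\<lambda>z. z powr (-1/2)) has_real_derivative (-1/2) * z powr (-1/2 - 1)) (at z)"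
        by (rule has_real_derivative_powr[OF that])
      show ?thesis unfolding gg_def[abs_def] dgg_def by (rule DERIV_mult[OF a b])
    qed
    have xm: "xm < x" if "x \<ge> xp" for x using that xm_less_xp by simp
    have y: "y x > 0" "xi x / \<delta> \<ge> 0" if "x \<ge> xp" for x
      using t(1) xi_nonneg[OF that] by (auto simp: y_def)
    have dy: "(y has_real_derivative 1 / psi x ^ 2) (at x)" if "x \<ge> xp" for x
      unfolding y_def[abs_def] using DERIV_add[OF DERIV_const xi_deriv_psi[OF xm[OF that]]] by simp
    obtain u u' where u: "linear_ode_sol (\<lambda>x. q x / h\<^sup>2) u u'"
      "\<And>x. x \<ge> xp \<Longrightarrow> \<bar>u x / airy_approx h x - 1\<bar> \<le> 2 * E x"
      "\<And>x. x \<ge> xp \<Longrightarrow> \<bar>u' x * airy_approx h x - u x * A' x\<bar> \<le> 2 * D x"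
    proof (rule recessive_solution[where a = xp and A = "airy_approx h" and A' = A' and R = "\<lambda>x. rem x / psi x ^ 4"
          and D = D and D' = D' and E = E, OF Q_cont[of h]])
      fix x assume x: "x \<ge> xp"
      note dA = airy_approx_deriv[OF h(1) Ai xm[OF x], folded \<delta>_def]
      have p: "psi x > 0" by (rule psi_pos[OF xm[OF x]])
      define w where "w = Ai (xi x / \<delta>)"
      define w' where "w' = Ai' (xi x / \<delta>)"
      have w: "w > 0" unfolding w_def by (rule Ai_pos[OF y(2)[OF x]])
      have A: "airy_approx h x = psi x * w" by (simp add: airy_approx_eq[OF h(1)] \<delta>_def w_def)
      then show "0 < airy_approx h x" using w p by simp
      show "(airy_approx h has_real_derivative A' x) (at x)" unfolding A'_def by (rule dA(1))
      show "(A' has_real_derivative (q x / h\<^sup>2 + rem x / psi x ^ 4) * airy_approx h x) (at x)"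
        unfolding A'_def[abs_def] by (rule dA(2))
      have dt: "((\<lambda>x. xi x / \<delta>) has_real_derivative 1 / (\<delta> * psi x ^ 2)) (at x)"
        using DERIV_cdivide[OF xi_deriv_psi[OF xm[OF x]], of \<delta>] by (simp add: mult.commute)
      have A0: "((\<lambda>x. Ai (xi x / \<delta>)) has_real_derivative Ai' (xi x / \<delta>) * (1 / (\<delta> * psi x ^ 2))) (at x)"
        by (rule DERIV_chain2[OF linear_ode_solD(1)[OF Ai] dt])
      have A2: "((\<lambda>x. (Ai (xi x / \<delta>))\<^sup>2) has_real_derivative 2 * Ai (xi x / \<delta>) * (Ai' (xi x / \<delta>) * (1 / (\<delta> * psi x ^ 2)))) (at x)"
        using DERIV_mult[OF A0 A0] by (simp add: power2_eq_square mult_ac)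
      have G0: "((\<lambda>x. gg (y x)) has_real_derivative dgg (y x) * (1 / psi x ^ 2)) (at x)"
        by (rule DERIV_chain2[OF dgg[OF y(1)[OF x]] dy[OF x]])
      have "((\<lambda>x. K * h * rho * ((Ai (xi x / \<delta>))\<^sup>2 * gg (y x))) has_real_derivative D' x) (at x)"
        unfolding D'_def using DERIV_cmult[OF DERIV_mult[OF A2 G0], of "K * h * rho"] by (simp add: mult_ac add_ac)
      then show "(D has_real_derivative D' x) (at x)" unfolding D_def[abs_def] by (simp add: mult_ac)
      have gg0: "gg (y x) \<ge> 0" by (simp add: gg_def)
      show "0 \<le> D x" "0 \<le> E x" using K h rho_nu gg0 by (auto simp: D_def E_def)
      let ?D = "K * h * (- 2 * rho * (1 + sqrt (y x)) powr (- 2 * rho - 1) *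
          (inverse (sqrt (y x)) / 2 * (1 / psi x ^ 2)))"
      have "((\<lambda>x. 1 + sqrt (y x)) has_real_derivative inverse (sqrt (y x)) / 2 * (1 / psi x ^ 2)) (at x)"
        using DERIV_add[OF DERIV_const DERIV_chain2[OF DERIV_real_sqrt[OF y(1)[OF x]] dy[OF x]], of 1] by simp
      from DERIV_cmult[OF DERIV_fun_powr[OF this sq[OF y(1)[OF x]], of "- 2 * rho"], of "K * h"]
      have "(E has_real_derivative ?D) (at x)"
        unfolding E_def[abs_def] by simp
      moreover have "?D = - D x / (airy_approx h x)\<^sup>2"
      proof -
        have e1: "- 2 * rho - 1 = - 2 * nu" by (simp add: nu_def)
        have e2: "y x powr (-1/2) = inverse (sqrt (y x))" using y(1)[OF x] by (simp add: powr_minus powr_half_sqrt)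
        show ?thesis unfolding D_def w_def[symmetric] A gg_def e1 e2 using w p
          by (simp add: power_mult_distrib)
      qed
      ultimately show "(E has_real_derivative - D x / (airy_approx h x)\<^sup>2) (at x)" by simp
      show "D' x \<le> - \<bar>rem x / psi x ^ 4\<bar> * (airy_approx h x)\<^sup>2"
      proof -
        define z where "z = y x"
        define B where "B = (1 + sqrt z) powr (- 2 * nu)"
        have z: "z > 0" using y(1)[OF x] by (simp add: z_def)
        have xi0: "xi x \<ge> 0" by (rule xi_nonneg[OF x])
        have B0: "B \<ge> 0" by (simp add: B_def)
        \<comment> \<open>\<open>gg\<close> decreases, so the derivative falling on it has the
          favourable sign; the required negativity comes from Ai' alone.\<close>
        have dgg0: "dgg z \<le> 0"
        proof -
          have "dgg z = - (2 * nu * (1 + sqrt z) powr (- 2 * nu - 1) * (inverse (sqrt z) / 2) * z powr (-1/2)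
              + 1/2 * z powr (-1/2 - 1) * (1 + sqrt z) powr (- 2 * nu))"
            unfolding dgg_def by simp
          also have "\<dots> \<le> 0"
            unfolding neg_le_0_iff_le using rho_nu z by (intro add_nonneg_nonneg mult_nonneg_nonneg) auto
          finally show ?thesis .
        qed
        have sz: "sqrt (1 + xi x / \<delta>) = sqrt z / sqrt \<delta>"
          using t(1) by (simp add: z_def y_def field_simps flip: real_sqrt_divide)
        have ggz: "gg z = B / sqrt z"
          using z by (simp add: gg_def B_def powr_minus_divide powr_half_sqrt)
        have hd: "h = sqrt \<delta> * \<delta>" using t(3) by simp
        have "w' \<le> - c * (sqrt z / sqrt \<delta>) * w"
          using Ai'_le[OF y(2)[OF x]] by (simp only: sz w_def w'_def)
        then have "2 * w * (w' * (1 / (\<delta> * psi x ^ 2))) * gg z \<le>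
            2 * w * ((- c * (sqrt z / sqrt \<delta>) * w) * (1 / (\<delta> * psi x ^ 2))) * gg z"
          using w p t(1) z B0 unfolding ggz by (intro mult_right_mono mult_left_mono) auto
        also have "\<dots> = - 2 * c * w\<^sup>2 * B / (h * psi x ^ 2)"
          unfolding ggz hd using z t(1) by (simp add: power2_eq_square mult_ac)
        finally have s1: "2 * w * (w' * (1 / (\<delta> * psi x ^ 2))) * gg z \<le> - 2 * c * w\<^sup>2 * B / (h * psi x ^ 2)" .
        have s2: "w\<^sup>2 * (dgg z * (1 / psi x ^ 2)) \<le> 0"
          using dgg0 by (intro mult_nonneg_nonpos mult_nonpos_nonneg) auto
        have "D' x = K * h * rho * (2 * w * (w' * (1 / (\<delta> * psi x ^ 2))) * gg z + w\<^sup>2 * (dgg z * (1 / psi x ^ 2)))"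
          by (simp add: D'_def w_def w'_def z_def)
        also have "\<dots> \<le> K * h * rho * (- 2 * c * w\<^sup>2 * B / (h * psi x ^ 2))"
          using s1 s2 K h rho_nu by (intro mult_left_mono) auto
        also have "\<dots> = - (2 * c * rho * K) * B * (w\<^sup>2 / psi x ^ 2)" using h by simp
        also have "\<dots> = - (C * (4 powr nu * B)) * (w\<^sup>2 / psi x ^ 2)"
          using c rho_nu by (simp add: K_def)
        also have "\<dots> \<le> - \<bar>rem x\<bar> * (w\<^sup>2 / psi x ^ 2)"
        proof (rule mult_right_mono)
          \<comment> \<open>Since \<delta> \<le> 1, the shifted variable is at most 1 + xi x.
            Raising the factor 2 to the power 2 * nu yields 4 powr nu.\<close>
          have "1 + sqrt z \<le> 2 * sqrt (1 + xi x)"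
          proof -
            have "sqrt z \<le> sqrt (1 + xi x)" using \<delta>1 by (simp add: z_def y_def)
            moreover have "1 \<le> sqrt (1 + xi x)" using xi0 by simp
            ultimately show ?thesis by linarith
          qed
          then have "(2 * sqrt (1 + xi x)) powr (- 2 * nu) \<le> B"
            unfolding B_def using rho_nu sq[OF z] by (intro powr_mono2') auto
          moreover have "(2 * sqrt (1 + xi x)) powr (- 2 * nu) = (1 + xi x) powr (- nu) / 4 powr nu"
          proof -
            have "sqrt (1 + xi x) = (1 + xi x) powr (1/2)" using xi0 by (simp add: powr_half_sqrt)
            then have a: "sqrt (1 + xi x) powr (- 2 * nu) = (1 + xi x) powr (- nu)" by (simp add: powr_powr)
            have "(2::real) powr (- 2 * nu) = (2 powr 2) powr (- nu)" unfolding powr_powr by simp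
            then have b: "(2::real) powr (- 2 * nu) = 1 / 4 powr nu" by (simp add: powr_minus_divide)
            show ?thesis using xi0 by (simp only: powr_mult a b) simp
          qed
          ultimately have "(1 + xi x) powr (- nu) / 4 powr nu \<le> B" by (simp only:)
          then have "(1 + xi x) powr (- nu) \<le> 4 powr nu * B" by (simp add: pos_divide_le_eq mult.commute)
          then have "C * (1 + xi x) powr (- nu) \<le> C * (4 powr nu * B)" using C(1) by (intro mult_left_mono) auto
          then show "- (C * (4 powr nu * B)) \<le> - \<bar>rem x\<bar>" using C(2)[OF x] by linarith
        qed simp
        also have "\<dots> = - \<bar>rem x / psi x ^ 4\<bar> * (airy_approx h x)\<^sup>2"
          unfolding A using p by (simp add: abs_mult power_mult_distrib field_simps eval_nat_numeral)
        finally show ?thesis .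
      qed
    next
      have "E xp \<le> K * h * 1"
        unfolding E_def using K h rho_nu t(1) by (intro mult_left_mono powr_nonpos_le_one) (auto simp: y_def xi_xp)
      then show "E xp \<le> 1/2" using hK by simp
    qed blast
    have "2 * E x \<le> 2 * K * h * (1 + xi x) powr (- rho)" if x: "x \<ge> xp" for x
    proof -
      have xi0: "xi x \<ge> 0" by (rule xi_nonneg[OF x])
      \<comment> \<open>Removes \<delta> from the bound: (1 + sqrt y)^2 \<ge> 1 + y \<ge> 1 +
        xi.\<close>
      have "sqrt (1 + xi x) \<le> 1 + sqrt (y x)"
      proof (rule real_le_lsqrt)
        have "(1 + sqrt (y x))\<^sup>2 = 1 + 2 * sqrt (y x) + y x" using y(1)[OF x] by (simp add: power2_sum)
        then show "1 + xi x \<le> (1 + sqrt (y x))\<^sup>2" using t(1) y(1)[OF x] by (simp add: y_def)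
      qed (use y(1)[OF x] xi0 in auto)
      then have "(1 + sqrt (y x)) powr (- 2 * rho) \<le> sqrt (1 + xi x) powr (- 2 * rho)"
        using xi0 rho_nu by (intro powr_mono2') auto
      also have "\<dots> = (1 + xi x) powr (- rho)"
        using xi0 powr_powr[of "1 + xi x" "1/2" "- 2 * rho"] by (simp add: powr_half_sqrt)
      finally show ?thesis using K h by (simp add: E_def)
    qed
    moreover have "2 * K * h * (1 + xi x) powr (- rho) \<le> K2 * h * (1 + xi x) powr (- rho)" for x
      using h by (intro mult_right_mono K2) auto
    ultimately have r1: "\<forall>x\<ge>xp. \<bar>u x / airy_approx h x - 1\<bar> \<le> K2 * h * (1 + xi x) powr (- rho)"
      using u(2) by (meson order_trans)
    \<comment> \<open>At the turning point gg is at most \<delta> powr (-1/2), and h / sqrt \<delta>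
      = \<delta>.\<close>
    have r2: "2 * D xp \<le> K2 * \<delta>"
    proof -
      have "gg \<delta> \<le> 1 * \<delta> powr (-1/2)"
        unfolding gg_def using rho_nu t(1) by (intro mult_right_mono powr_nonpos_le_one) auto
      also have "\<dots> = 1 / sqrt \<delta>" using t(1) by (simp add: powr_minus_divide powr_half_sqrt)
      finally have "h * gg \<delta> \<le> h * (1 / sqrt \<delta>)" using h by (intro mult_left_mono) auto
      also have "h * (1 / sqrt \<delta>) = \<delta>" using t(1,3) by (simp add: field_simps)
      finally have "2 * (K * rho * (Ai 0)\<^sup>2) * (h * gg \<delta>) \<le> 2 * (K * rho * (Ai 0)\<^sup>2) * \<delta>"
        using K rho_nu by (intro mult_left_mono) auto
      also have "\<dots> \<le> K2 * \<delta>" using t(1) by (intro mult_right_mono K2) auto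
      finally show ?thesis by (simp add: D_def y_def xi_xp mult_ac)
    qed
    have "deriv (airy_approx h) xp = A' xp"
      unfolding A'_def \<delta>_def by (rule DERIV_imp_deriv[OF airy_approx_deriv(1)[OF h(1) Ai xm_less_xp]])
    then have "\<bar>u' xp * airy_approx h xp - u xp * deriv (airy_approx h) xp\<bar> \<le> K2 * \<delta>"
      using order_trans[OF u(3) r2] by simp
    then show ?thesis using u(1) r1 unfolding close_to_airy_def \<delta>_def by blast
  qed
  have "h0 > 0" "h0 \<le> 1" "K2 > 0" using K by (auto simp: h0_def K2_def)
  then show thesis using main that by blast
qed

text \<open>In the variable xi / \<delta> the difference u / psi - Ai has Cauchy data of order h at
  the turning point and forcing of order \<delta>^2. The exponent in the energy bound stays bounded
  as h tends to 0, so the error keeps order h times the weight of the Airy function.\<close>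

lemma oscillatory_near_airy:
  assumes x1: "xm < x1" "x1 < xp" and K: "K > 0"
  obtains C where "\<And>h u u' x. 0 < h \<Longrightarrow> h \<le> 1 \<Longrightarrow> close_to_airy K h u u' \<Longrightarrow> x \<in> {x1..xp} \<Longrightarrow>
      \<bar>u x - airy_approx h x\<bar> \<le> C * h powr (7/6) * (h powr (2/3) + \<bar>x - xp\<bar>) powr (-1/4)"
proof -
  obtain Ai' where Ai: "linear_ode_sol (\<lambda>t. t) Ai Ai'" and Ai0: "Ai 0 > 0"
    using Ai_decay by (metis order_refl)
  obtain CA where CA: "CA \<ge> 0" "\<And>t. t \<le> 0 \<Longrightarrow> \<bar>Ai t\<bar> \<le> CA * (1 + t\<^sup>2) powr (-1/8)"
    using Ai_oscillatory_bound by metis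
  have bdd: "\<exists>B>0. \<forall>x\<in>{x1..xp}. \<bar>f x\<bar> \<le> B" if f: "continuous_on {xm<..} f" for f :: "real \<Rightarrow> real"
  proof -
    have "bounded (f ` {x1..xp})"
      by (intro compact_imp_bounded compact_continuous_image continuous_on_subset[OF f]) (use x1 in auto)
    then show ?thesis unfolding bounded_pos by auto
  qed
  have "continuous_on {xm<..} psi" by (rule DERIV_imp_continuous_on, rule psi_deriv) simp
  then obtain \<Psi> where \<Psi>: "\<Psi> > 0" "\<And>x. x \<in> {x1..xp} \<Longrightarrow> \<bar>psi x\<bar> \<le> \<Psi>" using bdd by blast
  obtain C1 where C1: "C1 > 0" "\<And>x. x \<in> {x1..xp} \<Longrightarrow> \<bar>rem x\<bar> \<le> C1" using bdd[OF rem_cont] by blast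
  obtain X where X: "X > 0" "\<And>x. x \<in> {x1..xp} \<Longrightarrow> \<bar>xi x\<bar> \<le> X" using bdd[OF xi_cont] by blast
  \<comment> \<open>A lower bound for xi' on the interval, capped at 1 so that it can also multiply
    \<delta>.\<close>
  define m where "m = min 1 (1 / \<Psi>\<^sup>2)"
  have m: "m > 0" "m \<le> 1" using \<Psi> by (auto simp: m_def)
  define C2 where "C2 = 2 * exp (12 + 20 * (C1 * sqrt (1 + X))) * (K * Ai 0 + (K / Ai 0 + \<bar>Ai' 0\<bar> * K) + CA)"
  have C2: "C2 \<ge> 0" using K Ai0 CA by (simp add: C2_def)
  show thesis
  proof (rule that[of "\<Psi> * C2 * (2 * m powr (-1/4))"])
    fix h u u' x assume h: "0 < h" "h \<le> 1" and close: "close_to_airy K h u u'" and x: "x \<in> {x1..xp}"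
    have u: "linear_ode_sol (\<lambda>x. q x / h\<^sup>2) u u'" and u0: "\<bar>u xp / airy_approx h xp - 1\<bar> \<le> K * h"
      and z0: "\<bar>u' xp * airy_approx h xp - u xp * deriv (airy_approx h) xp\<bar> \<le> K * h powr (2/3)"
      using close unfolding close_to_airy_def by (auto simp: xi_xp dest: spec[of _ xp])
    define \<delta> where "\<delta> = h powr (2/3)"
    note t = two_thirds_powr[OF h(1), folded \<delta>_def]
    have \<delta>1: "\<delta> \<le> 1" unfolding \<delta>_def using h by (intro powr_le1) auto
    have xm: "xm < y" if "y \<in> {x1..xp}" for y using that x1 by auto
    define d where "d x = u x / psi x - Ai (xi x / \<delta>)" for x
    \<comment> \<open>The derivative of \<open>d\<close> with respect to xi / \<delta>, hence the
      factor \<theta> in the equations below.\<close>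
    define d' where "d' x = \<delta> * (u' x * psi x - u x * psi1 x) - Ai' (xi x / \<delta>)" for x
    define \<theta> where "\<theta> x = 1 / (\<delta> * psi x ^ 2)" for x
    define s where "s x = - (xi x / \<delta>)" for x
    define f where "f x = - \<delta>\<^sup>2 * rem x * (d x + Ai (xi x / \<delta>))" for x
    have dt: "((\<lambda>x. xi x / \<delta>) has_real_derivative \<theta> x) (at x)" if "xm < x" for x
      unfolding \<theta>_def using DERIV_cdivide[OF xi_deriv_psi[OF that], of \<delta>] by (simp add: mult.commute)
    have s0: "s y \<ge> 0" if y: "y \<in> {x1..xp}" for y
      using xi_neg[OF xm[OF y]] xi_xp y t(1) by (cases "y = xp") (auto simp: s_def divide_nonpos_pos)
    have sx: "(1 + (s x)\<^sup>2) powr (1/8) * \<bar>d x\<bar> \<le>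
        2 * exp (12 + 20 * ((\<delta>\<^sup>2 * C1) / h) * sqrt (1 + s x)) * (\<bar>d xp\<bar> + \<bar>d' xp\<bar> + h * CA)"
    proof (rule airy_energy_bound[where a = x1 and b = xp and \<theta> = \<theta> and f = f])
      fix y assume y: "y \<in> {x1..xp}"
      note xmy = xm[OF y]
      have p: "psi y > 0" by (rule psi_pos[OF xmy])
      note du = linear_ode_solD[OF u, of y]
      have dAi: "((\<lambda>x. Ai (xi x / \<delta>)) has_real_derivative Ai' (xi y / \<delta>) * \<theta> y) (at y)"
        by (rule DERIV_chain2[OF linear_ode_solD(1)[OF Ai] dt[OF xmy]])
      have dAi': "((\<lambda>x. Ai' (xi x / \<delta>)) has_real_derivative (xi y / \<delta> * Ai (xi y / \<delta>)) * \<theta> y) (at y)"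
        by (rule DERIV_chain2[OF linear_ode_solD(2)[OF Ai] dt[OF xmy]])
      show "(s has_real_derivative - \<theta> y) (at y)"
        unfolding s_def[abs_def] by (rule DERIV_minus[OF dt[OF xmy]])
      show "0 \<le> \<theta> y" using t(1) by (simp add: \<theta>_def)
      show "0 \<le> s y" by (rule s0[OF y])
      have "((\<lambda>x. u x / psi x - Ai (xi x / \<delta>)) has_real_derivative
          (u' y * psi y - u y * psi1 y) / (psi y * psi y) - Ai' (xi y / \<delta>) * \<theta> y) (at y)"
        using p by (intro DERIV_diff DERIV_divide du(1) psi_deriv[OF xmy] dAi) simp
      moreover have "(u' y * psi y - u y * psi1 y) / (psi y * psi y) - Ai' (xi y / \<delta>) * \<theta> y = \<theta> y * d' y"
        using p t(1) by (simp add: \<theta>_def d'_def power2_eq_square right_diff_distrib diff_divide_distrib)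
      ultimately show "(d has_real_derivative \<theta> y * d' y) (at y)" unfolding d_def[abs_def] by simp
      let ?D = "\<delta> * ((q y / h\<^sup>2 * u y * psi y + psi1 y * u' y) - (u' y * psi1 y + rem y / psi y ^ 3 * u y))
          - (xi y / \<delta> * Ai (xi y / \<delta>)) * \<theta> y"
      have "((\<lambda>x. \<delta> * (u' x * psi x - u x * psi1 x) - Ai' (xi x / \<delta>)) has_real_derivative ?D) (at y)"
        by (intro DERIV_diff DERIV_cmult DERIV_mult du psi_deriv[OF xmy] psi1_deriv[OF xmy] dAi')
      moreover have "?D = \<theta> y * (f y - s y * d y)"
      proof -
        have "D * ((Q / D ^ 3 * U * p + e) - (e + rm / p ^ 3 * U)) - (p ^ 4 * Q / D * A) * (1 / (D * p ^ 2))
          = 1 / (D * p ^ 2) * (- D\<^sup>2 * rm * (U / p - A + A) - - (p ^ 4 * Q / D) * (U / p - A))"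
          if "D > 0" "p > 0" for D Q U p e rm A :: real
          using that by (simp add: field_simps eval_nat_numeral)
        from this[OF t(1) p, of "q y" "u y" "u' y * psi1 y" "rem y" "Ai (xi y / \<delta>)"]
        show ?thesis
          unfolding f_def s_def d_def \<theta>_def t(2) xi_psi[OF xmy, symmetric] by (simp only: mult.commute[of "psi1 y"])
      qed
      ultimately show "(d' has_real_derivative \<theta> y * (f y - s y * d y)) (at y)" unfolding d'_def[abs_def] by simp
      have "\<bar>Ai (xi y / \<delta>)\<bar> \<le> CA * (1 + (s y)\<^sup>2) powr (-1/8)"
        using CA(2)[of "xi y / \<delta>"] s0[OF y] by (simp add: s_def)
      then have "\<bar>d y + Ai (xi y / \<delta>)\<bar> \<le> \<bar>d y\<bar> + CA * (1 + (s y)\<^sup>2) powr (-1/8)" by linarith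
      then have "(\<delta>\<^sup>2 * \<bar>rem y\<bar>) * \<bar>d y + Ai (xi y / \<delta>)\<bar> \<le> (\<delta>\<^sup>2 * C1) * (\<bar>d y\<bar> + CA * (1 + (s y)\<^sup>2) powr (-1/8))"
        using C1(2)[OF y] C1(1) by (intro mult_mono mult_left_mono) auto
      then show "\<bar>f y\<bar> \<le> (\<delta>\<^sup>2 * C1) * (\<bar>d y\<bar> + CA * (1 + (s y)\<^sup>2) powr (-1/8))"
        by (simp add: f_def abs_mult)
    qed (use x h CA C1 xi_xp in \<open>auto simp: s_def\<close>)
    \<comment> \<open>The growth exponent is uniform in h: \<delta>^2 / h = sqrt \<delta> and 1 + s
      = (\<delta> - xi) / \<delta>, so the product is C1 * sqrt (\<delta> - xi).\<close>
    have arg: "(\<delta>\<^sup>2 * C1) / h * sqrt (1 + s x) \<le> C1 * sqrt (1 + X)"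
    proof -
      have "1 + s x = (\<delta> - xi x) / \<delta>" using t(1) by (simp add: s_def field_simps)
      then have "\<delta>\<^sup>2 / h * sqrt (1 + s x) = sqrt (\<delta> - xi x)"
        using t(1) unfolding t(3)[symmetric] by (simp add: real_sqrt_divide power2_eq_square)
      also have "\<dots> \<le> sqrt (1 + X)" using \<delta>1 X(2)[OF x] by (intro real_sqrt_le_mono) linarith
      finally have "C1 * (\<delta>\<^sup>2 / h * sqrt (1 + s x)) \<le> C1 * sqrt (1 + X)" using C1 by (intro mult_left_mono) auto
      then show ?thesis by (simp add: mult_ac)
    qed
    have xpI: "xp \<in> {x1..xp}" using x1 by simp
    have pp: "psi xp > 0" by (rule psi_pos[OF xm[OF xpI]])
    have Axp: "airy_approx h xp = psi xp * Ai 0" using airy_approx_eq[OF h(1), of xp] by (simp add: xi_xp)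
    have dxp: "\<bar>d xp\<bar> \<le> h * (K * Ai 0)"
    proof -
      have "d xp = Ai 0 * (u xp / airy_approx h xp - 1)"
        unfolding Axp using Ai0 pp by (simp add: d_def xi_xp right_diff_distrib)
      then have "\<bar>d xp\<bar> = Ai 0 * \<bar>u xp / airy_approx h xp - 1\<bar>" using Ai0 by (simp add: abs_mult)
      also have "\<dots> \<le> Ai 0 * (K * h)" using u0 Ai0 by (intro mult_left_mono) auto
      finally show ?thesis by (simp add: mult_ac)
    qed
    have d'xp: "\<bar>d' xp\<bar> \<le> h * (K / Ai 0 + \<bar>Ai' 0\<bar> * K)"
    proof -
      define z where "z = u' xp * airy_approx h xp - u xp * (psi1 xp * Ai 0 + Ai' 0 / (\<delta> * psi xp))"
      have "deriv (airy_approx h) xp = psi1 xp * Ai 0 + Ai' 0 / (\<delta> * psi xp)"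
        using DERIV_imp_deriv[OF airy_approx_deriv(1)[OF h(1) Ai xm_less_xp]] by (simp add: \<delta>_def xi_xp)
      then have zb: "\<bar>z\<bar> \<le> K * \<delta>" using z0 by (simp add: z_def \<delta>_def)
      have "d' xp = \<delta> * z / Ai 0 + Ai' 0 * (u xp / airy_approx h xp - 1)"
        unfolding Axp d'_def z_def xi_xp using Ai0 pp t(1) by (simp add: field_simps)
      also have "\<bar>\<dots>\<bar> \<le> \<delta> * \<bar>z\<bar> / Ai 0 + \<bar>Ai' 0\<bar> * \<bar>u xp / airy_approx h xp - 1\<bar>"
        by (rule order_trans[OF abs_triangle_ineq]) (use Ai0 t(1) in \<open>simp add: abs_mult\<close>)
      also have "\<dots> \<le> \<delta> * (K * \<delta>) / Ai 0 + \<bar>Ai' 0\<bar> * (K * h)"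
        using zb u0 Ai0 t(1) by (intro add_mono divide_right_mono mult_left_mono) auto
      also have "\<delta> * (K * \<delta>) / Ai 0 \<le> h * K / Ai 0"
      proof (rule divide_right_mono)
        \<comment> \<open>The Wronskian contributes order \<delta>^2, which is at most h =
          \<delta>^(3/2).\<close>
        have "sqrt \<delta> \<le> 1" using \<delta>1 by simp
        then have "\<delta> * \<delta> \<le> sqrt \<delta> * \<delta>"
          using t(1) \<delta>1 by (intro mult_right_mono) (auto simp: real_le_rsqrt power2_eq_square mult_left_le)
        then have "\<delta> * \<delta> * K \<le> h * K" unfolding t(3) using K by (intro mult_right_mono) auto
        then show "\<delta> * (K * \<delta>) \<le> h * K" by (simp add: mult_ac)
      qed (use Ai0 in simp)
      finally show ?thesis by (simp add: algebra_simps)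
    qed
    have E1: "(1 + (s x)\<^sup>2) powr (1/8) * \<bar>d x\<bar> \<le> C2 * h"
    proof -
      have "(1 + (s x)\<^sup>2) powr (1/8) * \<bar>d x\<bar> \<le> 2 * exp (12 + 20 * (C1 * sqrt (1 + X))) *
          (h * (K * Ai 0) + h * (K / Ai 0 + \<bar>Ai' 0\<bar> * K) + h * CA)"
        by (rule order_trans[OF sx]) (use arg dxp d'xp h CA in \<open>intro mult_mono add_mono, auto simp: mult.assoc\<close>)
      also have "\<dots> = C2 * h" by (simp add: C2_def algebra_simps)
      finally show ?thesis .
    qed
    have s1: "1 + s x > 0" using s0[OF x] by simp
    have w: "(1 + (s x)\<^sup>2) powr (-1/8) \<le> 2 * (1 + s x) powr (-1/4)"
    proof -
      have le: "(1 + s x)\<^sup>2 / 2 \<le> 1 + (s x)\<^sup>2" using sum_squares_bound[of 1 "s x"] by (simp add: power2_sum)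
      have "(1 + (s x)\<^sup>2) powr (-1/8) \<le> ((1 + s x)\<^sup>2 / 2) powr (-1/8)"
        using le s1 by (intro powr_mono2') auto
      also have "\<dots> = ((1 + s x) powr 2) powr (-1/8) / 2 powr (-1/8)"
        using s1 by (simp add: powr_divide)
      also have "\<dots> = 2 powr (1/8) * (1 + s x) powr (-1/4)"
        unfolding powr_powr by (simp add: powr_minus field_simps)
      also have "\<dots> \<le> 2 powr 1 * (1 + s x) powr (-1/4)" by (intro mult_right_mono powr_mono) auto
      finally show ?thesis by simp
    qed
    have ximp: "m * (\<delta> + \<bar>x - xp\<bar>) \<le> \<delta> - xi x"
    proof -
      have "m * xp - m * x \<le> xi xp - xi x"
      proof (rule DERIV_le_imp_diff_le[where f = "\<lambda>x. m * x" and f' = "\<lambda>_. m" and g = xi])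
        show "x \<le> xp" using x by simp
        fix y assume "x \<le> y" "y \<le> xp"
        then have y: "y \<in> {x1..xp}" using x by simp
        show "((\<lambda>x. m * x) has_real_derivative m) (at y)" by (auto intro!: derivative_eq_intros)
        show "(xi has_real_derivative 1 / psi y ^ 2) (at y)" by (rule xi_deriv_psi[OF xm[OF y]])
        have p: "psi y > 0" by (rule psi_pos[OF xm[OF y]])
        then have "psi y ^ 2 \<le> \<Psi> ^ 2" using \<Psi>(2)[OF y] by (intro power_mono) auto
        then have "1 / \<Psi>\<^sup>2 \<le> 1 / psi y ^ 2" using p \<Psi> by (intro divide_left_mono) auto
        then show "m \<le> 1 / psi y ^ 2" by (simp add: m_def)
      qed
      moreover have "m * \<delta> \<le> 1 * \<delta>" using m t(1) by (intro mult_right_mono) auto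
      moreover have "m * (\<delta> + \<bar>x - xp\<bar>) = m * \<delta> + (m * xp - m * x)" using x by (simp add: algebra_simps)
      ultimately show ?thesis by (simp add: xi_xp)
    qed
    have pos: "\<delta> + \<bar>x - xp\<bar> > 0" using t(1) by simp
    have w2: "(1 + s x) powr (-1/4) \<le> h powr (1/6) * (m powr (-1/4) * (\<delta> + \<bar>x - xp\<bar>) powr (-1/4))"
    proof -
      have "m * (\<delta> + \<bar>x - xp\<bar>) / \<delta> \<le> 1 + s x"
      proof -
        have "m * (\<delta> + \<bar>x - xp\<bar>) / \<delta> \<le> (\<delta> - xi x) / \<delta>" using ximp t(1) by (intro divide_right_mono) auto
        also have "\<dots> = 1 + s x" using t(1) by (simp add: s_def diff_divide_distrib)
        finally show ?thesis .
      qed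
      then have "(1 + s x) powr (-1/4) \<le> (m * (\<delta> + \<bar>x - xp\<bar>) / \<delta>) powr (-1/4)"
        using m pos t(1) by (intro powr_mono2') auto
      also have "\<dots> = m powr (-1/4) * (\<delta> + \<bar>x - xp\<bar>) powr (-1/4) / \<delta> powr (-1/4)"
        by (simp only: powr_divide powr_mult)
      also have "\<dots> = h powr (1/6) * (m powr (-1/4) * (\<delta> + \<bar>x - xp\<bar>) powr (-1/4))"
        unfolding t(5) using t(1) by (simp add: powr_minus_divide)
      finally show ?thesis .
    qed
    have px: "psi x > 0" by (rule psi_pos[OF xm[OF x]])
    have dx: "\<bar>d x\<bar> \<le> C2 * h * (1 + (s x)\<^sup>2) powr (-1/8)"
    proof -
      have "(1 + (s x)\<^sup>2) powr (1/8) > 0" by (simp add: add_nonneg_eq_0_iff)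
      moreover have "(1 + (s x)\<^sup>2) powr (-1/8) = 1 / (1 + (s x)\<^sup>2) powr (1/8)"
        using powr_minus_divide[of "1 + (s x)\<^sup>2" "1/8"] by simp
      ultimately show ?thesis using E1 by (simp only:) (simp add: pos_le_divide_eq mult.commute)
    qed
    have "u x - airy_approx h x = psi x * d x"
      using px airy_approx_eq[OF h(1), of x] by (simp add: d_def \<delta>_def right_diff_distrib)
    then have "\<bar>u x - airy_approx h x\<bar> = psi x * \<bar>d x\<bar>" using px by (simp add: abs_mult)
    also have "\<dots> \<le> \<Psi> * (C2 * h * (2 * (h powr (1/6) * (m powr (-1/4) * (\<delta> + \<bar>x - xp\<bar>) powr (-1/4)))))"
    proof (rule mult_mono)
      show "\<bar>d x\<bar> \<le> C2 * h * (2 * (h powr (1/6) * (m powr (-1/4) * (\<delta> + \<bar>x - xp\<bar>) powr (-1/4))))"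
      proof (rule order_trans[OF dx], rule mult_left_mono)
        show "(1 + (s x)\<^sup>2) powr (-1/8) \<le> 2 * (h powr (1/6) * (m powr (-1/4) * (\<delta> + \<bar>x - xp\<bar>) powr (-1/4)))"
          using w w2 by linarith
      qed (use C2 h in auto)
    qed (use \<Psi>(1) \<Psi>(2)[OF x] in auto)
    also have "\<dots> = \<Psi> * C2 * (2 * m powr (-1/4)) * (h * h powr (1/6)) * (\<delta> + \<bar>x - xp\<bar>) powr (-1/4)"
      by (simp add: mult_ac)
    also have "h * h powr (1/6) = h powr (7/6)" using h powr_add[of h 1 "1/6"] by simp
    finally show "\<bar>u x - airy_approx h x\<bar> \<le> \<Psi> * C2 * (2 * m powr (-1/4)) * h powr (7/6) *
        (h powr (2/3) + \<bar>x - xp\<bar>) powr (-1/4)" by (simp add: \<delta>_def)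
  qed
qed

section \<open>Normalisation at infinity and identification of the recessive solution\<close>

definition "wkb h x = 1 / (2 * sqrt pi) * h powr (1/6) * q x powr (-1/4) * exp (- (1 / h) * S x)"

text \<open>The identity is exact: with psi = (xi / q)^(1/4) the powers of xi cancel, and
  \<delta>^(1/4) = h^(1/6) is the power of h in the prescribed normalisation.\<close>

lemma wkb_eq: assumes h: "h > 0" and x: "x > xp"
  shows "psi x * airy_wkb (xi x / h powr (2/3)) = wkb h x"
proof -
  note t = two_thirds_powr[OF h]
  have xm: "xm < x" using x xm_less_xp by simp
  have xi: "xi x > 0" and q: "q x > 0" using xi_pos q_pos x by auto
  have "(xi x / h powr (2/3)) powr (3/2) = xi x powr (3/2) / (h powr (2/3)) powr (3/2)"
    by (rule powr_divide)
  also have "(h powr (2/3)) powr (3/2) = h" unfolding powr_powr using h by simp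
  finally have e1: "- 2 * (xi x / h powr (2/3)) powr (3/2) / 3 = - (1 / h) * S x"
    using xi_S[of x] x by simp
  have "psi x * (xi x / h powr (2/3)) powr (-1/4) = (xi x / q x) powr (1/4) * (xi x powr (-1/4) / (h powr (2/3)) powr (-1/4))"
  proof -
    have Px: "P x = xi x / q x" using x by (simp add: P_def)
    show ?thesis unfolding psi_def Px powr_divide[of "xi x" "h powr (2/3)"] ..
  qed
  also have "\<dots> = h powr (1/6) * q x powr (-1/4)"
    unfolding t(5) powr_divide using xi q by (simp add: powr_minus_divide)
  finally show ?thesis unfolding airy_wkb_def wkb_def e1 by (simp add: mult_ac)
qed

lemma wkb_pos: "h > 0 \<Longrightarrow> x > xp \<Longrightarrow> wkb h x > 0"
  using q_pos[of x] by (simp add: wkb_def)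

lemma wkb_tendsto_0: assumes h: "h > 0" shows "(wkb h \<longlongrightarrow> 0) at_top"
proof (rule tendsto_sandwich[of "\<lambda>_. 0"])
  define c where "c = 1 / (2 * sqrt pi) * h powr (1/6) * \<eta> powr (-1/4)"
  show "eventually (\<lambda>x. 0 \<le> wkb h x) at_top"
    using eventually_gt_at_top[of xp] by eventually_elim (use wkb_pos[OF h] in \<open>auto intro: less_imp_le\<close>)
  show "eventually (\<lambda>x. wkb h x \<le> c * exp (- (1 / h) * S x)) at_top"
    using eventually_ge_at_top[of R]
  proof eventually_elim
    case (elim x)
    have "q x powr (-1/4) \<le> \<eta> powr (-1/4)" using \<eta>(1) \<eta>(2)[OF elim] by (intro powr_mono2') auto
    then show ?case unfolding wkb_def c_def by (intro mult_right_mono mult_left_mono) auto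
  qed
  have "((\<lambda>s. c * exp (- (1 / h) * s)) \<longlongrightarrow> 0) at_top" using h by real_asymp
  then show "((\<lambda>x. c * exp (- (1 / h) * S x)) \<longlongrightarrow> 0) at_top"
    by (rule filterlim_compose[OF _ S_at_top])
qed simp

lemma airy_approx_asymp: assumes h: "h > 0"
  shows "airy_approx h \<sim>[at_top] wkb h"
proof -
  obtain Ai' where Ai: "Ai \<sim>[at_top] airy_wkb" using Ai_spec by metis
  define \<delta> where "\<delta> = h powr (2/3)"
  have \<delta>: "\<delta> > 0" using h by (simp add: \<delta>_def)
  have "filterlim (\<lambda>x::real. x / \<delta>) at_top at_top" using \<delta> by real_asymp
  then have lim: "filterlim (\<lambda>x. xi x / \<delta>) at_top at_top" by (rule filterlim_compose[OF _ xi_at_top])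
  have "(\<lambda>x. psi x * Ai (xi x / \<delta>)) \<sim>[at_top] (\<lambda>x. psi x * airy_wkb (xi x / \<delta>))"
    by (intro asymp_equiv_mult asymp_equiv_refl asymp_equiv_compose'[OF Ai lim])
  moreover have "(\<lambda>x. psi x * airy_wkb (xi x / \<delta>)) \<sim>[at_top] wkb h"
    by (rule asymp_equiv_refl_ev)
      (use eventually_gt_at_top[of xp] in \<open>eventually_elim, simp add: wkb_eq[OF h] \<delta>_def\<close>)
  moreover have "airy_approx h = (\<lambda>x. psi x * Ai (xi x / \<delta>))"
    unfolding \<delta>_def by (rule ext) (rule airy_approx_eq[OF h])
  ultimately show ?thesis using asymp_equiv_trans by metis
qed

lemma near_airy_asymp_wkb:
  assumes h: "h > 0" and u: "\<And>x. x \<ge> xp \<Longrightarrow> \<bar>u x / airy_approx h x - 1\<bar> \<le> c * (1 + xi x) powr (- rho)"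
  shows "u \<sim>[at_top] wkb h"
proof (rule asymp_equiv_trans[OF _ airy_approx_asymp[OF h]], rule asymp_equiv_of_quotient_bound)
  show "eventually (\<lambda>x. airy_approx h x > 0) at_top"
    using eventually_ge_at_top[of xp]
  proof eventually_elim
    case (elim x)
    have "xm < x" "xi x / h powr (2/3) \<ge> 0" using elim xm_less_xp xi_nonneg[OF elim] by auto
    then show ?case using Ai_decay psi_pos[of x] unfolding airy_approx_eq[OF h] by (metis mult_pos_pos)
  qed
  show "eventually (\<lambda>x. \<bar>u x / airy_approx h x - 1\<bar> \<le> c * (1 + xi x) powr (- rho)) at_top"
    using eventually_ge_at_top[of xp] by eventually_elim (rule u)
  have "((\<lambda>y. c * (1 + y) powr (- rho)) \<longlongrightarrow> 0) at_top" using rho_nu(1) by real_asymp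
  then show "((\<lambda>x. c * (1 + xi x) powr (- rho)) \<longlongrightarrow> 0) at_top"
    by (rule filterlim_compose[OF _ xi_at_top])
qed

definition "recessive h = (THE u. (\<exists>u'. linear_ode_sol (\<lambda>x. q x / h\<^sup>2) u u') \<and> u \<sim>[at_top] wkb h)"

lemma wkb_eventually_pos: "h > 0 \<Longrightarrow> eventually (\<lambda>x. wkb h x > 0) at_top"
  using eventually_gt_at_top[of xp] by eventually_elim (rule wkb_pos)

lemma wkb_solution_unique:
  assumes "h > 0" "linear_ode_sol (\<lambda>x. q x / h\<^sup>2) u u'" "u \<sim>[at_top] wkb h"
    "linear_ode_sol (\<lambda>x. q x / h\<^sup>2) w w'" "w \<sim>[at_top] wkb h"
  shows "u = w"
proof (rule recessive_solution_unique[OF Q_cont _ assms(2,4,3,5) wkb_tendsto_0 wkb_eventually_pos])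
  show "q x / h\<^sup>2 \<ge> 0" if "x \<ge> R" for x using \<eta>(1) \<eta>(2)[OF that] by simp
qed (use assms(1) in auto)

lemma recessive_eqI:
  assumes "h > 0" "linear_ode_sol (\<lambda>x. q x / h\<^sup>2) u u'" "u \<sim>[at_top] wkb h"
  shows "recessive h = u"
  unfolding recessive_def by (rule the_equality) (use assms wkb_solution_unique in blast)+

lemma deriv_xi: assumes "xm < x" shows "\<bar>deriv xi x\<bar> powr (-1/2) = psi x"
proof -
  have "deriv xi x = P x powr (-1/2)" by (rule DERIV_imp_deriv[OF xi_deriv[OF assms]])
  then have "\<bar>deriv xi x\<bar> powr (-1/2) = (P x powr (-1/2)) powr (-1/2)" by simp
  also have "\<dots> = psi x" unfolding powr_powr psi_def by simp
  finally show ?thesis .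
qed

text \<open>\<open>h0\<close> comes from the forbidden side alone and is fixed before
  \<open>x1\<close>; only the constant depends on \<open>x1\<close>. Existence and asymptotics are
  exported as well, since the reflected case needs them.\<close>

lemma recessive_estimates:
  obtains h0 where "h0 > 0"
    "\<And>h. 0 < h \<Longrightarrow> h \<le> h0 \<Longrightarrow> (\<exists>u'. linear_ode_sol (\<lambda>x. q x / h\<^sup>2) (recessive h) u') \<and> recessive h \<sim>[at_top] wkb h"
    "\<And>x1. x1 \<in> {xm<..<xp} \<Longrightarrow> \<exists>C. \<forall>h. 0 < h \<and> h \<le> h0 \<longrightarrow>
      airy_estimate (recessive h) xi h rho xp {xp..} {x1..xp} C"
proof -
  have Ai_pos: "\<And>t. t \<ge> 0 \<Longrightarrow> Ai t > 0" using Ai_decay by metis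
  obtain h0 K where h0: "h0 > 0" "h0 \<le> 1" and K: "K > 0" and
    near: "\<And>h. 0 < h \<Longrightarrow> h \<le> h0 \<Longrightarrow> \<exists>u u'. close_to_airy K h u u'"
    using recessive_near_airy by metis
  have rec: "\<exists>u'. close_to_airy K h (recessive h) u' \<and> recessive h \<sim>[at_top] wkb h" if h: "0 < h" "h \<le> h0" for h
  proof -
    obtain u u' where u: "close_to_airy K h u u'" using near[OF h] by blast
    then have "u \<sim>[at_top] wkb h"
      unfolding close_to_airy_def by (intro near_airy_asymp_wkb[OF h(1), of _ "K * h"]) blast
    moreover from this have "recessive h = u"
      using u unfolding close_to_airy_def by (intro recessive_eqI[OF h(1)]) auto
    ultimately show ?thesis using u by blast
  qed
  show thesis
  proof (rule that[OF h0(1)])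
    show "(\<exists>u'. linear_ode_sol (\<lambda>x. q x / h\<^sup>2) (recessive h) u') \<and> recessive h \<sim>[at_top] wkb h"
      if "0 < h" "h \<le> h0" for h using rec[OF that] unfolding close_to_airy_def by blast
    fix x1 assume x1: "x1 \<in> {xm<..<xp}"
    obtain C where C: "\<And>h u u' x. 0 < h \<Longrightarrow> h \<le> 1 \<Longrightarrow> close_to_airy K h u u' \<Longrightarrow> x \<in> {x1..xp} \<Longrightarrow>
      \<bar>u x - airy_approx h x\<bar> \<le> C * h powr (7/6) * (h powr (2/3) + \<bar>x - xp\<bar>) powr (-1/4)"
      using oscillatory_near_airy[OF _ _ K, of x1] x1 by auto
    define D where "D = max K C"
    show "\<exists>C. \<forall>h. 0 < h \<and> h \<le> h0 \<longrightarrow> airy_estimate (recessive h) xi h rho xp {xp..} {x1..xp} C"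
    proof (intro exI[of _ D] allI impI, unfold airy_estimate_def, intro conjI ballI)
      fix h assume h': "0 < h \<and> h \<le> h0"
      then have h: "0 < h" "h \<le> h0" "h \<le> 1" using h0 by auto
      obtain u' where u: "close_to_airy K h (recessive h) u'" using rec[OF h(1,2)] by blast
      have A: "\<bar>deriv xi x\<bar> powr (-1/2) * Ai (h powr (-2/3) * xi x) = airy_approx h x" if "xm < x" for x
        unfolding deriv_xi[OF that] airy_approx_def ..
      have "recessive h x = \<bar>deriv xi x\<bar> powr (-1/2) * Ai (h powr (-2/3) * xi x) * (1 + (recessive h x / airy_approx h x - 1)) \<and>
         \<bar>recessive h x / airy_approx h x - 1\<bar> \<le> D * h * (1 + \<bar>xi x\<bar>) powr (- rho)" if x: "x \<ge> xp" for x
      proof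
        have xm: "xm < x" using x xm_less_xp by simp
        have "airy_approx h x \<noteq> 0"
          using psi_pos[OF xm] Ai_pos[of "xi x / h powr (2/3)"] xi_nonneg[OF x] unfolding airy_approx_eq[OF h(1)] by force
        then show "recessive h x = \<bar>deriv xi x\<bar> powr (-1/2) * Ai (h powr (-2/3) * xi x) * (1 + (recessive h x / airy_approx h x - 1))"
          unfolding A[OF xm] by simp
        have "K * h * (1 + xi x) powr (- rho) \<le> D * h * (1 + xi x) powr (- rho)"
          using h by (intro mult_right_mono) (auto simp: D_def)
        then show "\<bar>recessive h x / airy_approx h x - 1\<bar> \<le> D * h * (1 + \<bar>xi x\<bar>) powr (- rho)"
          using u x xi_nonneg[OF x] unfolding close_to_airy_def by force
      qed
      then show "\<exists>eps. \<forall>x\<in>{xp..}. recessive h x = \<bar>deriv xi x\<bar> powr (-1/2) * Ai (h powr (-2/3) * xi x) * (1 + eps x) \<and>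
         \<bar>eps x\<bar> \<le> D * h * (1 + \<bar>xi x\<bar>) powr (- rho)"
        by (intro exI[of _ "\<lambda>x. recessive h x / airy_approx h x - 1"]) simp
      fix x assume x: "x \<in> {x1..xp}"
      then have xm: "xm < x" using x1 by simp
      from C[OF h(1,3) u x]
      have "\<bar>recessive h x - airy_approx h x\<bar> \<le> C * h powr (7/6) * (h powr (2/3) + \<bar>x - xp\<bar>) powr (-1/4)" .
      also have "\<dots> \<le> D * h powr (7/6) * (h powr (2/3) + \<bar>x - xp\<bar>) powr (-1/4)"
        by (intro mult_right_mono) (auto simp: D_def)
      finally show "\<bar>recessive h x - \<bar>deriv xi x\<bar> powr (-1/2) * Ai (h powr (-2/3) * xi x)\<bar>
         \<le> D * h powr (7/6) * (h powr (2/3) + \<bar>x - xp\<bar>) powr (-1/4)" unfolding A[OF xm] .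
    qed
  qed
qed

end

section \<open>The two recessive solutions\<close>

lemma schroedinger_sol_iff:
  assumes "continuous_on UNIV v"
  shows "schroedinger_sol v lam h u \<longleftrightarrow> (\<exists>u'. linear_ode_sol (\<lambda>x. (v x - lam) / h\<^sup>2) u u')"
proof -
  have c: "continuous_on UNIV (\<lambda>x. (v x - lam) / h\<^sup>2)"
    by (cases "h = 0") (auto intro!: continuous_intros assms)
  have "- d + q * u / h\<^sup>2 = 0 \<longleftrightarrow> d = q / h\<^sup>2 * u" for d q u :: real by auto
  then show ?thesis unfolding schroedinger_sol_def C_2_on_UNIV_linear_ode_iff[OF c, symmetric] by simp
qed

section \<open>From the assumptions on v to the two turning points\<close>

lemma assumption_A_D:
  assumes "assumption_A v lam rho0"
  shows "(v has_real_derivative deriv v x) (at x)" "(deriv v has_real_derivative deriv (deriv v) x) (at x)"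
    "continuous_on UNIV (deriv (deriv v))" "continuous_on UNIV v" "rho0 > 1"
    "\<exists>M R. \<forall>x. \<bar>x\<bar> \<ge> R \<longrightarrow> ((deriv v x)\<^sup>2 / \<bar>v x - lam\<bar> ^ 3 + \<bar>deriv (deriv v) x\<bar> / (v x - lam)\<^sup>2)
      * \<bar>LBINT y=0..x. sqrt \<bar>v y - lam\<bar>\<bar> powr rho0 \<le> M"
proof -
  have C: "C_k_on 2 v UNIV" and rho0: "rho0 > 1" using assms by (auto simp: assumption_A_def)
  have "\<forall>j<2. \<forall>x. (deriv ^^ j) v differentiable (at x)" using C by (simp add: C_k_on_def)
  from this[rule_format, of 0] this[rule_format, of 1]
  show d: "(v has_real_derivative deriv v x) (at x)" "(deriv v has_real_derivative deriv (deriv v) x) (at x)" for x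
    by (simp_all add: DERIV_deriv_iff_real_differentiable)
  have "\<forall>j\<le>2. continuous_on UNIV ((deriv ^^ j) v)" using C by (simp add: C_k_on_def)
  from this[rule_format, of 0] this[rule_format, of 2]
  show "continuous_on UNIV (deriv (deriv v))" "continuous_on UNIV v" by (simp_all add: eval_nat_numeral)
  show "rho0 > 1" by fact
  have "deriv (\<lambda>x. v x - lam) = deriv v"
    by (rule ext) (rule DERIV_imp_deriv, auto intro!: derivative_eq_intros d)
  then show "\<exists>M R. \<forall>x. \<bar>x\<bar> \<ge> R \<longrightarrow> ((deriv v x)\<^sup>2 / \<bar>v x - lam\<bar> ^ 3 + \<bar>deriv (deriv v) x\<bar> / (v x - lam)\<^sup>2)
      * \<bar>LBINT y=0..x. sqrt \<bar>v y - lam\<bar>\<bar> powr rho0 \<le> M"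
    using assms unfolding assumption_A_def Let_def by (auto dest!: abs_le_D1)
qed

lemma assumption_B_D:
  assumes "assumption_B v lam xm xp"
  shows "xm < xp" "v xm = lam" "v xp = lam" "\<And>x. xm < x \<Longrightarrow> x < xp \<Longrightarrow> v x < lam"
    "\<And>x. x > xp \<Longrightarrow> v x > lam" "\<And>x. x < xm \<Longrightarrow> v x > lam" "deriv v xp > 0" "deriv v xm < 0"
    "\<exists>\<eta>>0. \<exists>R. \<forall>x. \<bar>x\<bar> \<ge> R \<longrightarrow> v x - lam \<ge> \<eta>"
    "\<exists>r>0. r \<le> xp - xm \<and> (\<forall>x0\<in>{xm, xp}. \<forall>x. \<bar>x - x0\<bar> < r \<longrightarrow>
       (deriv (deriv v) has_real_derivative deriv (deriv (deriv v)) x) (at x) \<and> isCont (deriv (deriv (deriv v))) x)"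
proof -
  show lt: "xm < xp" and "deriv v xp > 0" "deriv v xm < 0"
    "\<And>x. xm < x \<Longrightarrow> x < xp \<Longrightarrow> v x < lam" "\<And>x. x > xp \<Longrightarrow> v x > lam" "\<And>x. x < xm \<Longrightarrow> v x > lam"
    using assms by (auto simp: assumption_B_def)
  have "{x. v x = lam} = {xm, xp}" using assms by (auto simp: assumption_B_def)
  then show "v xm = lam" "v xp = lam" by auto
  have "ereal lam < Liminf at_infinity (\<lambda>x. ereal (v x))" using assms by (simp add: assumption_B_def)
  then obtain l where l: "ereal lam < ereal l" "ereal l < Liminf at_infinity (\<lambda>x. ereal (v x))"
    using ereal_dense2 by blast
  from less_LiminfD[OF l(2)] obtain R where R: "\<And>x. \<bar>x\<bar> \<ge> R \<Longrightarrow> l < v x"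
    unfolding eventually_at_infinity by auto
  show "\<exists>\<eta>>0. \<exists>R. \<forall>x. \<bar>x\<bar> \<ge> R \<longrightarrow> v x - lam \<ge> \<eta>"
    using l(1) R by (intro exI[of _ "l - lam"] conjI exI[of _ R]) (auto dest!: R)
  have "\<exists>r>0. \<forall>x. \<bar>x - x0\<bar> < r \<longrightarrow>
       (deriv (deriv v) has_real_derivative deriv (deriv (deriv v)) x) (at x) \<and> isCont (deriv (deriv (deriv v))) x"
    if "x0 \<in> {xm, xp}" for x0
  proof -
    have "x0 = xm \<or> x0 = xp" using that by simp
    then have "\<exists>U. open U \<and> x0 \<in> U \<and> C_k_on 3 v U"
      using assms unfolding assumption_B_def by (elim disjE) blast+
    then obtain U where U: "open U" "x0 \<in> U" "C_k_on 3 v U" by blast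
    obtain r where r: "r > 0" "ball x0 r \<subseteq> U" using U open_contains_ball by blast
    have "(deriv (deriv v) has_real_derivative deriv (deriv (deriv v)) x) (at x) \<and> isCont (deriv (deriv (deriv v))) x"
      if "\<bar>x - x0\<bar> < r" for x
    proof
      have xU: "x \<in> U" using that r by (auto simp: dist_real_def abs_minus_commute)
      have "\<forall>j<3. \<forall>x\<in>U. (deriv ^^ j) v differentiable (at x)" using U(3) by (simp add: C_k_on_def)
      from this[rule_format, of 2 x] xU
      show "(deriv (deriv v) has_real_derivative deriv (deriv (deriv v)) x) (at x)"
        by (simp add: eval_nat_numeral DERIV_deriv_iff_real_differentiable)
      have "\<forall>j\<le>3. continuous_on U ((deriv ^^ j) v)" using U(3) by (simp add: C_k_on_def)
      from this[rule_format, of 3] have "continuous_on U (deriv (deriv (deriv v)))" by (simp add: eval_nat_numeral)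
      then show "isCont (deriv (deriv (deriv v))) x" using U(1) xU by (simp add: continuous_on_eq_continuous_at)
    qed
    then show ?thesis using r by blast
  qed
  from this[of xm] this[of xp] obtain r1 r2 where r12: "r1 > 0" "r2 > 0"
    "\<And>x. \<bar>x - xm\<bar> < r1 \<Longrightarrow> (deriv (deriv v) has_real_derivative deriv (deriv (deriv v)) x) (at x) \<and> isCont (deriv (deriv (deriv v))) x"
    "\<And>x. \<bar>x - xp\<bar> < r2 \<Longrightarrow> (deriv (deriv v) has_real_derivative deriv (deriv (deriv v)) x) (at x) \<and> isCont (deriv (deriv (deriv v))) x"
    by auto
  show "\<exists>r>0. r \<le> xp - xm \<and> (\<forall>x0\<in>{xm, xp}. \<forall>x. \<bar>x - x0\<bar> < r \<longrightarrow>
       (deriv (deriv v) has_real_derivative deriv (deriv (deriv v)) x) (at x) \<and> isCont (deriv (deriv (deriv v))) x)"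
    using r12 lt by (intro exI[of _ "min (xp - xm) (min r1 r2)"]) auto
qed

text \<open>Reflection makes - xm a right turning point with left neighbour - xp; derivatives of odd
  order change sign. Both assumptions are stated in \<bar>x\<bar> at infinity, so one choice of
  parameters serves both instances.\<close>

lemma turning_points:
  assumes A: "assumption_A v lam rho0" and B: "assumption_B v lam xm xp"
  obtains r M R \<eta> where
    "decaying_turning_point (\<lambda>x. v x - lam) (deriv v) (deriv (deriv v)) (deriv (deriv (deriv v))) xm xp r rho0 M R \<eta>"
    "decaying_turning_point (\<lambda>x. v (- x) - lam) (\<lambda>x. - deriv v (- x)) (\<lambda>x. deriv (deriv v) (- x))
      (\<lambda>x. - deriv (deriv (deriv v)) (- x)) (- xp) (- xm) r rho0 M R \<eta>"
proof -
  note a = assumption_A_D[OF A]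
  note b = assumption_B_D[OF B]
  obtain M R1 where M: "\<And>x. \<bar>x\<bar> \<ge> R1 \<Longrightarrow> ((deriv v x)\<^sup>2 / \<bar>v x - lam\<bar> ^ 3 + \<bar>deriv (deriv v) x\<bar> / (v x - lam)\<^sup>2)
      * \<bar>LBINT y=0..x. sqrt \<bar>v y - lam\<bar>\<bar> powr rho0 \<le> M" using a(6) by blast
  obtain \<eta> R2 where \<eta>: "\<eta> > 0" "\<And>x. \<bar>x\<bar> \<ge> R2 \<Longrightarrow> v x - lam \<ge> \<eta>" using b(9) by blast
  obtain r where r: "r > 0" "r \<le> xp - xm"
    "\<And>x0 x. x0 \<in> {xm, xp} \<Longrightarrow> \<bar>x - x0\<bar> < r \<Longrightarrow>
       (deriv (deriv v) has_real_derivative deriv (deriv (deriv v)) x) (at x)"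
    "\<And>x0 x. x0 \<in> {xm, xp} \<Longrightarrow> \<bar>x - x0\<bar> < r \<Longrightarrow> isCont (deriv (deriv (deriv v))) x" using b(10) by blast
  define R where "R = max R1 R2"
  have RR: "R1 \<le> \<bar>x\<bar>" "R2 \<le> \<bar>x\<bar>" "R1 \<le> \<bar>- x\<bar>" "R2 \<le> \<bar>- x\<bar>" if "x \<ge> R" for x
    using that order_trans[OF _ abs_ge_self[of x]] by (auto simp: R_def)
  have chain: "((\<lambda>x. f (- x)) has_real_derivative - f') (at x)" if "(f has_real_derivative f') (at (- x))"
    for f :: "real \<Rightarrow> real" and f' x
    using that by (simp add: DERIV_mirror)
  show thesis
  proof (rule that[of r M R \<eta>])
    show "decaying_turning_point (\<lambda>x. v x - lam) (deriv v) (deriv (deriv v)) (deriv (deriv (deriv v))) xm xp r rho0 M R \<eta>"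
    proof
      show "((\<lambda>x. v x - lam) has_real_derivative deriv v x) (at x)" for x
        using a(1) by (auto intro!: derivative_eq_intros)
      show "continuous_on {xp - r<..<xp + r} (deriv (deriv (deriv v)))"
        by (intro continuous_at_imp_continuous_on ballI r(4)[of xp]) (auto simp: abs_less_iff)
      show "(deriv (deriv v) has_real_derivative deriv (deriv (deriv v)) x) (at x)" if "\<bar>x - xp\<bar> < r" for x
        by (rule r(3)[OF _ that]) simp
      show "((deriv v x)\<^sup>2 / \<bar>v x - lam\<bar> ^ 3 + \<bar>deriv (deriv v) x\<bar> / (v x - lam)\<^sup>2) *
          \<bar>LBINT y=0..ereal x. sqrt \<bar>v y - lam\<bar>\<bar> powr rho0 \<le> M" if "x \<ge> R" for x
        by (rule M[OF RR(1)[OF that]])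
      show "v x - lam \<ge> \<eta>" if "x \<ge> R" for x
        by (rule \<eta>(2)[OF RR(2)[OF that]])
    qed (use a(1-5) b(1-8) r(1,2) \<eta>(1) in auto)
    show "decaying_turning_point (\<lambda>x. v (- x) - lam) (\<lambda>x. - deriv v (- x)) (\<lambda>x. deriv (deriv v) (- x))
      (\<lambda>x. - deriv (deriv (deriv v)) (- x)) (- xp) (- xm) r rho0 M R \<eta>"
    proof
      show "((\<lambda>x. v (- x) - lam) has_real_derivative - deriv v (- x)) (at x)" for x
        using DERIV_diff[OF chain[OF a(1)] DERIV_const] by simp
      show "((\<lambda>x. - deriv v (- x)) has_real_derivative deriv (deriv v) (- x)) (at x)" for x
        using DERIV_minus[OF chain[OF a(2)]] by simp
      show "continuous_on UNIV (\<lambda>x. deriv (deriv v) (- x))"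
        by (rule continuous_on_compose2[OF a(3)]) (auto intro: continuous_intros)
      show "((\<lambda>x. deriv (deriv v) (- x)) has_real_derivative - deriv (deriv (deriv v)) (- x)) (at x)"
        if "\<bar>x - - xm\<bar> < r" for x
        by (rule chain[OF r(3)[of xm]]) (use that in \<open>auto simp: abs_less_iff\<close>)
      show "continuous_on {- xm - r<..<- xm + r} (\<lambda>x. - deriv (deriv (deriv v)) (- x))"
        by (intro continuous_at_imp_continuous_on ballI continuous_intros isCont_o2[OF _ r(4)[of xm]])
          (auto simp: abs_less_iff)
      show "((- deriv v (- x))\<^sup>2 / \<bar>v (- x) - lam\<bar> ^ 3 + \<bar>deriv (deriv v) (- x)\<bar> / (v (- x) - lam)\<^sup>2) *
          \<bar>LBINT y=0..ereal x. sqrt \<bar>v (- y) - lam\<bar>\<bar> powr rho0 \<le> M" if "x \<ge> R" for x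
      proof -
        \<comment> \<open>The reflected integral is minus the one in Assumption A at - x, and only
          its absolute value matters.\<close>
        have "(LBINT y=0..ereal x. sqrt \<bar>v (- y) - lam\<bar>) = (LBINT y=- ereal x..0. sqrt \<bar>v y - lam\<bar>)"
          by (subst interval_integral_reflect) simp
        also have "\<dots> = - (LBINT y=0..ereal (- x). sqrt \<bar>v y - lam\<bar>)"
          by (subst interval_integral_endpoints_reverse) simp
        finally show ?thesis using M[OF RR(3)[OF that]] by simp
      qed
      show "v (- x) - lam \<ge> \<eta>" if "x \<ge> R" for x
        by (rule \<eta>(2)[OF RR(4)[OF that]])
    qed (use a(1-5) b(1-8) r(1,2) \<eta>(1) in auto)
  qed
qed

text \<open>To the right of \<open>xp\<close> the absolute value under the root is idle, so the
  asymptotic forms agree eventually and the two definite descriptions describe the same function for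
  every h.\<close>

lemma u_plus_estimates:
  assumes "decaying_turning_point (\<lambda>x. v x - lam) q1 q2 q3 xm xp r rho0 M R \<eta>"
    and v: "continuous_on UNIV v"
  shows "\<exists>h0>0. \<forall>x1\<in>{xm<..<xp}. \<exists>C. \<forall>h. 0 < h \<and> h \<le> h0 \<longrightarrow>
    airy_estimate (u_plus v lam xp h) (xi_plus v lam xp) h (3/2 * min (rho0 - 1) 1) xp {xp..} {x1..xp} C"
proof -
  interpret tp: decaying_turning_point "\<lambda>x. v x - lam" q1 q2 q3 xm xp r rho0 M R \<eta> by fact
  have int: "(LBINT y=xp..x. sqrt (v y - lam)) = tp.S x" if "x \<ge> xp" for x
    unfolding tp.S_def
    by (rule interval_integral_cong) (use that tp.q_pos in \<open>force simp: einterval_def min_def max_def\<close>)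
  have xi: "xi_plus v lam xp = tp.xi"
  proof
    fix x
    have "(LBINT y=x..xp. sqrt \<bar>v y - lam\<bar>) = - tp.S x"
      unfolding tp.S_def by (rule interval_integral_endpoints_reverse)
    then show "xi_plus v lam xp x = tp.xi x"
      unfolding xi_plus_def tp.xi_def using int by auto
  qed
  have u: "u_plus v lam xp h = tp.recessive h" for h
  proof -
    have "eventually (\<lambda>x. 1 / (2 * sqrt pi) * h powr (1/6) * (v x - lam) powr (-1/4)
        * exp (- (1 / h) * (LBINT y=xp..x. sqrt (v y - lam))) = tp.wkb h x) at_top"
      using eventually_ge_at_top[of xp] by eventually_elim (simp add: int tp.wkb_def)
    then have "u \<sim>[at_top] (\<lambda>x. 1 / (2 * sqrt pi) * h powr (1/6) * (v x - lam) powr (-1/4)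
        * exp (- (1 / h) * (LBINT y=xp..x. sqrt (v y - lam)))) \<longleftrightarrow> u \<sim>[at_top] tp.wkb h" for u
      by (intro asymp_equiv_cong) auto
    then show ?thesis unfolding u_plus_def tp.recessive_def schroedinger_sol_iff[OF v] by simp
  qed
  obtain h0 where "h0 > 0" and h0: "\<And>x1. x1 \<in> {xm<..<xp} \<Longrightarrow> \<exists>C. \<forall>h. 0 < h \<and> h \<le> h0 \<longrightarrow>
      airy_estimate (tp.recessive h) tp.xi h tp.rho xp {xp..} {x1..xp} C"
    by (rule tp.recessive_estimates) (rule that)
  then show ?thesis unfolding u xi tp.rho_def by blast
qed

text \<open>The description of \<open>u_minus\<close> ranges over functions on the unreflected line,
  so it is identified through existence and uniqueness. Hence the identification is made for h \<le>
  h0, where existence is known.\<close>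

lemma u_minus_estimates:
  assumes "decaying_turning_point (\<lambda>x. v (- x) - lam) q1 q2 q3 (- xp) (- xm) r rho0 M R \<eta>"
    and v: "continuous_on UNIV v"
  shows "\<exists>h0>0. \<forall>x1\<in>{xm<..<xp}. \<exists>C. \<forall>h. 0 < h \<and> h \<le> h0 \<longrightarrow>
    airy_estimate (u_minus v lam xm h) (xi_minus v lam xm) h (3/2 * min (rho0 - 1) 1) xm {..xm} {xm..x1} C"
proof -
  interpret tp: decaying_turning_point "\<lambda>x. v (- x) - lam" q1 q2 q3 "- xp" "- xm" r rho0 M R \<eta> by fact
  have int: "(LBINT y=x..xm. sqrt (v y - lam)) = tp.S (- x)" if "x \<le> xm" for x
  proof -
    have "(LBINT y=x..xm. sqrt (v y - lam)) = (LBINT y=- ereal xm..- ereal x. sqrt (v (- y) - lam))"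
      by (rule interval_integral_reflect)
    also have "\<dots> = tp.S (- x)"
      unfolding tp.S_def uminus_ereal.simps
      by (rule interval_integral_cong) (use that tp.q_pos in \<open>force simp: einterval_def min_def max_def\<close>)
    finally show ?thesis .
  qed
  have xi: "xi_minus v lam xm = (\<lambda>x. tp.xi (- x))"
  proof
    fix x
    have "(LBINT y=xm..x. sqrt \<bar>v y - lam\<bar>) = (LBINT y=- ereal x..- ereal xm. sqrt \<bar>v (- y) - lam\<bar>)"
      by (rule interval_integral_reflect)
    also have "\<dots> = - tp.S (- x)"
      unfolding tp.S_def uminus_ereal.simps by (rule interval_integral_endpoints_reverse)
    finally show "xi_minus v lam xm x = tp.xi (- x)"
      unfolding xi_minus_def tp.xi_def using int by auto
  qed
  obtain h0 where h0: "h0 > 0"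
    "\<And>h. 0 < h \<Longrightarrow> h \<le> h0 \<Longrightarrow> (\<exists>u'. linear_ode_sol (\<lambda>x. (v (- x) - lam) / h\<^sup>2) (tp.recessive h) u') \<and> tp.recessive h \<sim>[at_top] tp.wkb h"
    "\<And>x1. x1 \<in> {- xp<..<- xm} \<Longrightarrow> \<exists>C. \<forall>h. 0 < h \<and> h \<le> h0 \<longrightarrow>
      airy_estimate (tp.recessive h) tp.xi h tp.rho (- xm) {- xm..} {x1..- xm} C"
    by (rule tp.recessive_estimates) (rule that)
  have u: "u_minus v lam xm h = (\<lambda>x. tp.recessive h (- x))" if h: "0 < h" "h \<le> h0" for h
  proof -
    let ?f = "\<lambda>x. 1 / (2 * sqrt pi) * h powr (1/6) * (v x - lam) powr (-1/4)
        * exp ((1 / h) * (LBINT y=xm..x. sqrt (v y - lam)))"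
    have "eventually (\<lambda>x. ?f x = tp.wkb h (- x)) at_bot"
      using eventually_le_at_bot[of xm]
    proof eventually_elim
      case (elim x)
      have "(LBINT y=xm..x. sqrt (v y - lam)) = - tp.S (- x)"
        by (subst interval_integral_endpoints_reverse) (simp add: int[OF elim])
      then show ?case by (simp add: tp.wkb_def)
    qed
    then have f_iff: "w \<sim>[at_bot] ?f \<longleftrightarrow> w \<sim>[at_bot] (\<lambda>x. tp.wkb h (- x))" for w
      by (intro asymp_equiv_cong) auto
    obtain u' where u': "linear_ode_sol (\<lambda>x. (v (- x) - lam) / h\<^sup>2) (tp.recessive h) u'"
      and asymp: "tp.recessive h \<sim>[at_top] tp.wkb h"
      using h0(2)[OF h] by blast
    show ?thesis
      unfolding u_minus_def
    proof (rule the_equality, unfold f_iff schroedinger_sol_iff[OF v])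
      show "(\<exists>u'. linear_ode_sol (\<lambda>x. (v x - lam) / h\<^sup>2) (\<lambda>x. tp.recessive h (- x)) u') \<and>
          (\<lambda>x. tp.recessive h (- x)) \<sim>[at_bot] (\<lambda>x. tp.wkb h (- x))"
        using linear_ode_sol_reflect[OF u'] asymp_equiv_compose'[OF asymp filterlim_uminus_at_top_at_bot] by auto
      fix w assume w: "(\<exists>u'. linear_ode_sol (\<lambda>x. (v x - lam) / h\<^sup>2) w u') \<and> w \<sim>[at_bot] (\<lambda>x. tp.wkb h (- x))"
      then obtain w' where "linear_ode_sol (\<lambda>x. (v x - lam) / h\<^sup>2) w w'" by blast
      from linear_ode_sol_reflect[OF this]
      have "linear_ode_sol (\<lambda>x. (v (- x) - lam) / h\<^sup>2) (\<lambda>x. w (- x)) (\<lambda>x. - w' (- x))" .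
      moreover have "(\<lambda>x. w (- x)) \<sim>[at_top] tp.wkb h"
        using asymp_equiv_compose'[OF conjunct2[OF w] filterlim_uminus_at_bot_at_top] by simp
      ultimately have "tp.recessive h = (\<lambda>x. w (- x))" by (rule tp.recessive_eqI[OF h(1)])
      then show "w = (\<lambda>x. tp.recessive h (- x))" by simp
    qed
  qed
  show ?thesis
  proof (rule exI[of _ h0], intro conjI h0(1) ballI)
    fix x1 assume x1: "x1 \<in> {xm<..<xp}"
    then have "- x1 \<in> {- xp<..<- xm}" by simp
    from h0(3)[OF this] obtain C where C: "\<And>h. 0 < h \<Longrightarrow> h \<le> h0 \<Longrightarrow>
      airy_estimate (tp.recessive h) tp.xi h tp.rho (- xm) {- xm..} {- x1..- xm} C" by blast
    have "airy_estimate (u_minus v lam xm h) (xi_minus v lam xm) h (3/2 * min (rho0 - 1) 1) xm {..xm} {xm..x1} C"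
      if h: "0 < h" "h \<le> h0" for h
    proof -
      have "(tp.xi has_real_derivative deriv tp.xi x) (at x)" if "x \<in> {- xm..} \<union> {- x1..- xm}" for x
      proof -
        have "(tp.xi has_real_derivative tp.P x powr (-1/2)) (at x)"
          by (rule tp.xi_deriv) (use that x1 in auto)
        then show ?thesis using DERIV_imp_deriv by metis
      qed
      from airy_estimate_reflect[OF C[OF h] this] show ?thesis
        by (simp add: u[OF h] xi tp.rho_def)
    qed
    then show "\<exists>C. \<forall>h. 0 < h \<and> h \<le> h0 \<longrightarrow>
        airy_estimate (u_minus v lam xm h) (xi_minus v lam xm) h (3/2 * min (rho0 - 1) 1) xm {..xm} {xm..x1} C"
      by blast
  qed
qed

theorem theorem2p5:
  fixes v :: "real \<Rightarrow> real" and lam rho0 xm xp :: real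
  assumes A: "assumption_A v lam rho0" and B: "assumption_B v lam xm xp"
  shows "let rho = 3/2 * min (rho0 - 1) 1 in
    \<exists>h0>0. \<forall>x1\<in>{xm<..<xp}. \<exists>C. \<forall>h. 0 < h \<and> h \<le> h0 \<longrightarrow>
      (\<exists>eps :: real \<Rightarrow> real. \<forall>x\<ge>xp.
         u_plus v lam xp h x =
           \<bar>deriv (xi_plus v lam xp) x\<bar> powr (-1/2) * Ai (h powr (-2/3) * xi_plus v lam xp x)
             * (1 + eps x) \<and>
         \<bar>eps x\<bar> \<le> C * h * (1 + \<bar>xi_plus v lam xp x\<bar>) powr (- rho)) \<and>
      (\<exists>eps :: real \<Rightarrow> real. \<forall>x\<le>xm.
         u_minus v lam xm h x =
           \<bar>deriv (xi_minus v lam xm) x\<bar> powr (-1/2) * Ai (h powr (-2/3) * xi_minus v lam xm x)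
             * (1 + eps x) \<and>
         \<bar>eps x\<bar> \<le> C * h * (1 + \<bar>xi_minus v lam xm x\<bar>) powr (- rho)) \<and>
      (\<forall>x\<in>{x1..xp}.
         \<bar>u_plus v lam xp h x -
            \<bar>deriv (xi_plus v lam xp) x\<bar> powr (-1/2) * Ai (h powr (-2/3) * xi_plus v lam xp x)\<bar>
         \<le> C * h powr (7/6) * (h powr (2/3) + \<bar>x - xp\<bar>) powr (-1/4)) \<and>
      (\<forall>x\<in>{xm..x1}.
         \<bar>u_minus v lam xm h x -
            \<bar>deriv (xi_minus v lam xm) x\<bar> powr (-1/2) * Ai (h powr (-2/3) * xi_minus v lam xm x)\<bar>
         \<le> C * h powr (7/6) * (h powr (2/3) + \<bar>x - xm\<bar>) powr (-1/4))"
proof -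
  define rho where "rho = 3/2 * min (rho0 - 1) 1"
  have v: "continuous_on UNIV v" by (rule assumption_A_D(4)[OF A])
  obtain r M R \<eta> where tp:
    "decaying_turning_point (\<lambda>x. v x - lam) (deriv v) (deriv (deriv v)) (deriv (deriv (deriv v))) xm xp r rho0 M R \<eta>"
    "decaying_turning_point (\<lambda>x. v (- x) - lam) (\<lambda>x. - deriv v (- x)) (\<lambda>x. deriv (deriv v) (- x))
      (\<lambda>x. - deriv (deriv (deriv v)) (- x)) (- xp) (- xm) r rho0 M R \<eta>"
    using turning_points[OF A B] by blast
  let ?p = "\<lambda>h. airy_estimate (u_plus v lam xp h) (xi_plus v lam xp) h rho xp {xp..}"
  let ?m = "\<lambda>h. airy_estimate (u_minus v lam xm h) (xi_minus v lam xm) h rho xm {..xm}"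
  obtain hp where hp: "hp > 0" "\<And>x1. x1 \<in> {xm<..<xp} \<Longrightarrow> \<exists>C. \<forall>h. 0 < h \<and> h \<le> hp \<longrightarrow> ?p h {x1..xp} C"
    using u_plus_estimates[OF tp(1) v, folded rho_def] by blast
  obtain hm where hm: "hm > 0" "\<And>x1. x1 \<in> {xm<..<xp} \<Longrightarrow> \<exists>C. \<forall>h. 0 < h \<and> h \<le> hm \<longrightarrow> ?m h {xm..x1} C"
    using u_minus_estimates[OF tp(2) v, folded rho_def] by blast
  have "\<exists>C. \<forall>h. 0 < h \<and> h \<le> min hp hm \<longrightarrow> ?p h {x1..xp} C \<and> ?m h {xm..x1} C" if x1: "x1 \<in> {xm<..<xp}" for x1
  proof -
    obtain C where C: "\<And>h. 0 < h \<Longrightarrow> h \<le> hp \<Longrightarrow> ?p h {x1..xp} C" using hp(2)[OF x1] by blast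
    obtain D where D: "\<And>h. 0 < h \<Longrightarrow> h \<le> hm \<Longrightarrow> ?m h {xm..x1} D" using hm(2)[OF x1] by blast
    have "?p h {x1..xp} (max C D) \<and> ?m h {xm..x1} (max C D)" if h: "0 < h" "h \<le> min hp hm" for h
      using airy_estimate_mono[OF C _ h(1)] airy_estimate_mono[OF D _ h(1)] h by simp
    then show ?thesis by blast
  qed
  moreover have "min hp hm > 0" using hp hm by simp
  ultimately have "\<exists>h0>0. \<forall>x1\<in>{xm<..<xp}. \<exists>C. \<forall>h. 0 < h \<and> h \<le> h0 \<longrightarrow> ?p h {x1..xp} C \<and> ?m h {xm..x1} C"
    by blast
  then show ?thesis
    unfolding Let_def rho_def[symmetric] airy_estimate_def Ball_def atLeast_iff atMost_iff by (simp only: conj_ac)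
qed

end
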